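(* Let $n\ge 1$, $s\ge 1$, and $H=(-\Delta)^{\frac s2}$ on $L^2(\mathbb{R}^n)$. Then one can find a sequence of functions $\{f_k\}_{k\in\mathbb{Z}}\subset L^2(\mathbb{R}^n)$ with $$\int_{\mathbb{R}^n}|f_k|^2\,dx=1\quad\text{for all }k,$$ and there exists some $\sigma>0$, such that for any $t>0$ and any fixed $r_1>0$, $$\lim_{k\to\infty}\int_{|x|\ge r_1}|f_k|^2\,dx=\lim_{k\to\infty}\int_{|x|\le\sigma t}|e^{it(-\Delta)^{\frac s2}}f_k|^2\,dx=0.$$
   Context: $(-\Delta)^{s/2}$ is the self-adjoint operator on $L^2(\mathbb{R}^n)$ with domain the Sobolev space $H^s(\mathbb{R}^n)$ given by the Fourier multiplier $|\xi|^s$. *)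

theory Defs
  imports "HOL-Analysis.Analysis"
begin

text \<open>
  Elements of \<open>L\<^sup>2\<close> are represented by Borel functions; no quotient by almost-everywhere equality is
  formed, so equations between elements of \<open>L\<^sup>2\<close> are stated with \<open>AE\<close>.
\<close>

definition L2 :: "('a::euclidean_space \<Rightarrow> complex) set" where
  "L2 = {f. f \<in> borel_measurable lborel \<and> integrable lborel (\<lambda>x. (cmod (f x))\<^sup>2)}"

definition l2_norm :: "('a::euclidean_space \<Rightarrow> complex) \<Rightarrow> real" where
  "l2_norm f = sqrt (LINT x|lborel. (cmod (f x))\<^sup>2)"

definition fourier_integral :: "('a::euclidean_space \<Rightarrow> complex) \<Rightarrow> 'a \<Rightarrow> complex" where
  "fourier_integral f \<xi> =
     (2 * pi) powr (- real DIM('a) / 2) *\<^sub>R (LINT x|lborel. cis (- (x \<bullet> \<xi>)) * f x)"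

text \<open>
  The Fourier--Plancherel transform on \<open>L\<^sup>2\<close>, as a relation: \<open>g\<close> is the limit in \<open>L\<^sup>2\<close> of the Fourier
  integrals of the truncations of \<open>f\<close> to large balls, which are integrable. The squared distance is
  an \<open>ennreal\<close>-valued integral, so that it is \<open>\<infinity>\<close> rather than \<open>0\<close> when it diverges.
\<close>

definition fourier_L2 ::
    "('a::euclidean_space \<Rightarrow> complex) \<Rightarrow> ('a \<Rightarrow> complex) \<Rightarrow> bool" where
  "fourier_L2 f g \<longleftrightarrow> f \<in> L2 \<and> g \<in> L2 \<and>
     ((\<lambda>R::real. \<integral>\<^sup>+ \<xi>. ennreal ((cmod (fourier_integral
          (\<lambda>x. indicat_real (cball 0 R) x *\<^sub>R f x) \<xi> - g \<xi>))\<^sup>2) \<partial>lborel) \<longlongrightarrow> 0) at_top"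

definition sobolev :: "real \<Rightarrow> ('a::euclidean_space \<Rightarrow> complex) set" where
  "sobolev s = {f \<in> L2. \<exists>g. fourier_L2 f g \<and>
     (\<lambda>\<xi>. (1 + (norm \<xi>)\<^sup>2) powr (s / 2) *\<^sub>R g \<xi>) \<in> L2}"

text \<open>An unbounded operator on \<open>L\<^sup>2\<close> is given by its graph, a relation closed under \<open>AE\<close>-equality.\<close>

type_synonym 'a L2_operator = "('a \<Rightarrow> complex) \<Rightarrow> ('a \<Rightarrow> complex) \<Rightarrow> bool"

definition frac_laplacian :: "real \<Rightarrow> 'a::euclidean_space L2_operator" where
  "frac_laplacian s f g \<longleftrightarrow> f \<in> sobolev s \<and> g \<in> L2 \<and>
     (\<exists>fh gh. fourier_L2 f fh \<and> fourier_L2 g gh \<and>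
        (AE \<xi> in lborel. gh \<xi> = norm \<xi> powr s *\<^sub>R fh \<xi>))"

definition unitary_group ::
    "(real \<Rightarrow> ('a::euclidean_space \<Rightarrow> complex) \<Rightarrow> ('a \<Rightarrow> complex)) \<Rightarrow> bool" where
  "unitary_group U \<longleftrightarrow>
     (\<forall>t. \<forall>f\<in>L2. U t f \<in> L2 \<and> l2_norm (U t f) = l2_norm f) \<and>
     (\<forall>t. \<forall>f\<in>L2. \<forall>g\<in>L2. \<forall>a b.
        AE x in lborel. U t (\<lambda>y. a * f y + b * g y) x = a * U t f x + b * U t g x) \<and>
     (\<forall>f\<in>L2. AE x in lborel. U 0 f x = f x) \<and>
     (\<forall>t u. \<forall>f\<in>L2. AE x in lborel. U (t + u) f x = U t (U u f) x) \<and>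
     (\<forall>f\<in>L2. ((\<lambda>t. l2_norm (\<lambda>x. U t f x - f x)) \<longlongrightarrow> 0) (at 0))"

text \<open>
  For a self-adjoint operator \<open>H\<close>, the family \<open>e\<^bsup>itH\<^esup>\<close> is by Stone's theorem the strongly continuous
  unitary group with infinitesimal generator \<open>iH\<close> (with equality of domains); it is unique up to
  \<open>AE\<close>-equality.
\<close>

definition generates :: "'a::euclidean_space L2_operator \<Rightarrow>
    (real \<Rightarrow> ('a \<Rightarrow> complex) \<Rightarrow> ('a \<Rightarrow> complex)) \<Rightarrow> bool" where
  "generates H U \<longleftrightarrow> unitary_group U \<and>
     (\<forall>f\<in>L2. \<forall>g\<in>L2. H f g \<longleftrightarrow>
        ((\<lambda>h. l2_norm (\<lambda>x. (U h f x - f x) / of_real h - \<i> * g x)) \<longlongrightarrow> 0) (at 0))"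

definition exp_i :: "real \<Rightarrow> 'a::euclidean_space L2_operator \<Rightarrow> ('a \<Rightarrow> complex) \<Rightarrow> ('a \<Rightarrow> complex)" where
  "exp_i t H = (SOME U. generates H U) t"

end

theory Submission
  imports Defs "HOL-Probability.Probability"
begin

text \<open>
  In Fourier space \<open>H = (-\<Delta>)\<^bsup>s/2\<^esup>\<close> is multiplication by \<open>w \<xi> = |\<xi>|\<^sup>s\<close> and \<open>e\<^bsup>itH\<^esup>\<close> is
  multiplication by \<open>cis (t * w \<xi>)\<close>, so a wave at frequency \<open>\<xi>\<close> travels with velocity
  \<open>- \<nabla>w \<xi> = - s |\<xi>|\<^bsup>s-2\<^esup> \<xi>\<close>, whose length does not decay as \<open>|\<xi>|\<close> grows because \<open>s \<ge> 1\<close>.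
  Fix a unit vector \<open>e\<close> and let \<open>B\<close> be the unit ball around \<open>2e\<close>. The function \<open>f\<^sub>k\<close> is the
  one whose transform is the normalised indicator of \<open>k B\<close>. Spreading the frequencies over a set of
  size \<open>k\<close> squeezes \<open>f\<^sub>k\<close> to the scale \<open>1/k\<close> around the origin; and as all these frequencies have a
  component along \<open>e\<close> comparable to their length, all but a vanishing part of the wave is outside the
  ball of radius \<open>t/4\<close> at time \<open>t\<close>.

  Both limits are instances of one statement about the random variable \<open>(x \<bullet> e) / \<tau>\<close> when \<open>x\<close>
  has density \<open>|u|\<^sup>2\<close> (\<open>packet_position_limit\<close>). By Parseval and since modulation becomes
  translation, its characteristic function is a correlation of the transform of \<open>u\<close> with a small
  translate of itself (\<open>char_position_distr\<close>); for the packets at hand it becomes, after rescaling,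
  an integral over \<open>B\<close> of \<open>cis\<close> of a difference quotient of the phase. Passing to the limit under the
  integral gives the characteristic function of the rescaled velocity of a uniformly distributed
  frequency in \<open>B\<close>, and Levy's continuity theorem turns this into convergence of distributions.
  The limit is \<open>0\<close> for \<open>f\<^sub>k\<close> itself and stays at distance at least \<open>1/3\<close> from \<open>0\<close> for \<open>e\<^bsup>itH\<^esup> f\<^sub>k\<close> with
  \<open>\<tau> = t k\<^bsup>s-1\<^esup>\<close>.

  To know what \<open>e\<^bsup>itH\<^esup>\<close> is, two things are needed. First, that a group generated by \<open>i H\<close> exists:
  this is the Fourier multiplier (\<open>phase_group_generates\<close>), which rests on the
  Fourier--Plancherel transform being a unitary bijection of \<open>L\<^sup>2\<close>. Isometry on integrable functions
  (\<open>fourier_integral_isometry\<close>) comes from Gaussian regularisation and approximation by continuous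
  functions; it extends to \<open>L\<^sup>2\<close> by a Riesz--Fischer argument (\<open>fourier_L2_exists\<close>); and surjectivity
  follows from isometry and the symmetry of the kernel (\<open>fourier_L2_conj_inverse\<close>). Second, that any
  two groups with the same generator agree on its domain (\<open>generates_unique\<close>): the distance between
  the two orbits has derivative zero.
\<close>

section \<open>Square-integrable functions\<close>

lemma L2_measurable [measurable_dest]: "f \<in> L2 \<Longrightarrow> f \<in> borel_measurable borel"
  by (simp add: L2_def)

lemma L2_integrable: "f \<in> L2 \<Longrightarrow> integrable lborel (\<lambda>x. (cmod (f x))\<^sup>2)"
  by (simp add: L2_def)

lemma L2I: "f \<in> borel_measurable borel \<Longrightarrow> integrable lborel (\<lambda>x. (cmod (f x))\<^sup>2) \<Longrightarrow> f \<in> L2"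
  by (simp add: L2_def)

lemma l2_norm_nonneg [simp]: "0 \<le> l2_norm f"
  by (simp add: l2_norm_def)

lemma l2_norm_square: "(l2_norm f)\<^sup>2 = (LINT x|lborel. (cmod (f x))\<^sup>2)"
  by (simp add: l2_norm_def)

lemma nn_integral_L2:
  "f \<in> L2 \<Longrightarrow> (\<integral>\<^sup>+ x. ennreal ((cmod (f x))\<^sup>2) \<partial>lborel) = ennreal ((l2_norm f)\<^sup>2)"
  by (subst nn_integral_eq_integral) (auto simp: L2_integrable l2_norm_square)

lemma L2I_nn_integral:
  assumes "f \<in> borel_measurable borel"
    and "(\<integral>\<^sup>+ x. ennreal ((cmod (f x))\<^sup>2) \<partial>lborel) \<le> ennreal (C\<^sup>2)" and "0 \<le> C"
  shows "f \<in> L2" and "l2_norm f \<le> C"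
proof -
  show f: "f \<in> L2"
  proof (rule L2I)
    show "integrable lborel (\<lambda>x. (cmod (f x))\<^sup>2)"
      using assms by (intro integrableI_bounded) (auto simp: le_less_trans)
  qed (use assms in simp)
  have "(l2_norm f)\<^sup>2 \<le> C\<^sup>2"
    using assms(2) unfolding nn_integral_L2[OF f] by simp
  then show "l2_norm f \<le> C"
    using assms(3) by (rule power2_le_imp_le)
qed

lemma l2_norm_cong_AE:
  assumes "f \<in> borel_measurable borel" "g \<in> borel_measurable borel" "AE x in lborel. f x = g x"
  shows "l2_norm f = l2_norm g"
proof -
  have "(LINT x|lborel. (cmod (f x))\<^sup>2) = (LINT x|lborel. (cmod (g x))\<^sup>2)"
    using assms by (intro integral_cong_AE) auto
  then show ?thesis
    by (simp add: l2_norm_def)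
qed

lemma L2_bound:
  assumes f: "f \<in> L2" and g: "g \<in> borel_measurable borel"
    and le: "AE x in lborel. cmod (g x) \<le> C * cmod (f x)" and C: "0 \<le> C"
  shows "g \<in> L2" and "l2_norm g \<le> C * l2_norm f"
proof -
  have "(\<integral>\<^sup>+ x. ennreal ((cmod (g x))\<^sup>2) \<partial>lborel)
      \<le> (\<integral>\<^sup>+ x. ennreal (C\<^sup>2) * ennreal ((cmod (f x))\<^sup>2) \<partial>lborel)"
  proof (rule nn_integral_mono_AE)
    show "AE x in lborel. ennreal ((cmod (g x))\<^sup>2) \<le> ennreal (C\<^sup>2) * ennreal ((cmod (f x))\<^sup>2)"
      using le
    proof eventually_elim
      case (elim x)
      then have "(cmod (g x))\<^sup>2 \<le> (C * cmod (f x))\<^sup>2"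
        by (intro power_mono) auto
      then show ?case
        by (simp add: ennreal_mult[symmetric] power_mult_distrib)
    qed
  qed
  also have "\<dots> = ennreal ((C * l2_norm f)\<^sup>2)"
    using L2_measurable[OF f]
    by (subst nn_integral_cmult) (auto simp: nn_integral_L2[OF f] ennreal_mult[symmetric] power_mult_distrib)
  finally have *: "(\<integral>\<^sup>+ x. ennreal ((cmod (g x))\<^sup>2) \<partial>lborel) \<le> ennreal ((C * l2_norm f)\<^sup>2)" .
  show "g \<in> L2" "l2_norm g \<le> C * l2_norm f"
    using L2I_nn_integral[OF g *] C by auto
qed

lemma L2_cong_AE:
  assumes "f \<in> L2" "g \<in> borel_measurable borel" "AE x in lborel. f x = g x"
  shows "g \<in> L2"
  using assms by (intro L2_bound(1)[of f g 1]) auto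

lemma L2_cmult: "f \<in> L2 \<Longrightarrow> (\<lambda>x. c * f x) \<in> L2"
  by (rule L2_bound[of f _ "cmod c"]) (auto simp: norm_mult dest: L2_measurable)

lemma l2_norm_cmult: "l2_norm (\<lambda>x. c * f x) = cmod c * l2_norm f"
  by (simp add: l2_norm_def norm_mult power_mult_distrib real_sqrt_mult)

lemma measurable_cnj [measurable]:
  "f \<in> borel_measurable M \<Longrightarrow> (\<lambda>x. cnj (f x)) \<in> borel_measurable M"
  by (rule borel_measurable_continuous_on[where f=cnj]) (intro continuous_intros)

lemma L2_cnj: "f \<in> L2 \<Longrightarrow> (\<lambda>x. cnj (f x)) \<in> L2"
  by (rule L2_bound[of f _ 1]) (auto dest: L2_measurable)

lemma l2_norm_cnj: "l2_norm (\<lambda>x. cnj (f x)) = l2_norm f"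
  by (simp add: l2_norm_def)

lemma l2_norm_minus_commute: "l2_norm (\<lambda>x. f x - g x) = l2_norm (\<lambda>x. g x - f x)"
  by (simp add: l2_norm_def norm_minus_commute)

lemma L2_add:
  assumes f: "f \<in> L2" and g: "g \<in> L2"
  shows "(\<lambda>x. f x + g x) \<in> L2"
proof (rule L2I)
  show "(\<lambda>x. f x + g x) \<in> borel_measurable borel"
    using f g by (auto dest: L2_measurable)
  show "integrable lborel (\<lambda>x. (cmod (f x + g x))\<^sup>2)"
  proof (rule Bochner_Integration.integrable_bound)
    show "integrable lborel (\<lambda>x. 2 * (cmod (f x))\<^sup>2 + 2 * (cmod (g x))\<^sup>2)"
      using f g by (auto simp: L2_integrable)
    show "(\<lambda>x. (cmod (f x + g x))\<^sup>2) \<in> borel_measurable lborel"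
      using f g by (auto dest!: L2_measurable)
    show "AE x in lborel. norm ((cmod (f x + g x))\<^sup>2) \<le> norm (2 * (cmod (f x))\<^sup>2 + 2 * (cmod (g x))\<^sup>2)"
    proof (rule AE_I2)
      fix x
      have "(cmod (f x + g x))\<^sup>2 \<le> (cmod (f x) + cmod (g x))\<^sup>2"
        by (intro power_mono norm_triangle_ineq) auto
      also have "\<dots> \<le> 2 * (cmod (f x))\<^sup>2 + 2 * (cmod (g x))\<^sup>2"
        using sum_squares_bound[of "cmod (f x)" "cmod (g x)"] by (simp add: power2_sum)
      finally show "norm ((cmod (f x + g x))\<^sup>2) \<le> norm (2 * (cmod (f x))\<^sup>2 + 2 * (cmod (g x))\<^sup>2)"
        by simp
    qed
  qed
qed

lemma L2_diff:
  assumes "f \<in> L2" "g \<in> L2"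
  shows "(\<lambda>x. f x - g x) \<in> L2"
  using L2_add[OF assms(1) L2_cmult[OF assms(2), of "-1"]] by simp

lemma l2_norm_eq_0:
  assumes "f \<in> L2" "l2_norm f = 0"
  shows "AE x in lborel. f x = 0"
proof -
  have "(LINT x|lborel. (cmod (f x))\<^sup>2) = 0"
    using assms(2) by (simp add: l2_norm_def)
  then have "AE x in lborel. (cmod (f x))\<^sup>2 = 0"
    by (subst (asm) integral_nonneg_eq_0_iff_AE) (auto simp: L2_integrable[OF assms(1)])
  then show ?thesis
    by simp
qed

lemma L2_mult_integrable:
  assumes f: "f \<in> L2" and g: "g \<in> L2"
  shows "integrable lborel (\<lambda>x. f x * g x)"
proof (rule Bochner_Integration.integrable_bound)
  show "integrable lborel (\<lambda>x. (cmod (f x))\<^sup>2 + (cmod (g x))\<^sup>2)"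
    using f g by (auto simp: L2_integrable)
  show "(\<lambda>x. f x * g x) \<in> borel_measurable lborel"
    using f g by (auto dest!: L2_measurable)
  show "AE x in lborel. norm (f x * g x) \<le> norm ((cmod (f x))\<^sup>2 + (cmod (g x))\<^sup>2)"
  proof (rule AE_I2)
    fix x
    have "0 \<le> cmod (f x) * cmod (g x)" by simp
    moreover have "2 * (cmod (f x) * cmod (g x)) \<le> (cmod (f x))\<^sup>2 + (cmod (g x))\<^sup>2"
      using sum_squares_bound[of "cmod (f x)" "cmod (g x)"] by (simp add: mult.assoc)
    ultimately have "cmod (f x * g x) \<le> (cmod (f x))\<^sup>2 + (cmod (g x))\<^sup>2"
      unfolding norm_mult by linarith
    then show "norm (f x * g x) \<le> norm ((cmod (f x))\<^sup>2 + (cmod (g x))\<^sup>2)"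
      by simp
  qed
qed

text \<open>
  The weights \<open>b / (2a)\<close> and \<open>a / (2b)\<close> in the elementary inequality
  \<open>xy \<le> (b / (2a)) x\<^sup>2 + (a / (2b)) y\<^sup>2\<close> make both integrals on the right equal to half of the product of
  the norms; the case of a zero norm is separate.
\<close>

lemma integral_norm_mult_le:
  assumes f: "f \<in> L2" and g: "g \<in> L2"
  shows "(LINT x|lborel. cmod (f x) * cmod (g x)) \<le> l2_norm f * l2_norm g"
proof (cases "l2_norm f = 0 \<or> l2_norm g = 0")
  case True
  have m: "f \<in> borel_measurable borel" "g \<in> borel_measurable borel"
    using f g by (auto dest: L2_measurable)
  have "AE x in lborel. f x = 0 \<or> g x = 0"
    using True l2_norm_eq_0[OF f] l2_norm_eq_0[OF g] by (auto elim: eventually_mono)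
  then have "(LINT x|lborel. cmod (f x) * cmod (g x)) = (LINT x|(lborel::'a measure). 0)"
    using m by (intro integral_cong_AE) auto
  then show ?thesis
    using True by auto
next
  case False
  define a b where "a = l2_norm f" and "b = l2_norm g"
  have ab: "a > 0" "b > 0"
    using False l2_norm_nonneg[of f] l2_norm_nonneg[of g] by (auto simp: a_def b_def less_le)
  have "(LINT x|lborel. cmod (f x) * cmod (g x))
      \<le> (LINT x|lborel. b / (2 * a) * (cmod (f x))\<^sup>2 + a / (2 * b) * (cmod (g x))\<^sup>2)"
  proof (rule integral_mono)
    show "integrable lborel (\<lambda>x. cmod (f x) * cmod (g x))"
      using integrable_norm[OF L2_mult_integrable[OF f g]] by (simp add: norm_mult)
    show "integrable lborel (\<lambda>x. b / (2 * a) * (cmod (f x))\<^sup>2 + a / (2 * b) * (cmod (g x))\<^sup>2)"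
      using f g by (auto simp: L2_integrable)
    fix x
    have "0 \<le> (b * cmod (f x) - a * cmod (g x))\<^sup>2 / (2 * a * b)"
      using ab by simp
    also have "\<dots> = b / (2 * a) * (cmod (f x))\<^sup>2 + a / (2 * b) * (cmod (g x))\<^sup>2 - cmod (f x) * cmod (g x)"
      using ab by (simp add: power2_eq_square field_simps)
    finally show "cmod (f x) * cmod (g x) \<le> b / (2 * a) * (cmod (f x))\<^sup>2 + a / (2 * b) * (cmod (g x))\<^sup>2"
      by simp
  qed
  also have "\<dots> = b / (2 * a) * a\<^sup>2 + a / (2 * b) * b\<^sup>2"
    using f g by (simp add: L2_integrable a_def b_def l2_norm_square)
  also have "\<dots> = a * b"
    using ab by (simp add: power2_eq_square field_simps)
  finally show ?thesis
    by (simp add: a_def b_def)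
qed

lemma L2_Cauchy_Schwarz:
  assumes f: "f \<in> L2" and g: "g \<in> L2"
  shows "cmod (LINT x|lborel. f x * g x) \<le> l2_norm f * l2_norm g"
  using integral_norm_bound[of lborel "\<lambda>x. f x * g x"] integral_norm_mult_le[OF f g]
  by (simp add: norm_mult)

lemma l2_norm_triangle:
  assumes f: "f \<in> L2" and g: "g \<in> L2"
  shows "l2_norm (\<lambda>x. f x + g x) \<le> l2_norm f + l2_norm g"
proof (rule power2_le_imp_le)
  have "(l2_norm (\<lambda>x. f x + g x))\<^sup>2
      \<le> (LINT x|lborel. (cmod (f x))\<^sup>2 + (cmod (g x))\<^sup>2 + 2 * (cmod (f x) * cmod (g x)))"
    unfolding l2_norm_square
  proof (rule integral_mono)
    show "integrable lborel (\<lambda>x. (cmod (f x + g x))\<^sup>2)"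
      by (rule L2_integrable[OF L2_add[OF f g]])
    show "integrable lborel (\<lambda>x. (cmod (f x))\<^sup>2 + (cmod (g x))\<^sup>2 + 2 * (cmod (f x) * cmod (g x)))"
      using f g integrable_norm[OF L2_mult_integrable[OF f g]]
      by (auto simp: norm_mult L2_integrable)
    fix x
    have "(cmod (f x + g x))\<^sup>2 \<le> (cmod (f x) + cmod (g x))\<^sup>2"
      by (intro power_mono norm_triangle_ineq) auto
    then show "(cmod (f x + g x))\<^sup>2 \<le> (cmod (f x))\<^sup>2 + (cmod (g x))\<^sup>2 + 2 * (cmod (f x) * cmod (g x))"
      by (simp add: power2_sum)
  qed
  also have "\<dots> = (l2_norm f)\<^sup>2 + (l2_norm g)\<^sup>2 + 2 * (LINT x|lborel. cmod (f x) * cmod (g x))"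
    using f g integrable_norm[OF L2_mult_integrable[OF f g]]
    by (simp add: L2_integrable l2_norm_square norm_mult)
  also have "\<dots> \<le> (l2_norm f + l2_norm g)\<^sup>2"
    using integral_norm_mult_le[OF f g] by (simp add: power2_sum)
  finally show "(l2_norm (\<lambda>x. f x + g x))\<^sup>2 \<le> (l2_norm f + l2_norm g)\<^sup>2" .
qed simp

lemma l2_norm_triangle_diff:
  assumes "f \<in> L2" "g \<in> L2" "h \<in> L2"
  shows "l2_norm (\<lambda>x. f x - h x) \<le> l2_norm (\<lambda>x. f x - g x) + l2_norm (\<lambda>x. g x - h x)"
  using l2_norm_triangle[OF L2_diff[OF assms(1,2)] L2_diff[OF assms(2,3)]] by simp

lemma l2_norm_diff_abs:
  assumes f: "f \<in> L2" and g: "g \<in> L2"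
  shows "\<bar>l2_norm f - l2_norm g\<bar> \<le> l2_norm (\<lambda>x. f x - g x)"
  using l2_norm_triangle[OF L2_diff[OF f g] g] l2_norm_triangle[OF L2_diff[OF g f] f]
    l2_norm_minus_commute[of f g] by simp

lemma l2_norm_tendsto_0:
  fixes w :: "nat \<Rightarrow> 'a::euclidean_space \<Rightarrow> complex"
  assumes h: "h \<in> L2" and w: "\<And>i. w i \<in> borel_measurable borel"
    and lim: "AE x in lborel. (\<lambda>i. w i x) \<longlonglongrightarrow> 0"
    and le: "\<And>i. AE x in lborel. cmod (w i x) \<le> C * cmod (h x)"
  shows "(\<lambda>i. l2_norm (w i)) \<longlonglongrightarrow> 0"
proof -
  have "(\<lambda>i. LINT x|lborel. (cmod (w i x))\<^sup>2) \<longlonglongrightarrow> (LINT x|(lborel::'a measure). 0)"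
  proof (rule integral_dominated_convergence)
    show "integrable lborel (\<lambda>x. C\<^sup>2 * (cmod (h x))\<^sup>2)"
      using h by (simp add: L2_integrable)
    show "AE x in lborel. (\<lambda>i. (cmod (w i x))\<^sup>2) \<longlonglongrightarrow> 0"
      using lim by eventually_elim (auto intro!: tendsto_eq_intros)
    show "AE x in lborel. norm ((cmod (w i x))\<^sup>2) \<le> C\<^sup>2 * (cmod (h x))\<^sup>2" for i
      using le[of i]
    proof eventually_elim
      case (elim x)
      then have "(cmod (w i x))\<^sup>2 \<le> (C * cmod (h x))\<^sup>2"
        by (intro power_mono) auto
      then show ?case
        by (simp add: power_mult_distrib)
    qed
  qed (use w in auto)
  then have "(\<lambda>i. sqrt (LINT x|lborel. (cmod (w i x))\<^sup>2)) \<longlonglongrightarrow> sqrt 0"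
    by (intro tendsto_real_sqrt) simp
  then show ?thesis
    by (simp add: l2_norm_def)
qed


lemma tendsto_integral_mult:
  assumes u: "\<And>i. u i \<in> L2" "u' \<in> L2" "((\<lambda>i. l2_norm (\<lambda>x. u i x - u' x)) \<longlongrightarrow> 0) F"
    and v: "\<And>i. v i \<in> L2" "v' \<in> L2" "((\<lambda>i. l2_norm (\<lambda>x. v i x - v' x)) \<longlongrightarrow> 0) F"
  shows "((\<lambda>i. LINT x|lborel. u i x * v i x) \<longlongrightarrow> (LINT x|lborel. u' x * v' x)) F"
proof -
  have "cmod ((LINT x|lborel. u i x * v i x) - (LINT x|lborel. u' x * v' x))
      \<le> l2_norm (\<lambda>x. u i x - u' x) * (l2_norm (\<lambda>x. v i x - v' x) + l2_norm v')
        + l2_norm u' * l2_norm (\<lambda>x. v i x - v' x)" (is "?d i \<le> ?e i") for i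
  proof -
    have "(LINT x|lborel. u i x * v i x) - (LINT x|lborel. u' x * v' x)
        = (LINT x|lborel. u i x * v i x - u' x * v' x)"
      using u v by (simp add: L2_mult_integrable)
    also have "\<dots> = (LINT x|lborel. (u i x - u' x) * v i x + u' x * (v i x - v' x))"
      by (simp add: algebra_simps)
    also have "\<dots> = (LINT x|lborel. (u i x - u' x) * v i x) + (LINT x|lborel. u' x * (v i x - v' x))"
      using u v by (intro Bochner_Integration.integral_add L2_mult_integrable L2_diff) auto
    also have "cmod \<dots>
      \<le> l2_norm (\<lambda>x. u i x - u' x) * l2_norm (v i) + l2_norm u' * l2_norm (\<lambda>x. v i x - v' x)"
      by (intro norm_triangle_mono L2_Cauchy_Schwarz L2_diff u v)
    finally have "cmod ((LINT x|lborel. u i x * v i x) - (LINT x|lborel. u' x * v' x))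
      \<le> l2_norm (\<lambda>x. u i x - u' x) * l2_norm (v i) + l2_norm u' * l2_norm (\<lambda>x. v i x - v' x)" .
    moreover have "l2_norm (v i) \<le> l2_norm (\<lambda>x. v i x - v' x) + l2_norm v'"
      using l2_norm_triangle[OF L2_diff[OF v(1)[of i] v(2)] v(2)] by (simp only: diff_add_cancel)
    then have "l2_norm (\<lambda>x. u i x - u' x) * l2_norm (v i)
        \<le> l2_norm (\<lambda>x. u i x - u' x) * (l2_norm (\<lambda>x. v i x - v' x) + l2_norm v')"
      by (rule mult_left_mono) simp
    ultimately show ?thesis
      by linarith
  qed
  then have "\<forall>\<^sub>F i in F. ?d i \<le> ?e i"
    by (intro always_eventually allI)
  moreover have "(?e \<longlongrightarrow> 0) F"
    using tendsto_add[OF tendsto_mult[OF u(3) tendsto_add[OF v(3) tendsto_const[of "l2_norm v'"]]]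
        tendsto_mult[OF tendsto_const[of "l2_norm u'"] v(3)]] by simp
  ultimately have "((\<lambda>i. (LINT x|lborel. u i x * v i x) - (LINT x|lborel. u' x * v' x)) \<longlongrightarrow> 0) F"
    by (rule Lim_null_comparison)
  then show ?thesis
    by (rule LIM_zero_cancel)
qed

lemma l2_norm_tendsto:
  assumes "\<And>i. u i \<in> L2" "v \<in> L2" "((\<lambda>i. l2_norm (\<lambda>x. u i x - v x)) \<longlongrightarrow> 0) F"
  shows "((\<lambda>i. l2_norm (u i)) \<longlongrightarrow> l2_norm v) F"
proof -
  have "\<forall>\<^sub>F i in F. norm (l2_norm (u i) - l2_norm v) \<le> l2_norm (\<lambda>x. u i x - v x)"
    using l2_norm_diff_abs[OF assms(1,2)] by (simp add: always_eventually)
  then have "((\<lambda>i. l2_norm (u i) - l2_norm v) \<longlongrightarrow> 0) F"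
    by (rule Lim_null_comparison) (rule assms(3))
  then show ?thesis
    by (rule LIM_zero_cancel)
qed

lemma l2_dist_eq_0_iff:
  assumes "f \<in> L2" "g \<in> L2"
  shows "l2_norm (\<lambda>x. f x - g x) = 0 \<longleftrightarrow> (AE x in lborel. f x = g x)"
proof
  assume "l2_norm (\<lambda>x. f x - g x) = 0"
  from l2_norm_eq_0[OF L2_diff[OF assms] this] show "AE x in lborel. f x = g x"
    by simp
next
  note [measurable] = L2_measurable[OF assms(1)] L2_measurable[OF assms(2)]
  assume "AE x in lborel. f x = g x"
  then have "l2_norm (\<lambda>x. f x - g x) = l2_norm (\<lambda>x::'a. 0)"
    by (intro l2_norm_cong_AE) auto
  then show "l2_norm (\<lambda>x. f x - g x) = 0"
    by (simp add: l2_norm_def)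
qed

lemma integral_mult_cnj_self:
  assumes "f \<in> L2"
  shows "(LINT x|lborel. f x * cnj (f x)) = complex_of_real ((l2_norm f)\<^sup>2)"
  unfolding l2_norm_square complex_norm_square[symmetric]
  by (rule integral_of_real[OF L2_integrable[OF assms]])

section \<open>The Gaussian and the Fourier integral\<close>

lemma lborel_integral_affine:
  fixes f :: "'a::euclidean_space \<Rightarrow> 'b::{banach, second_countable_topology}"
  assumes f: "f \<in> borel_measurable borel" and c: "c \<noteq> 0"
  shows "(LINT x|lborel. f x) = \<bar>c\<bar> ^ DIM('a) *\<^sub>R (LINT x|lborel. f (t + c *\<^sub>R x))"
proof -
  have "(LINT x|lborel. f x)
      = (LINT x|density (distr lborel borel (\<lambda>x. t + c *\<^sub>R x)) (\<lambda>_. ennreal (\<bar>c\<bar> ^ DIM('a))). f x)"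
    using lborel_affine[OF c, of t] by simp
  also have "\<dots> = (LINT x|lborel. \<bar>c\<bar> ^ DIM('a) *\<^sub>R f (t + c *\<^sub>R x))"
    using f by (subst integral_density) (auto simp: integral_distr)
  finally show ?thesis
    by simp
qed

lemma lborel_nn_integral_affine:
  fixes f :: "'a::euclidean_space \<Rightarrow> ennreal"
  assumes f: "f \<in> borel_measurable borel" and c: "c \<noteq> 0"
  shows "(\<integral>\<^sup>+ x. f x \<partial>lborel) = ennreal (\<bar>c\<bar> ^ DIM('a)) * (\<integral>\<^sup>+ x. f (t + c *\<^sub>R x) \<partial>lborel)"
proof -
  have "(\<integral>\<^sup>+ x. f x \<partial>lborel)
      = (\<integral>\<^sup>+ x. f x \<partial>density (distr lborel borel (\<lambda>x. t + c *\<^sub>R x)) (\<lambda>_. ennreal (\<bar>c\<bar> ^ DIM('a))))"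
    using lborel_affine[OF c, of t] by simp
  also have "\<dots> = ennreal (\<bar>c\<bar> ^ DIM('a)) * (\<integral>\<^sup>+ x. f (t + c *\<^sub>R x) \<partial>lborel)"
    using f by (subst nn_integral_density) (auto simp: nn_integral_distr nn_integral_cmult)
  finally show ?thesis .
qed

lemma lborel_integrable_affine:
  fixes f :: "'a::euclidean_space \<Rightarrow> 'b::{banach, second_countable_topology}"
  assumes f: "integrable lborel f" and c: "c \<noteq> 0"
  shows "integrable lborel (\<lambda>x. f (t + c *\<^sub>R x))"
proof (rule integrableI_bounded)
  have m: "f \<in> borel_measurable borel"
    using borel_measurable_integrable[OF f] by simp
  then show "(\<lambda>x. f (t + c *\<^sub>R x)) \<in> borel_measurable lborel"
    by simp
  have "ennreal (\<bar>c\<bar> ^ DIM('a)) * (\<integral>\<^sup>+ x. norm (f (t + c *\<^sub>R x)) \<partial>lborel) < \<infinity>"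
    using f m unfolding integrable_iff_bounded
    by (subst lborel_nn_integral_affine[OF _ c, symmetric]) auto
  then show "(\<integral>\<^sup>+ x. norm (f (t + c *\<^sub>R x)) \<partial>lborel) < \<infinity>"
    using c by (auto simp: ennreal_mult_less_top)
qed

lemma lborel_prod_integral:
  fixes f :: "'a::euclidean_space \<Rightarrow> real \<Rightarrow> 'b::{real_normed_field, banach, second_countable_topology}"
  assumes f: "\<And>b. b \<in> Basis \<Longrightarrow> integrable lborel (f b)"
  shows "integrable lborel (\<lambda>x. \<Prod>b\<in>Basis. f b (x \<bullet> b))"
    and "(LINT x|lborel. (\<Prod>b\<in>Basis. f b (x \<bullet> b))) = (\<Prod>b\<in>Basis. LINT x|lborel. f b x)"
proof -
  interpret product_sigma_finite "\<lambda>_::'a. lborel :: real measure" ..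
  have m: "f b \<in> borel_measurable borel" if "b \<in> Basis" for b
    using borel_measurable_integrable[OF f[OF that]] by simp
  have m': "(\<lambda>x::'a. \<Prod>b\<in>Basis. f b (x \<bullet> b)) \<in> borel_measurable borel"
    using m by (intro borel_measurable_prod measurable_compose[OF _ m]) auto
  have coord: "(\<Sum>b'\<in>Basis. x b' *\<^sub>R b') \<bullet> b = x b" if "b \<in> Basis" for x and b :: 'a
    using that by (simp add: inner_sum_left inner_Basis if_distrib cong: if_cong)
  have eq: "(\<Prod>b\<in>Basis. f b ((\<Sum>b'\<in>Basis. x b' *\<^sub>R b') \<bullet> b)) = (\<Prod>b\<in>Basis. f b (x b))" for x
    by (intro prod.cong refl) (simp add: coord)
  have T: "(\<lambda>x. \<Sum>b\<in>Basis. x b *\<^sub>R b) \<in> measurable (\<Pi>\<^sub>M b\<in>(Basis::'a set). lborel) borel"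
    by measurable
  show "integrable lborel (\<lambda>x. \<Prod>b\<in>Basis. f b (x \<bullet> b))"
    by (subst lborel_eq, subst integrable_distr_eq[OF T m']) (simp add: eq f product_integrable_prod)
  show "(LINT x|lborel. (\<Prod>b\<in>Basis. f b (x \<bullet> b))) = (\<Prod>b\<in>Basis. LINT x|lborel. f b x)"
    by (subst lborel_eq, subst integral_distr[OF T m']) (simp add: eq f product_integral_prod)
qed

definition gaussian :: "'a::euclidean_space \<Rightarrow> real" where
  "gaussian x = exp (- (norm x)\<^sup>2 / 2)"

lemma gaussian_measurable [measurable]: "gaussian \<in> borel_measurable borel"
  unfolding gaussian_def by measurable

lemma gaussian_pos: "0 < gaussian x"
  by (simp add: gaussian_def)

lemma gaussian_le_1: "gaussian x \<le> 1"
  by (simp add: gaussian_def)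

text \<open>
  The integrand is a product over the coordinates, and each factor is the characteristic
  function of the standard normal distribution.
\<close>

lemma gaussian_integrable_cis:
  fixes \<xi> :: "'a::euclidean_space"
  shows "integrable lborel (\<lambda>x. cis (- (x \<bullet> \<xi>)) * gaussian x)"
    and "(LINT x|lborel. cis (- (x \<bullet> \<xi>)) * gaussian x)
      = complex_of_real ((2 * pi) powr (real DIM('a) / 2) * gaussian \<xi>)"
proof -
  let ?f = "\<lambda>t x. cis (- (x * t)) * complex_of_real (exp (- x\<^sup>2 / 2))"
  have 1: "integrable lborel (?f t)" for t
  proof (rule Bochner_Integration.integrable_bound)
    have "integrable lborel (\<lambda>x. sqrt (2 * pi) * std_normal_density x)"
      by simp
    then show "integrable lborel (\<lambda>x::real. exp (- x\<^sup>2 / 2))"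
      by (simp add: std_normal_density_def)
    show "(\<lambda>x. cis (- (x * t)) * complex_of_real (exp (- x\<^sup>2 / 2))) \<in> borel_measurable lborel"
      by (simp add: cis_conv_exp)
  qed (simp add: norm_mult)
  have 2: "(LINT x|lborel. ?f t x) = complex_of_real (sqrt (2 * pi) * exp (- t\<^sup>2 / 2))" for t
  proof -
    have "complex_of_real (exp (- t\<^sup>2 / 2)) = char std_normal_distribution (-t)"
      by (simp add: char_std_normal_distribution)
    also have "\<dots> = (LINT x|lborel. std_normal_density x *\<^sub>R iexp (- t * x))"
      unfolding char_def by (subst integral_density) auto
    also have "\<dots> = (LINT x|lborel. complex_of_real (1 / sqrt (2 * pi)) * ?f t x)"
      by (intro Bochner_Integration.integral_cong refl)
        (simp add: std_normal_density_def scaleR_conv_of_real cis_conv_exp mult_ac)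
    also have "\<dots> = complex_of_real (1 / sqrt (2 * pi)) * (LINT x|lborel. ?f t x)"
      by simp
    finally show ?thesis
      by (simp add: field_simps)
  qed
  have prod: "cis (- (x \<bullet> \<xi>)) * complex_of_real (gaussian x) = (\<Prod>b\<in>Basis. ?f (\<xi> \<bullet> b) (x \<bullet> b))" for x
  proof -
    have "- (x \<bullet> \<xi>) = (\<Sum>b\<in>Basis. - ((x \<bullet> b) * (\<xi> \<bullet> b)))"
      by (subst euclidean_inner) (simp add: sum_negf)
    then have "cis (- (x \<bullet> \<xi>)) = (\<Prod>b\<in>Basis. cis (- ((x \<bullet> b) * (\<xi> \<bullet> b))))"
      by (simp add: cis_conv_exp sum_distrib_left exp_sum)
    moreover have "- (norm x)\<^sup>2 / 2 = (\<Sum>b\<in>Basis. - (x \<bullet> b)\<^sup>2 / 2)"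
      unfolding power2_norm_eq_inner euclidean_inner[of x x]
      by (simp add: sum_negf sum_divide_distrib power2_eq_square)
    then have "gaussian x = (\<Prod>b\<in>Basis. exp (- (x \<bullet> b)\<^sup>2 / 2))"
      by (simp add: gaussian_def exp_sum)
    ultimately show ?thesis
      by (simp add: prod.distrib)
  qed
  show "integrable lborel (\<lambda>x. cis (- (x \<bullet> \<xi>)) * gaussian x)"
    unfolding prod by (rule lborel_prod_integral(1)) (rule 1)
  have "- (norm \<xi>)\<^sup>2 / 2 = (\<Sum>b\<in>Basis. - (\<xi> \<bullet> b)\<^sup>2 / 2)"
    unfolding power2_norm_eq_inner euclidean_inner[of \<xi> \<xi>]
    by (simp add: sum_negf sum_divide_distrib power2_eq_square)
  then have "gaussian \<xi> = (\<Prod>b\<in>Basis. exp (- (\<xi> \<bullet> b)\<^sup>2 / 2))"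
    by (simp add: gaussian_def exp_sum)
  moreover have "sqrt (2 * pi) ^ DIM('a) = (2 * pi) powr (real DIM('a) / 2)"
    by (simp add: powr_half_sqrt[symmetric] powr_power)
  ultimately show "(LINT x|lborel. cis (- (x \<bullet> \<xi>)) * gaussian x)
      = complex_of_real ((2 * pi) powr (real DIM('a) / 2) * gaussian \<xi>)"
    unfolding prod by (subst lborel_prod_integral(2)[OF 1]) (simp only: 2 prod.distrib prod_constant flip: of_real_prod of_real_mult)
qed

lemma measurable_cis [measurable]:
  "f \<in> borel_measurable M \<Longrightarrow> (\<lambda>x. cis (f x)) \<in> borel_measurable M"
  by (simp add: cis_conv_exp)

lemma fourier_integral_measurable [measurable]:
  assumes [measurable]: "f \<in> borel_measurable borel"
  shows "fourier_integral f \<in> borel_measurable borel"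
  unfolding fourier_integral_def by measurable

lemma integrable_cis_mult:
  assumes f: "integrable M f" and p: "p \<in> borel_measurable M"
  shows "integrable M (\<lambda>x. cis (p x) * f x)"
  by (rule Bochner_Integration.integrable_bound[OF f]) (use f p in \<open>auto simp: norm_mult\<close>)

lemma fourier_integral_bound:
  "cmod (fourier_integral f \<xi>) \<le> (2 * pi) powr (- real DIM('a) / 2) * (LINT x|lborel. cmod (f x))"
  for f :: "'a::euclidean_space \<Rightarrow> complex"
  using integral_norm_bound[of lborel "\<lambda>x. cis (- (x \<bullet> \<xi>)) * f x"]
  by (auto simp: fourier_integral_def norm_mult intro!: mult_left_mono)

text \<open>
  Fubini: the kernel \<open>cis (- (x \<bullet> \<xi>))\<close> is symmetric in \<open>x\<close> and \<open>\<xi>\<close>. The formula is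
  bilinear, without conjugation, which is the form in which it passes to \<open>L\<^sup>2\<close> and yields
  surjectivity there.
\<close>

lemma fourier_integral_duality:
  fixes f g :: "'a::euclidean_space \<Rightarrow> complex"
  assumes f: "integrable lborel f" and g: "integrable lborel g"
  shows "(LINT \<xi>|lborel. fourier_integral f \<xi> * g \<xi>) = (LINT x|lborel. f x * fourier_integral g x)"
proof -
  let ?h = "\<lambda>x \<xi>. cis (- (x \<bullet> \<xi>)) * f x * g \<xi>"
  have [measurable]: "f \<in> borel_measurable borel" "g \<in> borel_measurable borel"
    using f g by (auto dest: borel_measurable_integrable)
  have "integrable (lborel \<Otimes>\<^sub>M lborel) (case_prod ?h)"
  proof (rule lborel_pair.Fubini_integrable)
    show "case_prod ?h \<in> borel_measurable (lborel \<Otimes>\<^sub>M lborel)"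
      by measurable
    show "integrable lborel (\<lambda>x. LINT \<xi>|lborel. norm (case (x, \<xi>) of (x, \<xi>) \<Rightarrow> ?h x \<xi>))"
      using f by (simp add: norm_mult)
    show "AE x in lborel. integrable lborel (\<lambda>\<xi>. case (x, \<xi>) of (x, \<xi>) \<Rightarrow> ?h x \<xi>)"
    proof (rule AE_I2)
      fix x
      have "integrable lborel (\<lambda>\<xi>. f x * (cis (- (x \<bullet> \<xi>)) * g \<xi>))"
        by (intro integrable_mult_right integrable_cis_mult g) auto
      then show "integrable lborel (\<lambda>\<xi>. case (x, \<xi>) of (x, \<xi>) \<Rightarrow> ?h x \<xi>)"
        by (simp add: mult_ac)
    qed
  qed
  then have "(LINT \<xi>|lborel. (LINT x|lborel. ?h x \<xi>)) = (LINT x|lborel. (LINT \<xi>|lborel. ?h x \<xi>))"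
    by (rule lborel_pair.Fubini_integral)
  moreover have "(LINT x|lborel. ?h x \<xi>) = (LINT x|lborel. cis (- (x \<bullet> \<xi>)) * f x) * g \<xi>" for \<xi>
    by simp
  moreover have "(LINT \<xi>|lborel. ?h x \<xi>) = f x * (LINT \<xi>|lborel. cis (- (\<xi> \<bullet> x)) * g \<xi>)" for x
    by (subst integral_mult_right_zero[symmetric]) (simp add: mult_ac inner_commute)
  ultimately show ?thesis
    by (simp add: fourier_integral_def)
qed

lemma fourier_integral_lincomb:
  assumes "integrable lborel f" "integrable lborel g"
  shows "fourier_integral (\<lambda>x. a * f x + b * g x) \<xi> = a * fourier_integral f \<xi> + b * fourier_integral g \<xi>"
proof -
  have int: "integrable lborel (\<lambda>x. cis (- (x \<bullet> \<xi>)) * f x)" "integrable lborel (\<lambda>x. cis (- (x \<bullet> \<xi>)) * g x)"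
    using assms by (auto intro: integrable_cis_mult)
  have "(LINT x|lborel. cis (- (x \<bullet> \<xi>)) * (a * f x + b * g x))
      = (LINT x|lborel. a * (cis (- (x \<bullet> \<xi>)) * f x) + b * (cis (- (x \<bullet> \<xi>)) * g x))"
    by (simp add: algebra_simps)
  also have "\<dots> = a * (LINT x|lborel. cis (- (x \<bullet> \<xi>)) * f x) + b * (LINT x|lborel. cis (- (x \<bullet> \<xi>)) * g x)"
    using int by simp
  finally show ?thesis
    by (simp add: fourier_integral_def algebra_simps)
qed

lemma fourier_integral_diff:
  assumes "integrable lborel f" "integrable lborel g"
  shows "fourier_integral (\<lambda>x. f x - g x) = (\<lambda>\<xi>. fourier_integral f \<xi> - fourier_integral g \<xi>)"
  using fourier_integral_lincomb[OF assms, of 1 "-1"] by auto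

section \<open>Isometry on integrable functions\<close>

definition gauss_density :: "'a::euclidean_space \<Rightarrow> real" where
  "gauss_density z = (2 * pi) powr (- real DIM('a) / 2) * gaussian z"

lemma gauss_density_measurable [measurable]: "gauss_density \<in> borel_measurable borel"
  unfolding gauss_density_def by measurable

lemma gauss_density_nonneg: "0 \<le> gauss_density z"
  using gaussian_pos[of z] by (simp add: gauss_density_def)

lemma gaussian_integrable: "integrable lborel (gaussian :: 'a::euclidean_space \<Rightarrow> real)"
  using integrable_norm[OF gaussian_integrable_cis(1)[of "0::'a"]] gaussian_pos[where 'a='a]
  by (simp add: norm_mult abs_of_pos)

lemma gauss_density_integrable: "integrable lborel (gauss_density :: 'a::euclidean_space \<Rightarrow> real)"
  unfolding gauss_density_def using gaussian_integrable by simp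

lemma integral_gauss_density: "(LINT z|lborel. gauss_density (z::'a::euclidean_space)) = 1"
proof -
  have "complex_of_real (LINT z|lborel. gaussian (z::'a)) = complex_of_real ((2 * pi) powr (real DIM('a) / 2))"
    using gaussian_integrable_cis(2)[of "0::'a"] by (simp add: gaussian_def)
  then have "(LINT z|lborel. gaussian (z::'a)) = (2 * pi) powr (real DIM('a) / 2)"
    using of_real_eq_iff by blast
  then show ?thesis
    by (simp add: gauss_density_def powr_minus field_simps)
qed

lemma nn_integral_gauss_density: "(\<integral>\<^sup>+ z. ennreal (gauss_density (z::'a::euclidean_space)) \<partial>lborel) = 1"
  by (subst nn_integral_eq_integral)
    (auto simp: gauss_density_integrable gauss_density_nonneg integral_gauss_density)

lemma fourier_integral_modulated_gaussian:
  fixes x y :: "'a::euclidean_space"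
  assumes \<delta>: "\<delta> > 0"
  shows "fourier_integral (\<lambda>\<xi>. cis (x \<bullet> \<xi>) * complex_of_real (gaussian (\<delta> *\<^sub>R \<xi>))) y
    = complex_of_real (gaussian ((y - x) /\<^sub>R \<delta>) / \<delta> ^ DIM('a))"
proof -
  let ?w = "(y - x) /\<^sub>R \<delta>"
  let ?h = "\<lambda>\<eta>. cis (- (\<eta> \<bullet> ?w)) * complex_of_real (gaussian \<eta>)"
  have "(LINT \<xi>|lborel. cis (- (\<xi> \<bullet> y)) * (cis (x \<bullet> \<xi>) * complex_of_real (gaussian (\<delta> *\<^sub>R \<xi>))))
      = (LINT \<xi>|lborel. ?h (\<delta> *\<^sub>R \<xi>))"
    using \<delta> by (intro Bochner_Integration.integral_cong refl)
      (simp add: mult.assoc[symmetric] cis_mult inner_diff_right inner_commute algebra_simps)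
  also have "\<dots> = (LINT \<eta>|lborel. ?h \<eta>) /\<^sub>R \<delta> ^ DIM('a)"
    using lborel_integral_affine[of ?h \<delta> 0] \<delta> by simp
  also have "\<dots> = complex_of_real ((2 * pi) powr (real DIM('a) / 2) * gaussian ?w / \<delta> ^ DIM('a))"
    unfolding gaussian_integrable_cis(2) by (simp add: scaleR_conv_of_real field_simps)
  finally show ?thesis
    by (simp add: fourier_integral_def powr_minus scaleR_conv_of_real field_simps)
qed

text \<open>
  The convolution of \<open>f\<close> with the centred Gaussian density of variance \<open>\<delta>\<^sup>2\<close>, written so that
  \<open>\<delta>\<close> occurs in the argument of \<open>f\<close> only.
\<close>

definition gauss_mean :: "real \<Rightarrow> ('a::euclidean_space \<Rightarrow> complex) \<Rightarrow> 'a \<Rightarrow> complex" where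
  "gauss_mean \<delta> f x = (LINT z|lborel. f (x + \<delta> *\<^sub>R z) * gauss_density z)"

lemma gauss_mean_measurable [measurable]:
  assumes [measurable]: "f \<in> borel_measurable borel"
  shows "gauss_mean \<delta> f \<in> borel_measurable borel"
  unfolding gauss_mean_def by measurable

lemma integrable_mult_gaussian:
  fixes F :: "'a::euclidean_space \<Rightarrow> complex"
  assumes F: "F \<in> borel_measurable borel" "\<And>\<xi>. cmod (F \<xi>) \<le> C" and \<delta>: "\<delta> > 0"
  shows "integrable lborel (\<lambda>\<xi>. F \<xi> * complex_of_real (gaussian (\<delta> *\<^sub>R \<xi>)))"
proof (rule Bochner_Integration.integrable_bound)
  have "integrable lborel (\<lambda>\<xi>::'a. gaussian (\<delta> *\<^sub>R \<xi>))"
    using lborel_integrable_affine[OF gaussian_integrable, of \<delta> 0] \<delta> by simp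
  then show "integrable lborel (\<lambda>\<xi>::'a. C * gaussian (\<delta> *\<^sub>R \<xi>))"
    by simp
  show "(\<lambda>\<xi>. F \<xi> * complex_of_real (gaussian (\<delta> *\<^sub>R \<xi>))) \<in> borel_measurable lborel"
    using F(1) by measurable
  have "0 \<le> C"
    using F(2)[of 0] norm_ge_zero order_trans by blast
  then show "AE \<xi> in lborel. norm (F \<xi> * complex_of_real (gaussian (\<delta> *\<^sub>R \<xi>))) \<le> norm (C * gaussian (\<delta> *\<^sub>R \<xi>))"
    using F(2) by (intro AE_I2) (auto simp: norm_mult abs_mult intro!: mult_right_mono)
qed

text \<open>
  A Gaussian weight makes the energy of the transform absolutely convergent as a triple
  integral. Moving both transforms by duality onto the weight replaces it by its own transform, a
  Gaussian concentrated at scale \<open>\<delta>\<close>. Letting \<open>\<delta>\<close> tend to \<open>0\<close> then compares the norm of the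
  transform with that of \<open>f\<close>.
\<close>

lemma gaussian_weighted_energy:
  fixes f :: "'a::euclidean_space \<Rightarrow> complex"
  assumes f: "integrable lborel f" and \<delta>: "\<delta> > 0"
  shows "(LINT \<xi>|lborel. complex_of_real ((cmod (fourier_integral f \<xi>))\<^sup>2 * gaussian (\<delta> *\<^sub>R \<xi>)))
    = (LINT x|lborel. f x * cnj (gauss_mean \<delta> f x))"
proof -
  define F where "F = fourier_integral f"
  define \<gamma> where "\<gamma> = (\<lambda>\<xi>::'a. complex_of_real (gaussian (\<delta> *\<^sub>R \<xi>)))"
  have [measurable]: "f \<in> borel_measurable borel"
    using f by (auto dest: borel_measurable_integrable)
  have F [measurable]: "F \<in> borel_measurable borel"
    unfolding F_def by measurable
  define C where "C = (2 * pi) powr (- real DIM('a) / 2) * (LINT x|lborel. cmod (f x))"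
  have C: "cmod (F \<xi>) \<le> C" for \<xi>
    unfolding F_def C_def by (rule fourier_integral_bound)
  have mean: "(LINT \<xi>|lborel. F \<xi> * (cis (x \<bullet> \<xi>) * \<gamma> \<xi>)) = (2 * pi) powr (real DIM('a) / 2) *\<^sub>R gauss_mean \<delta> f x" for x
  proof -
    let ?k = "\<lambda>y. f y * complex_of_real (gaussian ((y - x) /\<^sub>R \<delta>) / \<delta> ^ DIM('a))"
    have "(LINT \<xi>|lborel. F \<xi> * (cis (x \<bullet> \<xi>) * \<gamma> \<xi>)) = (LINT y|lborel. f y * fourier_integral (\<lambda>\<xi>. cis (x \<bullet> \<xi>) * \<gamma> \<xi>) y)"
      unfolding F_def
    proof (rule fourier_integral_duality[OF f])
      show "integrable lborel (\<lambda>\<xi>. cis (x \<bullet> \<xi>) * \<gamma> \<xi>)"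
        unfolding \<gamma>_def by (rule integrable_mult_gaussian[OF _ _ \<delta>, of _ 1]) auto
    qed
    also have "\<dots> = (LINT y|lborel. ?k y)"
      unfolding \<gamma>_def fourier_integral_modulated_gaussian[OF \<delta>] ..
    also have "\<dots> = \<delta> ^ DIM('a) *\<^sub>R (LINT z|lborel. ?k (x + \<delta> *\<^sub>R z))"
      using \<delta> by (subst lborel_integral_affine[of ?k \<delta> x]) auto
    also have "\<dots> = (LINT z|lborel. f (x + \<delta> *\<^sub>R z) * complex_of_real (gaussian z))"
      using \<delta> by (simp add: scaleR_conv_of_real)
    also have "\<dots> = (LINT z|lborel. (2 * pi) powr (real DIM('a) / 2) *\<^sub>R (f (x + \<delta> *\<^sub>R z) * complex_of_real (gauss_density z)))"
      by (intro Bochner_Integration.integral_cong refl)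
        (simp add: gauss_density_def powr_minus scaleR_conv_of_real field_simps)
    finally show ?thesis
      by (simp add: gauss_mean_def)
  qed
  have conj: "fourier_integral (\<lambda>\<xi>. cnj (F \<xi>) * \<gamma> \<xi>) x = cnj (gauss_mean \<delta> f x)" for x
  proof -
    have "(LINT \<xi>|lborel. cis (- (\<xi> \<bullet> x)) * (cnj (F \<xi>) * \<gamma> \<xi>)) = (LINT \<xi>|lborel. cnj (F \<xi> * (cis (x \<bullet> \<xi>) * \<gamma> \<xi>)))"
      by (intro Bochner_Integration.integral_cong refl) (simp add: \<gamma>_def cis_cnj inner_commute mult_ac)
    also have "\<dots> = cnj (LINT \<xi>|lborel. F \<xi> * (cis (x \<bullet> \<xi>) * \<gamma> \<xi>))"
      by (rule Bochner_Integration.integral_cnj)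
    finally show ?thesis
      unfolding fourier_integral_def mean by (simp add: powr_minus)
  qed
  have "(LINT \<xi>|lborel. complex_of_real ((cmod (F \<xi>))\<^sup>2 * gaussian (\<delta> *\<^sub>R \<xi>)))
      = (LINT \<xi>|lborel. F \<xi> * (cnj (F \<xi>) * \<gamma> \<xi>))"
    by (simp add: \<gamma>_def complex_norm_square mult.assoc flip: of_real_power)
  also have "\<dots> = (LINT x|lborel. f x * cnj (gauss_mean \<delta> f x))"
    unfolding conj[symmetric] unfolding F_def
  proof (rule fourier_integral_duality[OF f])
    show "integrable lborel (\<lambda>\<xi>. cnj (fourier_integral f \<xi>) * \<gamma> \<xi>)"
      unfolding \<gamma>_def by (rule integrable_mult_gaussian[OF _ _ \<delta>, of _ C]) (use F C in \<open>auto simp: F_def\<close>)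
  qed
  finally show ?thesis
    unfolding F_def .
qed

lemma norm_integral_le_nn_integral:
  fixes f :: "'a \<Rightarrow> 'b::{banach, second_countable_topology}"
  shows "ennreal (norm (integral\<^sup>L M f)) \<le> (\<integral>\<^sup>+ x. ennreal (norm (f x)) \<partial>M)"
  by (cases "integrable M f") (auto simp: integral_norm_bound_ennreal not_integrable_integral_eq)

text \<open>
  Bound \<open>|f x| |f (x + \<delta>z)|\<close> by half the sum of the squares. By translation invariance each
  square integrates over \<open>x\<close> to the squared norm, whatever \<open>z\<close> is, and the Gaussian has mass \<open>1\<close>.
\<close>

lemma gauss_mean_form_bound:
  fixes f :: "'a::euclidean_space \<Rightarrow> complex"
  assumes f: "f \<in> L2" and \<delta>: "\<delta> > 0"
  shows "cmod (LINT x|lborel. f x * cnj (gauss_mean \<delta> f x)) \<le> (l2_norm f)\<^sup>2"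
proof -
  have [measurable]: "f \<in> borel_measurable borel"
    using f by (rule L2_measurable)
  let ?g = "gauss_density :: 'a \<Rightarrow> real"
  let ?q = "\<lambda>x. ennreal ((cmod (f x))\<^sup>2 / 2)"
  have q: "(\<integral>\<^sup>+ x. ?q (x + y) \<partial>lborel) = ennreal ((l2_norm f)\<^sup>2 / 2)" for y
  proof -
    have "(\<integral>\<^sup>+ x. ?q (x + y) \<partial>lborel) = (\<integral>\<^sup>+ x. ?q x \<partial>lborel)"
      using lborel_nn_integral_affine[of ?q 1 y] by (simp add: add.commute)
    also have "\<dots> = (\<integral>\<^sup>+ x. ennreal (1 / 2) * ennreal ((cmod (f x))\<^sup>2) \<partial>lborel)"
      by (simp add: ennreal_mult[symmetric] del: ennreal_half)
    also have "\<dots> = ennreal (1 / 2) * ennreal ((l2_norm f)\<^sup>2)"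
      by (subst nn_integral_cmult) (auto simp: nn_integral_L2[OF f])
    finally show ?thesis
      by (simp add: ennreal_mult[symmetric] del: ennreal_half)
  qed
  have "ennreal (cmod (LINT x|lborel. f x * cnj (gauss_mean \<delta> f x)))
      \<le> (\<integral>\<^sup>+ x. ennreal (cmod (f x)) * ennreal (cmod (gauss_mean \<delta> f x)) \<partial>lborel)"
    using norm_integral_le_nn_integral[of lborel "\<lambda>x. f x * cnj (gauss_mean \<delta> f x)"]
    by (simp add: norm_mult ennreal_mult)
  also have "\<dots> \<le> (\<integral>\<^sup>+ x. ennreal (cmod (f x)) * (\<integral>\<^sup>+ z. ennreal (cmod (f (x + \<delta> *\<^sub>R z) * ?g z)) \<partial>lborel) \<partial>lborel)"
    unfolding gauss_mean_def by (intro nn_integral_mono mult_left_mono norm_integral_le_nn_integral) auto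
  also have "\<dots> = (\<integral>\<^sup>+ x. \<integral>\<^sup>+ z. ennreal (cmod (f x)) * ennreal (cmod (f (x + \<delta> *\<^sub>R z) * ?g z)) \<partial>lborel \<partial>lborel)"
    by (subst nn_integral_cmult) auto
  also have "\<dots> \<le> (\<integral>\<^sup>+ x. \<integral>\<^sup>+ z. ennreal (?g z) * (?q x + ?q (x + \<delta> *\<^sub>R z)) \<partial>lborel \<partial>lborel)"
  proof (intro nn_integral_mono)
    fix x z
    have "cmod (f x) * cmod (f (x + \<delta> *\<^sub>R z)) \<le> (cmod (f x))\<^sup>2 / 2 + (cmod (f (x + \<delta> *\<^sub>R z)))\<^sup>2 / 2"
      using sum_squares_bound[of "cmod (f x)" "cmod (f (x + \<delta> *\<^sub>R z))"] by (simp add: field_simps)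
    then have "?g z * (cmod (f x) * cmod (f (x + \<delta> *\<^sub>R z)))
        \<le> ?g z * ((cmod (f x))\<^sup>2 / 2 + (cmod (f (x + \<delta> *\<^sub>R z)))\<^sup>2 / 2)"
      by (rule mult_left_mono) (rule gauss_density_nonneg)
    moreover have "ennreal (cmod (f x)) * ennreal (cmod (f (x + \<delta> *\<^sub>R z) * ?g z))
        = ennreal (?g z * (cmod (f x) * cmod (f (x + \<delta> *\<^sub>R z))))"
      by (simp add: ennreal_mult[symmetric] norm_mult gauss_density_nonneg mult_ac)
    moreover have "ennreal (?g z) * (?q x + ?q (x + \<delta> *\<^sub>R z))
        = ennreal (?g z * ((cmod (f x))\<^sup>2 / 2 + (cmod (f (x + \<delta> *\<^sub>R z)))\<^sup>2 / 2))"
      by (simp add: ennreal_mult gauss_density_nonneg)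
    ultimately show "ennreal (cmod (f x)) * ennreal (cmod (f (x + \<delta> *\<^sub>R z) * ?g z)) \<le> ennreal (?g z) * (?q x + ?q (x + \<delta> *\<^sub>R z))"
      by (simp add: ennreal_leI)
  qed
  also have "\<dots> = (\<integral>\<^sup>+ z. \<integral>\<^sup>+ x. ennreal (?g z) * (?q x + ?q (x + \<delta> *\<^sub>R z)) \<partial>lborel \<partial>lborel)"
    by (intro lborel_pair.Fubini'[symmetric]) measurable
  also have "\<dots> = (\<integral>\<^sup>+ z. ennreal (?g z) * ennreal ((l2_norm f)\<^sup>2) \<partial>lborel)"
  proof (intro nn_integral_cong)
    fix z
    show "(\<integral>\<^sup>+ x. ennreal (?g z) * (?q x + ?q (x + \<delta> *\<^sub>R z)) \<partial>lborel) = ennreal (?g z) * ennreal ((l2_norm f)\<^sup>2)"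
      using q[of 0] q[of "\<delta> *\<^sub>R z"]
      by (subst nn_integral_cmult, simp, subst nn_integral_add) (simp_all flip: ennreal_plus)
  qed
  also have "\<dots> = ennreal ((l2_norm f)\<^sup>2)"
    by (subst nn_integral_multc) (auto simp: nn_integral_gauss_density)
  finally show ?thesis
    by simp
qed

lemma nn_integral_Fatou_le:
  fixes u :: "nat \<Rightarrow> 'a \<Rightarrow> ennreal"
  assumes u: "\<And>i. u i \<in> borel_measurable M" and lim: "AE x in M. (\<lambda>i. u i x) \<longlonglongrightarrow> v x"
    and le: "\<forall>\<^sub>F i in sequentially. (\<integral>\<^sup>+ x. u i x \<partial>M) \<le> C"
  shows "(\<integral>\<^sup>+ x. v x \<partial>M) \<le> C"
proof -
  have "(\<integral>\<^sup>+ x. v x \<partial>M) = (\<integral>\<^sup>+ x. liminf (\<lambda>i. u i x) \<partial>M)"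
  proof (rule nn_integral_cong_AE)
    show "AE x in M. v x = liminf (\<lambda>i. u i x)"
      using lim by eventually_elim (simp add: lim_imp_Liminf)
  qed
  also have "\<dots> \<le> liminf (\<lambda>i. \<integral>\<^sup>+ x. u i x \<partial>M)"
    by (rule nn_integral_liminf[OF u])
  also have "\<dots> \<le> C"
    using le by (intro Liminf_le) auto
  finally show ?thesis .
qed

lemma gaussian_weighted_energy_real:
  fixes f :: "'a::euclidean_space \<Rightarrow> complex"
  assumes f: "integrable lborel f" and \<delta>: "\<delta> > 0"
  shows "integrable lborel (\<lambda>\<xi>. (cmod (fourier_integral f \<xi>))\<^sup>2 * gaussian (\<delta> *\<^sub>R \<xi>))"
    and "complex_of_real (LINT \<xi>|lborel. (cmod (fourier_integral f \<xi>))\<^sup>2 * gaussian (\<delta> *\<^sub>R \<xi>))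
      = (LINT x|lborel. f x * cnj (gauss_mean \<delta> f x))"
proof -
  have [measurable]: "f \<in> borel_measurable borel"
    using f by (auto dest: borel_measurable_integrable)
  define C where "C = (2 * pi) powr (- real DIM('a) / 2) * (LINT x|lborel. cmod (f x))"
  have C: "cmod (fourier_integral f \<xi>) \<le> C" for \<xi>
    unfolding C_def by (rule fourier_integral_bound)
  have "integrable lborel (\<lambda>\<xi>. complex_of_real ((cmod (fourier_integral f \<xi>))\<^sup>2) * complex_of_real (gaussian (\<delta> *\<^sub>R \<xi>)))"
  proof (rule integrable_mult_gaussian[OF _ _ \<delta>])
    show "cmod (complex_of_real ((cmod (fourier_integral f \<xi>))\<^sup>2)) \<le> C\<^sup>2" for \<xi>
      using power_mono[OF C, of \<xi> 2] by (simp add: norm_power)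
  qed measurable
  then have "integrable lborel (\<lambda>\<xi>. complex_of_real ((cmod (fourier_integral f \<xi>))\<^sup>2 * gaussian (\<delta> *\<^sub>R \<xi>)))"
    by simp
  then show int: "integrable lborel (\<lambda>\<xi>. (cmod (fourier_integral f \<xi>))\<^sup>2 * gaussian (\<delta> *\<^sub>R \<xi>))"
    by (rule complex_of_real_integrable_eq[THEN iffD1])
  show "complex_of_real (LINT \<xi>|lborel. (cmod (fourier_integral f \<xi>))\<^sup>2 * gaussian (\<delta> *\<^sub>R \<xi>))
      = (LINT x|lborel. f x * cnj (gauss_mean \<delta> f x))"
    unfolding gaussian_weighted_energy[OF f \<delta>, symmetric] by (rule integral_of_real[OF int, symmetric])
qed

lemma gaussian_inverse_Suc_tendsto: "(\<lambda>m. gaussian ((1 / real (Suc m)) *\<^sub>R \<xi>)) \<longlonglongrightarrow> 1"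
proof -
  have "(\<lambda>m. exp (- (norm ((1 / real (Suc m)) *\<^sub>R \<xi>))\<^sup>2 / 2)) \<longlonglongrightarrow> exp (- (norm (0 *\<^sub>R \<xi>))\<^sup>2 / 2)"
    by (intro tendsto_intros LIMSEQ_Suc[OF lim_1_over_n]) auto
  then show ?thesis
    by (simp add: gaussian_def)
qed

text \<open>
  Fatou's lemma removes the Gaussian weight from the bound above. An inequality is all that
  this gives; equality needs convergence of the Gaussian means.
\<close>

lemma fourier_integral_contraction:
  fixes f :: "'a::euclidean_space \<Rightarrow> complex"
  assumes f: "f \<in> L2" "integrable lborel f"
  shows "fourier_integral f \<in> L2" and "l2_norm (fourier_integral f) \<le> l2_norm f"
proof -
  have [measurable]: "f \<in> borel_measurable borel"
    using f(1) by (rule L2_measurable)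
  let ?u = "\<lambda>m \<xi>. (cmod (fourier_integral f \<xi>))\<^sup>2 * gaussian ((1 / real (Suc m)) *\<^sub>R \<xi>)"
  have "(\<integral>\<^sup>+ \<xi>. ennreal ((cmod (fourier_integral f \<xi>))\<^sup>2) \<partial>lborel) \<le> ennreal ((l2_norm f)\<^sup>2)"
  proof (rule nn_integral_Fatou_le[OF _ _ always_eventually[OF allI]])
    show "(\<lambda>\<xi>. ennreal (?u m \<xi>)) \<in> borel_measurable lborel" for m
      by measurable
    have "(\<lambda>m. ennreal (?u m \<xi>)) \<longlonglongrightarrow> ennreal ((cmod (fourier_integral f \<xi>))\<^sup>2 * 1)" for \<xi>
      by (intro tendsto_ennrealI tendsto_mult tendsto_const gaussian_inverse_Suc_tendsto)
    then show "AE \<xi> in lborel. (\<lambda>m. ennreal (?u m \<xi>)) \<longlonglongrightarrow> ennreal ((cmod (fourier_integral f \<xi>))\<^sup>2)"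
      by simp
    show "(\<integral>\<^sup>+ \<xi>. ennreal (?u m \<xi>) \<partial>lborel) \<le> ennreal ((l2_norm f)\<^sup>2)" for m
    proof -
      have \<delta>: "1 / real (Suc m) > 0"
        by simp
      have "cmod (complex_of_real (LINT \<xi>|lborel. ?u m \<xi>)) \<le> (l2_norm f)\<^sup>2"
        unfolding gaussian_weighted_energy_real(2)[OF f(2) \<delta>] by (rule gauss_mean_form_bound[OF f(1) \<delta>])
      then have "(LINT \<xi>|lborel. ?u m \<xi>) \<le> (l2_norm f)\<^sup>2"
        by (metis norm_of_real abs_le_D1)
      then show ?thesis
        using gaussian_weighted_energy_real(1)[OF f(2) \<delta>] less_imp_le[OF gaussian_pos]
        by (subst nn_integral_eq_integral) (auto simp del: of_nat_Suc intro!: AE_I2 mult_nonneg_nonneg ennreal_leI)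
    qed
  qed
  then show "fourier_integral f \<in> L2" "l2_norm (fourier_integral f) \<le> l2_norm f"
    by (auto intro!: L2I_nn_integral[of "fourier_integral f" "l2_norm f"])
qed

definition compactly_supported_continuous :: "('a::euclidean_space \<Rightarrow> complex) set" where
  "compactly_supported_continuous = {f. continuous_on UNIV f \<and> (\<exists>R. \<forall>x. norm x > R \<longrightarrow> f x = 0)}"

lemma compactly_supported_bounded:
  assumes "f \<in> compactly_supported_continuous"
  obtains C where "\<And>x. cmod (f x) \<le> C"
proof -
  obtain R where f: "continuous_on UNIV f" and R: "\<And>x. norm x > R \<Longrightarrow> f x = 0"
    using assms by (auto simp: compactly_supported_continuous_def)
  have "compact (f ` cball 0 R)"
    using f by (intro compact_continuous_image continuous_on_subset[OF f]) auto
  then obtain C where C: "\<And>y. y \<in> f ` cball 0 R \<Longrightarrow> cmod y \<le> C"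
    using compact_imp_bounded bounded_iff by metis
  have "cmod (f x) \<le> max C 0" for x
    using C[of "f x"] R[of x] by (cases "norm x > R") (simp_all add: le_max_iff_disj)
  then show ?thesis
    using that by blast
qed

lemma compactly_supported_L2:
  fixes f :: "'a::euclidean_space \<Rightarrow> complex"
  assumes f: "f \<in> compactly_supported_continuous"
  shows "f \<in> borel_measurable borel" and "integrable lborel f" and "f \<in> L2"
proof -
  obtain R where cont: "continuous_on UNIV f" and R: "\<And>x. norm x > R \<Longrightarrow> f x = 0"
    using f by (auto simp: compactly_supported_continuous_def)
  obtain C where C: "\<And>x. cmod (f x) \<le> C"
    using compactly_supported_bounded[OF f] by blast
  show m: "f \<in> borel_measurable borel"
    by (rule borel_measurable_continuous_onI[OF cont])
  have fin: "integrable lborel (\<lambda>x::'a. c * indicat_real (cball 0 R) x)" for c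
    by (intro integrable_mult_right integrable_real_indicator) (auto intro: emeasure_bounded_finite simp flip: infinity_ennreal_def)
  have C0: "0 \<le> C"
    using C norm_ge_zero order_trans by blast
  show "integrable lborel f"
    using m C C0 R by (intro Bochner_Integration.integrable_bound[OF fin[of C]] AE_I2) (auto simp: indicator_def not_le)
  show "f \<in> L2"
    using m C C0 R by (intro L2I Bochner_Integration.integrable_bound[OF fin[of "C\<^sup>2"]] AE_I2)
      (auto simp: indicator_def not_le intro!: power_mono)
qed

text \<open>
  For continuous \<open>f\<close> the Gaussian means converge pointwise to \<open>f\<close>, and boundedness with
  compact support supplies a dominating function. Hence the weighted energies tend to the squared
  norm of \<open>f\<close>, while none of them exceeds that of the transform.
\<close>

lemma fourier_integral_lower_bound_continuous:
  fixes f :: "'a::euclidean_space \<Rightarrow> complex"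
  assumes f: "f \<in> compactly_supported_continuous"
  shows "l2_norm f \<le> l2_norm (fourier_integral f)"
proof -
  obtain C where C: "\<And>x. cmod (f x) \<le> C"
    using compactly_supported_bounded[OF f] by blast
  have C0: "0 \<le> C"
    using C norm_ge_zero order_trans by blast
  have cont: "isCont f x" for x
    using f by (auto simp: compactly_supported_continuous_def continuous_on_eq_continuous_at)
  note fL = compactly_supported_L2[OF f]
  note [measurable] = fL(1)
  let ?\<delta> = "\<lambda>m. 1 / real (Suc m)"
  have mean: "(\<lambda>m. gauss_mean (?\<delta> m) f x) \<longlonglongrightarrow> f x" for x
  proof -
    have "(\<lambda>m. LINT z|lborel. f (x + ?\<delta> m *\<^sub>R z) * complex_of_real (gauss_density z))
        \<longlonglongrightarrow> (LINT z|lborel. f x * complex_of_real (gauss_density (z::'a)))"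
    proof (rule integral_dominated_convergence)
      show "integrable lborel (\<lambda>z::'a. C * gauss_density z)"
        by (intro integrable_mult_right gauss_density_integrable)
      have "(\<lambda>m. f (x + ?\<delta> m *\<^sub>R z)) \<longlonglongrightarrow> f x" for z
      proof -
        have "(\<lambda>m. x + ?\<delta> m *\<^sub>R z) \<longlonglongrightarrow> x + 0 *\<^sub>R z"
          by (intro tendsto_intros LIMSEQ_Suc[OF lim_1_over_n])
        then show ?thesis
          using isCont_tendsto_compose[OF cont[of x]] by simp
      qed
      then show "AE z in lborel. (\<lambda>m. f (x + ?\<delta> m *\<^sub>R z) * complex_of_real (gauss_density z)) \<longlonglongrightarrow> f x * complex_of_real (gauss_density z)"
        by (intro AE_I2 tendsto_mult tendsto_const)
      show "AE z in lborel. norm (f (x + ?\<delta> m *\<^sub>R z) * complex_of_real (gauss_density z)) \<le> C * gauss_density z" for m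
        using C C0 gauss_density_nonneg by (intro AE_I2) (auto simp: norm_mult intro!: mult_mono)
    qed measurable
    then show ?thesis
      by (simp add: gauss_mean_def integral_gauss_density)
  qed
  have mean_le: "cmod (gauss_mean \<delta> f x) \<le> C" for \<delta> x
  proof -
    have "ennreal (cmod (gauss_mean \<delta> f x)) \<le> (\<integral>\<^sup>+ z. ennreal (cmod (f (x + \<delta> *\<^sub>R z) * complex_of_real (gauss_density z))) \<partial>lborel)"
      unfolding gauss_mean_def by (rule norm_integral_le_nn_integral)
    also have "\<dots> \<le> (\<integral>\<^sup>+ z. ennreal C * ennreal (gauss_density (z::'a)) \<partial>lborel)"
      using C by (intro nn_integral_mono)
        (simp add: norm_mult gauss_density_nonneg ennreal_mult'' ennreal_leI mult_right_mono)
    also have "\<dots> = ennreal C"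
      by (subst nn_integral_cmult) (auto simp: nn_integral_gauss_density)
    finally show ?thesis
      using C0 by simp
  qed
  have "(\<lambda>m. LINT x|lborel. f x * cnj (gauss_mean (?\<delta> m) f x)) \<longlonglongrightarrow> (LINT x|lborel. f x * cnj (f x))"
  proof (rule integral_dominated_convergence)
    show "integrable lborel (\<lambda>x. C * cmod (f x))"
      using fL by simp
    show "AE x in lborel. (\<lambda>m. f x * cnj (gauss_mean (?\<delta> m) f x)) \<longlonglongrightarrow> f x * cnj (f x)"
      by (intro AE_I2 tendsto_intros mean)
    show "AE x in lborel. norm (f x * cnj (gauss_mean (?\<delta> m) f x)) \<le> C * cmod (f x)" for m
      using mean_le by (intro AE_I2) (simp add: norm_mult mult.commute[of C] mult_left_mono)
  qed measurable
  moreover have "(LINT x|lborel. f x * cnj (f x)) = complex_of_real ((l2_norm f)\<^sup>2)"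
    unfolding l2_norm_square complex_norm_square[symmetric]
    by (rule integral_of_real[OF L2_integrable[OF fL(3)]])
  ultimately have "(\<lambda>m. complex_of_real (LINT \<xi>|lborel. (cmod (fourier_integral f \<xi>))\<^sup>2 * gaussian (?\<delta> m *\<^sub>R \<xi>)))
      \<longlonglongrightarrow> complex_of_real ((l2_norm f)\<^sup>2)"
    by (subst gaussian_weighted_energy_real(2)[OF fL(2)]) auto
  then have lim: "(\<lambda>m. LINT \<xi>|lborel. (cmod (fourier_integral f \<xi>))\<^sup>2 * gaussian (?\<delta> m *\<^sub>R \<xi>)) \<longlonglongrightarrow> (l2_norm f)\<^sup>2"
    by (simp only: tendsto_of_real_iff)
  have "(LINT \<xi>|lborel. (cmod (fourier_integral f \<xi>))\<^sup>2 * gaussian (?\<delta> m *\<^sub>R \<xi>)) \<le> (l2_norm (fourier_integral f))\<^sup>2" for m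
    unfolding l2_norm_square
  proof (rule integral_mono)
    show "integrable lborel (\<lambda>\<xi>. (cmod (fourier_integral f \<xi>))\<^sup>2)"
      by (rule L2_integrable[OF fourier_integral_contraction(1)[OF fL(3,2)]])
  qed (use gaussian_weighted_energy_real(1)[OF fL(2)] gaussian_le_1 in \<open>auto intro!: mult_left_le\<close>)
  then have "(l2_norm f)\<^sup>2 \<le> (l2_norm (fourier_integral f))\<^sup>2"
    by (intro LIMSEQ_le_const2[OF lim]) auto
  then show ?thesis
    by (rule power2_le_imp_le) simp
qed

lemma L2_approx_bounded:
  fixes f :: "'a::euclidean_space \<Rightarrow> complex"
  assumes f: "f \<in> L2"
  shows "(\<lambda>n. l2_norm (\<lambda>x. f x - (if norm x \<le> real n \<and> cmod (f x) \<le> real n then f x else 0))) \<longlonglongrightarrow> 0"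
proof (rule l2_norm_tendsto_0[OF f, where C = 1])
  note [measurable] = L2_measurable[OF f]
  show "(\<lambda>x. f x - (if norm x \<le> real n \<and> cmod (f x) \<le> real n then f x else 0)) \<in> borel_measurable borel" for n
    by measurable
  show "AE x in lborel. (\<lambda>n. f x - (if norm x \<le> real n \<and> cmod (f x) \<le> real n then f x else 0)) \<longlonglongrightarrow> 0"
  proof (rule AE_I2, rule tendsto_eventually)
    fix x
    show "\<forall>\<^sub>F n in sequentially. f x - (if norm x \<le> real n \<and> cmod (f x) \<le> real n then f x else 0) = 0"
      using eventually_ge_at_top[of "nat \<lceil>max (norm x) (cmod (f x))\<rceil>"]
    proof eventually_elim
      case (elim n)
      then have "max (norm x) (cmod (f x)) \<le> real n"
        by linarith
      then show ?case
        by simp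
    qed
  qed
  show "AE x in lborel. cmod (f x - (if norm x \<le> real n \<and> cmod (f x) \<le> real n then f x else 0)) \<le> 1 * cmod (f x)" for n
    by (rule AE_I2) auto
qed

text \<open>
  A measurable function is an almost everywhere limit of continuous functions. Clipping
  their values at modulus \<open>N\<close> and multiplying by a continuous cutoff makes them dominated and compactly
  supported, and does not affect the limit, since \<open>f\<close> is bounded by \<open>N\<close> and vanishes outside the ball
  of radius \<open>N\<close>.
\<close>

lemma L2_approx_continuous_bounded:
  fixes f :: "'a::euclidean_space \<Rightarrow> complex"
  assumes f: "f \<in> borel_measurable borel" and N: "N \<ge> 1" "\<And>x. cmod (f x) \<le> N" "\<And>x. norm x > N \<Longrightarrow> f x = 0"
  obtains h where "\<And>n. h n \<in> compactly_supported_continuous" "(\<lambda>n. l2_norm (\<lambda>x. f x - h n x)) \<longlonglongrightarrow> 0"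
proof -
  have "f measurable_on UNIV"
    using f by (simp add: measurable_on_iff_borel_measurable measurable_completion lebesgue_on_UNIV_eq)
  then obtain X g where X: "negligible X" and g: "\<And>n. continuous_on UNIV (g n)"
    and lim: "\<And>x. x \<notin> X \<Longrightarrow> (\<lambda>n. g n x) \<longlonglongrightarrow> f x"
    unfolding measurable_on_def by auto
  define clip :: "complex \<Rightarrow> complex" where "clip = (\<lambda>z. (N / max N (cmod z)) *\<^sub>R z)"
  define cut :: "'a \<Rightarrow> real" where "cut = (\<lambda>x. max 0 (min 1 (N + 1 - norm x)))"
  define h where "h = (\<lambda>n x. cut x *\<^sub>R clip (g n x))"
  have maxN: "max N (cmod z) \<noteq> 0" for z
    using N(1) by (auto simp: max_def)
  \<comment> \<open>Radial projection onto the disc of radius \<open>N\<close>; the denominator is positive as \<open>N \<ge> 1\<close>.\<close>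
  have clip_cont: "continuous_on UNIV clip"
    unfolding clip_def by (intro continuous_intros) (simp add: maxN)
  have clip_le: "cmod (clip z) \<le> N" for z
    using N(1) by (auto simp: clip_def max_def field_simps)
  have clip_id: "clip z = z" if "cmod z \<le> N" for z
    using N(1) that by (auto simp: clip_def)
  have h_cont: "continuous_on UNIV (h n)" for n
    unfolding h_def cut_def
    by (intro continuous_intros continuous_on_compose2[OF clip_cont g]) auto
  have h_supp: "h n x = 0" if "norm x > N + 1" for n x
    using that by (simp add: h_def cut_def)
  have h: "h n \<in> compactly_supported_continuous" for n
    using h_cont h_supp by (auto simp: compactly_supported_continuous_def intro!: exI[of _ "N + 1"])
  have cut: "0 \<le> cut x" "cut x \<le> 1" for x
    by (auto simp: cut_def)
  have cutf: "cut x *\<^sub>R f x = f x" for x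
    using N(3)[of x] by (cases "norm x > N") (auto simp: cut_def)
  have h_le: "cmod (h n x) \<le> N" for n x
    using mult_mono[OF cut(2)[of x] clip_le[of "g n x"]] cut[of x] by (simp add: h_def)
  define B :: "'a \<Rightarrow> complex" where "B = (\<lambda>x. complex_of_real (indicat_real (cball 0 (N + 1)) x))"
  have B: "B \<in> L2"
  proof (rule L2I)
    have [measurable]: "cball (0::'a) (N + 1) \<in> sets borel"
      by simp
    show "B \<in> borel_measurable borel"
      unfolding B_def by measurable
    have "(\<lambda>x. (cmod (B x))\<^sup>2) = indicat_real (cball 0 (N + 1))"
      by (auto simp: B_def indicator_def)
    moreover have "integrable lborel (indicat_real (cball (0::'a) (N + 1)))"
      by (intro integrable_real_indicator emeasure_bounded_finite) auto
    ultimately show "integrable lborel (\<lambda>x. (cmod (B x))\<^sup>2)"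
      by simp
  qed
  have "(\<lambda>n. l2_norm (\<lambda>x. f x - h n x)) \<longlonglongrightarrow> 0"
  proof (rule l2_norm_tendsto_0[OF B, where C = "2 * N"])
    show "(\<lambda>x. f x - h n x) \<in> borel_measurable borel" for n
      using f borel_measurable_continuous_onI[OF h_cont] by simp
    have "AE x in lebesgue. x \<notin> X"
      using X by (intro AE_not_in) (simp add: negligible_iff_null_sets)
    then have "AE x in lborel. x \<notin> X"
      by (simp add: AE_completion_iff)
    then show "AE x in lborel. (\<lambda>n. f x - h n x) \<longlonglongrightarrow> 0"
    proof eventually_elim
      case (elim x)
      have "(\<lambda>n. clip (g n x)) \<longlonglongrightarrow> clip (f x)"
        using clip_cont lim[OF elim] by (intro continuous_on_tendsto_compose[OF clip_cont]) auto
      then have "(\<lambda>n. f x - h n x) \<longlonglongrightarrow> f x - cut x *\<^sub>R clip (f x)"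
        unfolding h_def by (intro tendsto_intros)
      then show ?case
        using clip_id[OF N(2)[of x]] cutf[of x] by simp
    qed
    show "AE x in lborel. cmod (f x - h n x) \<le> 2 * N * cmod (B x)" for n
    proof (rule AE_I2)
      fix x
      show "cmod (f x - h n x) \<le> 2 * N * cmod (B x)"
      proof (cases "norm x \<le> N + 1")
        case True
        have "cmod (f x - h n x) \<le> cmod (f x) + cmod (h n x)"
          by (rule norm_triangle_ineq4)
        then show ?thesis
          using True N(2)[of x] h_le[of n x] by (simp add: B_def)
      next
        case False
        then show ?thesis
          using N(3)[of x] h_supp[of x n] by (simp add: B_def)
      qed
    qed
  qed
  with h show ?thesis
    by (rule that)
qed

text \<open>
  The transform being a contraction, both sides of the reversed inequality are continuous
  in the \<open>L\<^sup>2\<close> norm.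
\<close>

lemma fourier_integral_isometry_approx:
  fixes f :: "'a::euclidean_space \<Rightarrow> complex"
  assumes f: "f \<in> L2" "integrable lborel f"
    and h: "\<And>n. h n \<in> L2" "\<And>n. integrable lborel (h n)" "(\<lambda>n. l2_norm (\<lambda>x. f x - h n x)) \<longlonglongrightarrow> 0"
    and le: "\<And>n::nat. l2_norm (h n) \<le> l2_norm (fourier_integral (h n))"
  shows "l2_norm f \<le> l2_norm (fourier_integral f)"
proof -
  let ?F = fourier_integral
  have "l2_norm f - l2_norm (?F f) \<le> 2 * l2_norm (\<lambda>x. f x - h n x)" for n
  proof -
    have "l2_norm f \<le> l2_norm (\<lambda>x. f x - h n x) + l2_norm (h n)"
      using l2_norm_diff_abs[OF f(1) h(1)[of n]] by linarith
    moreover have "l2_norm (?F (h n)) \<le> l2_norm (?F f) + l2_norm (\<lambda>\<xi>. ?F f \<xi> - ?F (h n) \<xi>)"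
      using l2_norm_diff_abs[OF fourier_integral_contraction(1)[OF f] fourier_integral_contraction(1)[OF h(1,2)], of n]
      by linarith
    moreover have "l2_norm (\<lambda>\<xi>. ?F f \<xi> - ?F (h n) \<xi>) \<le> l2_norm (\<lambda>x. f x - h n x)"
      using fourier_integral_contraction(2)[OF L2_diff[OF f(1) h(1)] Bochner_Integration.integrable_diff[OF f(2) h(2)], of n]
        fourier_integral_diff[OF f(2) h(2)[of n]] by simp
    ultimately show ?thesis
      using le[of n] by linarith
  qed
  moreover have lim: "(\<lambda>n. 2 * l2_norm (\<lambda>x. f x - h n x)) \<longlonglongrightarrow> 2 * 0"
    by (intro tendsto_intros h(3))
  ultimately have "l2_norm f - l2_norm (?F f) \<le> 2 * 0"
    by (intro LIMSEQ_le_const[OF lim]) blast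
  then show ?thesis
    by simp
qed

text \<open>
  Approximate first by bounded functions of bounded support, then each of these by
  continuous functions.
\<close>

lemma fourier_integral_isometry:
  fixes f :: "'a::euclidean_space \<Rightarrow> complex"
  assumes f: "f \<in> L2" "integrable lborel f"
  shows "l2_norm (fourier_integral f) = l2_norm f"
proof -
  let ?b = "\<lambda>n x. if norm x \<le> real n \<and> cmod (f x) \<le> real n then f x else 0"
  note [measurable] = L2_measurable[OF f(1)]
  have b_L2: "?b n \<in> L2" for n
    by (rule L2_bound(1)[OF f(1), of _ 1]) auto
  have b_int: "integrable lborel (?b n)" for n
    by (rule Bochner_Integration.integrable_bound[OF f(2)]) auto
  have b: "l2_norm (?b n) \<le> l2_norm (fourier_integral (?b n))" for n
  proof -
    obtain h where h: "\<And>m. h m \<in> compactly_supported_continuous" "(\<lambda>m. l2_norm (\<lambda>x. ?b n x - h m x)) \<longlonglongrightarrow> 0"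
    proof (rule L2_approx_continuous_bounded[of "?b n" "max 1 (real n)"])
      show "cmod (?b n x) \<le> max 1 (real n)" for x
        by (auto simp: le_max_iff_disj)
    qed auto
    show ?thesis
      using h compactly_supported_L2[OF h(1)] fourier_integral_lower_bound_continuous[OF h(1)]
      by (intro fourier_integral_isometry_approx[OF b_L2 b_int, of h]) auto
  qed
  have "l2_norm f \<le> l2_norm (fourier_integral f)"
    by (rule fourier_integral_isometry_approx[OF f b_L2 b_int L2_approx_bounded[OF f(1)] b])
  with fourier_integral_contraction(2)[OF f] show ?thesis
    by simp
qed

section \<open>Existence of the Fourier--Plancherel transform\<close>

definition trunc :: "real \<Rightarrow> ('a::euclidean_space \<Rightarrow> complex) \<Rightarrow> 'a \<Rightarrow> complex" where
  "trunc R f = (\<lambda>x. indicat_real (cball 0 R) x *\<^sub>R f x)"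

lemma trunc_L2: 
  assumes f: "f \<in> L2"
  shows "trunc R f \<in> L2"
proof (rule L2_bound(1)[OF f])
  note [measurable] = L2_measurable[OF f]
  have [measurable]: "cball (0::'a) R \<in> sets borel"
    by simp
  show "trunc R f \<in> borel_measurable borel"
    unfolding trunc_def by measurable
  show "AE x in lborel. cmod (trunc R f x) \<le> 1 * cmod (f x)"
    by (auto simp: trunc_def indicator_def)
qed simp

lemma trunc_integrable:
  fixes f :: "'a::euclidean_space \<Rightarrow> complex"
  assumes f: "f \<in> L2"
  shows "integrable lborel (trunc R f)"
proof -
  have [measurable]: "cball (0::'a) R \<in> sets borel"
    by simp
  have "integrable lborel (indicat_real (cball (0::'a) R))"
    by (intro integrable_real_indicator emeasure_bounded_finite) auto
  moreover have "(\<lambda>x::'a. (cmod (complex_of_real (indicat_real (cball 0 R) x)))\<^sup>2) = indicat_real (cball 0 R)"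
    by (auto simp: indicator_def)
  ultimately have "(\<lambda>x::'a. complex_of_real (indicat_real (cball 0 R) x)) \<in> L2"
    by (intro L2I) auto
  from L2_mult_integrable[OF this f] show ?thesis
    by (simp add: trunc_def scaleR_conv_of_real)
qed

lemma trunc_tendsto:
  fixes f :: "'a::euclidean_space \<Rightarrow> complex"
  assumes f: "f \<in> L2"
  shows "((\<lambda>R. l2_norm (\<lambda>x. trunc R f x - f x)) \<longlongrightarrow> 0) at_top"
proof (rule tendsto_at_topI_sequentially)
  fix X :: "nat \<Rightarrow> real"
  assume X: "filterlim X at_top sequentially"
  show "(\<lambda>n. l2_norm (\<lambda>x. trunc (X n) f x - f x)) \<longlonglongrightarrow> 0"
  proof (rule l2_norm_tendsto_0[OF f, where C = 1])
    show "(\<lambda>x. trunc (X n) f x - f x) \<in> borel_measurable borel" for n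
      using L2_measurable[OF trunc_L2[OF f]] L2_measurable[OF f] by measurable
    show "AE x in lborel. (\<lambda>n. trunc (X n) f x - f x) \<longlonglongrightarrow> 0"
    proof (rule AE_I2, rule tendsto_eventually)
      fix x :: 'a
      have "\<forall>\<^sub>F n in sequentially. norm x \<le> X n"
        using X by (simp add: filterlim_at_top)
      then show "\<forall>\<^sub>F n in sequentially. trunc (X n) f x - f x = 0"
        by eventually_elim (simp add: trunc_def)
    qed
    show "AE x in lborel. cmod (trunc (X n) f x - f x) \<le> 1 * cmod (f x)" for n
      by (auto simp: trunc_def indicator_def)
  qed
qed

lemma trunc_fourier_L2:
  "f \<in> L2 \<Longrightarrow> fourier_integral (trunc R f) \<in> L2"
  by (rule fourier_integral_contraction(1)[OF trunc_L2 trunc_integrable])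

lemma trunc_fourier_dist:
  assumes f: "f \<in> L2" 
  shows "l2_norm (\<lambda>\<xi>. fourier_integral (trunc R f) \<xi> - fourier_integral (trunc S f) \<xi>)
    = l2_norm (\<lambda>x. trunc R f x - trunc S f x)"
  using fourier_integral_isometry[OF L2_diff[OF trunc_L2[OF f] trunc_L2[OF f]]
      Bochner_Integration.integrable_diff[OF trunc_integrable[OF f] trunc_integrable[OF f]], of R S]
    fourier_integral_diff[OF trunc_integrable[OF f] trunc_integrable[OF f], of R S]
  by simp

lemma fourier_L2_iff:
  "fourier_L2 f g \<longleftrightarrow> f \<in> L2 \<and> g \<in> L2 \<and>
    ((\<lambda>R. l2_norm (\<lambda>\<xi>. fourier_integral (trunc R f) \<xi> - g \<xi>)) \<longlongrightarrow> 0) at_top"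
proof (cases "f \<in> L2 \<and> g \<in> L2")
  case True
  then have f: "f \<in> L2" and g: "g \<in> L2"
    by auto
  let ?d = "\<lambda>R. l2_norm (\<lambda>\<xi>. fourier_integral (trunc R f) \<xi> - g \<xi>)"
  have "((\<lambda>R. \<integral>\<^sup>+ \<xi>. ennreal ((cmod (fourier_integral (trunc R f) \<xi> - g \<xi>))\<^sup>2) \<partial>lborel) \<longlongrightarrow> 0) at_top
      \<longleftrightarrow> ((\<lambda>R. ennreal ((?d R)\<^sup>2)) \<longlongrightarrow> 0) at_top"
    by (subst nn_integral_L2[OF L2_diff[OF trunc_fourier_L2[OF f] g]]) simp
  also have "\<dots> \<longleftrightarrow> ((\<lambda>R. (?d R)\<^sup>2) \<longlongrightarrow> 0) at_top"
    using tendsto_ennreal_iff[where F=at_top and f="\<lambda>R. (?d R)\<^sup>2" and x=0] by simp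
  also have "\<dots> \<longleftrightarrow> (?d \<longlongrightarrow> 0) at_top"
  proof
    assume "((\<lambda>R. (?d R)\<^sup>2) \<longlongrightarrow> 0) at_top"
    from tendsto_real_sqrt[OF this] show "(?d \<longlongrightarrow> 0) at_top"
      by simp
  qed (use tendsto_power[of ?d 0 at_top 2] in simp)
  finally show ?thesis
    using f g by (simp add: fourier_L2_def trunc_def)
qed (auto simp: fourier_L2_def)

lemma fourier_L2_norm:
  assumes "fourier_L2 f g"
  shows "l2_norm g = l2_norm f"
proof -
  have f: "f \<in> L2" and g: "g \<in> L2"
    and lim: "((\<lambda>R. l2_norm (\<lambda>\<xi>. fourier_integral (trunc R f) \<xi> - g \<xi>)) \<longlongrightarrow> 0) at_top"
    using assms by (auto simp: fourier_L2_iff)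
  have "((\<lambda>R. l2_norm (fourier_integral (trunc R f))) \<longlongrightarrow> l2_norm g) at_top"
    by (rule l2_norm_tendsto[OF trunc_fourier_L2[OF f] g lim])
  moreover have "((\<lambda>R. l2_norm (fourier_integral (trunc R f))) \<longlongrightarrow> l2_norm f) at_top"
    unfolding fourier_integral_isometry[OF trunc_L2[OF f] trunc_integrable[OF f]]
    by (rule l2_norm_tendsto[OF trunc_L2[OF f] f trunc_tendsto[OF f]])
  ultimately show ?thesis
    by (rule tendsto_unique[rotated]) simp
qed

text \<open>
  The squared norms of the increments are at most \<open>16\<^bsup>-k\<^esup>\<close>, so weighting the squared
  increments by \<open>4\<^sup>k\<close> still leaves an integrable sum. Where that sum is finite, the increments are
  \<open>O(2\<^bsup>-k\<^esup>)\<close> and therefore summable.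
\<close>

lemma L2_Cauchy_AE_convergent:
  fixes g :: "nat \<Rightarrow> 'a::euclidean_space \<Rightarrow> complex"
  assumes g: "\<And>k. g k \<in> L2" and le: "\<And>k. l2_norm (\<lambda>x. g (Suc k) x - g k x) \<le> (1 / 4) ^ k"
  shows "AE x in lborel. convergent (\<lambda>k. g k x)"
proof -
  note [measurable] = L2_measurable[OF g]
  let ?d = "\<lambda>k x. g (Suc k) x - g k x"
  let ?u = "\<lambda>k x. ennreal (4 ^ k * (cmod (?d k x))\<^sup>2)"
  have "(\<integral>\<^sup>+ x. (\<Sum>k. ?u k x) \<partial>lborel) = (\<Sum>k. \<integral>\<^sup>+ x. ?u k x \<partial>lborel)"
    by (rule nn_integral_suminf) measurable
  also have "\<dots> \<le> (\<Sum>k. ennreal ((1 / 4) ^ k))"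
  proof (rule suminf_le)
    fix k
    have "(\<integral>\<^sup>+ x. ?u k x \<partial>lborel) = (\<integral>\<^sup>+ x. ennreal (4 ^ k) * ennreal ((cmod (?d k x))\<^sup>2) \<partial>lborel)"
      by (simp add: ennreal_mult)
    also have "\<dots> = ennreal (4 ^ k) * ennreal ((l2_norm (?d k))\<^sup>2)"
      by (subst nn_integral_cmult) (auto simp: nn_integral_L2[OF L2_diff[OF g g]])
    also have "\<dots> = ennreal (4 ^ k * (l2_norm (?d k))\<^sup>2)"
      by (simp add: ennreal_mult)
    also have "\<dots> \<le> ennreal (4 ^ k * ((1 / 4) ^ k)\<^sup>2)"
      by (intro ennreal_leI mult_left_mono power_mono le) auto
    also have "4 ^ k * ((1 / 4) ^ k)\<^sup>2 = (1 / 4 :: real) ^ k"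
      by (simp add: power2_eq_square power_divide)
    finally show "(\<integral>\<^sup>+ x. ?u k x \<partial>lborel) \<le> ennreal ((1 / 4) ^ k)" .
  qed auto
  also have "\<dots> < \<infinity>"
    by (subst suminf_ennreal2) (auto intro: summable_geometric)
  finally have "(\<integral>\<^sup>+ x. (\<Sum>k. ?u k x) \<partial>lborel) \<noteq> \<infinity>"
    by simp
  then have "AE x in lborel. (\<Sum>k. ?u k x) \<noteq> \<infinity>"
    by (intro nn_integral_PInf_AE) measurable
  then show ?thesis
  proof eventually_elim
    case (elim x)
    define T where "T = (\<Sum>k. ?u k x)"
    obtain S where S: "T = ennreal S" "0 \<le> S"
      using elim unfolding T_def[symmetric] by (cases T) auto
    have d_le: "cmod (?d k x) \<le> sqrt S * (1 / 2) ^ k" for k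
    proof -
      have "v k \<le> suminf v" for v :: "nat \<Rightarrow> ennreal"
        using sum_le_suminf[OF summableI, of "{k}" v] by simp
      then have "?u k x \<le> T"
        unfolding T_def .
      then have "4 ^ k * (cmod (?d k x))\<^sup>2 \<le> S"
        using S by simp
      moreover have "(2 ^ k * cmod (?d k x))\<^sup>2 = 4 ^ k * (cmod (?d k x))\<^sup>2"
        unfolding power_mult_distrib by (simp add: power2_eq_square flip: power_mult_distrib)
      ultimately have "2 ^ k * cmod (?d k x) \<le> sqrt S"
        by (intro real_le_rsqrt) simp
      then show ?thesis
        by (simp add: field_simps power_one_over)
    qed
    have "summable (\<lambda>k. sqrt S * (1 / 2) ^ k)"
      by (intro summable_mult summable_geometric) simp
    then have "summable (\<lambda>k. ?d k x)"
      by (rule summable_comparison_test') (rule d_le)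
    then have "convergent (\<lambda>n. \<Sum>k<n. ?d k x)"
      using summable_LIMSEQ convergentI by blast
    then have "convergent (\<lambda>n. g n x - g 0 x)"
      by (simp only: sum_lessThan_telescope[of "\<lambda>k. g k x"])
    from convergent_add[OF this convergent_const[of "g 0 x"]] show ?case
      by simp
  qed
qed

text \<open>
  Along radii for which the tails of \<open>f\<close> are geometrically small, the transforms of the
  truncations form a fast Cauchy sequence by isometry, and converge almost everywhere. For a single
  radius \<open>R\<close>, Fatou's lemma bounds the distance to the limit by the norm of the tail of \<open>f\<close> beyond
  \<open>R\<close>, which is the convergence over all radii that the definition asks for.
\<close>

lemma fourier_L2_exists:
  fixes f :: "'a::euclidean_space \<Rightarrow> complex"
  assumes f: "f \<in> L2"
  shows "\<exists>g. fourier_L2 f g"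
proof -
  let ?F = "\<lambda>R. fourier_integral (trunc R f)"
  \<comment> \<open>The lower bound \<open>k\<close> on the radius makes the chosen radii tend to infinity.\<close>
  have "\<exists>R\<ge>real k. l2_norm (\<lambda>x. trunc R f x - f x) < (1 / 4) ^ k / 2" for k :: nat
  proof -
    have "\<forall>\<^sub>F R in at_top. l2_norm (\<lambda>x. trunc R f x - f x) < (1 / 4) ^ k / 2"
      using order_tendstoD(2)[OF trunc_tendsto[OF f], of "(1 / 4) ^ k / 2"] by simp
    then have "\<forall>\<^sub>F R in at_top. real k \<le> R \<and> l2_norm (\<lambda>x. trunc R f x - f x) < (1 / 4) ^ k / 2"
      using eventually_ge_at_top[of "real k"] by eventually_elim simp
    from eventually_happens[OF this] show ?thesis
      by auto
  qed
  then obtain r where r: "\<And>k. real k \<le> r k" "\<And>k. l2_norm (\<lambda>x. trunc (r k) f x - f x) < (1 / 4) ^ k / 2"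
    by metis
  have r_lim: "filterlim r at_top sequentially"
    by (rule filterlim_at_top_mono[OF filterlim_real_sequentially]) (auto simp: r)
  note [measurable] = L2_measurable[OF trunc_fourier_L2[OF f]]
  have "AE \<xi> in lborel. convergent (\<lambda>k. ?F (r k) \<xi>)"
  proof (rule L2_Cauchy_AE_convergent[OF trunc_fourier_L2[OF f]])
    fix k
    have "l2_norm (\<lambda>\<xi>. ?F (r (Suc k)) \<xi> - ?F (r k) \<xi>) = l2_norm (\<lambda>x. trunc (r (Suc k)) f x - trunc (r k) f x)"
      by (rule trunc_fourier_dist[OF f])
    also have "\<dots> \<le> l2_norm (\<lambda>x. trunc (r (Suc k)) f x - f x) + l2_norm (\<lambda>x. f x - trunc (r k) f x)"
      by (rule l2_norm_triangle_diff[OF trunc_L2[OF f] f trunc_L2[OF f]])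
    also have "\<dots> \<le> (1 / 4) ^ Suc k / 2 + (1 / 4) ^ k / 2"
      using r(2)[of k] r(2)[of "Suc k"] l2_norm_minus_commute[of f "trunc (r k) f"] by linarith
    also have "\<dots> \<le> (1 / 4) ^ k"
      by simp
    finally show "l2_norm (\<lambda>\<xi>. ?F (r (Suc k)) \<xi> - ?F (r k) \<xi>) \<le> (1 / 4) ^ k" .
  qed
  define g where "g = (\<lambda>\<xi>. lim (\<lambda>k. ?F (r k) \<xi>))"
  have g [measurable]: "g \<in> borel_measurable borel"
    unfolding g_def by (rule borel_measurable_lim_metric) measurable
  have lim: "AE \<xi> in lborel. (\<lambda>k. ?F (r k) \<xi>) \<longlonglongrightarrow> g \<xi>"
    using \<open>AE \<xi> in lborel. convergent (\<lambda>k. ?F (r k) \<xi>)\<close>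
    by eventually_elim (simp add: g_def convergent_LIMSEQ_iff)
  have bound: "(\<lambda>\<xi>. ?F R \<xi> - g \<xi>) \<in> L2 \<and> l2_norm (\<lambda>\<xi>. ?F R \<xi> - g \<xi>) \<le> l2_norm (\<lambda>x. trunc R f x - f x)" for R
  proof -
    have "(\<integral>\<^sup>+ \<xi>. ennreal ((cmod (?F R \<xi> - g \<xi>))\<^sup>2) \<partial>lborel) \<le> ennreal ((l2_norm (\<lambda>x. trunc R f x - f x))\<^sup>2)"
    proof (rule nn_integral_Fatou_le)
      show "(\<lambda>\<xi>. ennreal ((cmod (?F R \<xi> - ?F (r k) \<xi>))\<^sup>2)) \<in> borel_measurable lborel" for k
        by measurable
      show "AE \<xi> in lborel. (\<lambda>k. ennreal ((cmod (?F R \<xi> - ?F (r k) \<xi>))\<^sup>2)) \<longlonglongrightarrow> ennreal ((cmod (?F R \<xi> - g \<xi>))\<^sup>2)"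
        using lim by eventually_elim (intro tendsto_ennrealI tendsto_intros)
      have "\<forall>\<^sub>F k in sequentially. R \<le> r k"
        using r_lim by (simp add: filterlim_at_top)
      then show "\<forall>\<^sub>F k in sequentially. (\<integral>\<^sup>+ \<xi>. ennreal ((cmod (?F R \<xi> - ?F (r k) \<xi>))\<^sup>2) \<partial>lborel)
          \<le> ennreal ((l2_norm (\<lambda>x. trunc R f x - f x))\<^sup>2)"
      proof eventually_elim
        case (elim k)
        have "l2_norm (\<lambda>x. trunc R f x - trunc (r k) f x) \<le> 1 * l2_norm (\<lambda>x. trunc R f x - f x)"
          using elim f by (intro L2_bound(2) L2_diff trunc_L2 L2_measurable AE_I2)
            (auto simp: trunc_def indicator_def)
        then show ?case
          using trunc_fourier_dist[OF f, of R "r k"] nn_integral_L2[OF L2_diff[OF trunc_fourier_L2[OF f] trunc_fourier_L2[OF f]], of R "r k"]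
          by (simp add: ennreal_leI power_mono)
      qed
    qed
    then show ?thesis
      using L2I_nn_integral[of "\<lambda>\<xi>. ?F R \<xi> - g \<xi>" "l2_norm (\<lambda>x. trunc R f x - f x)"] by simp
  qed
  have "g \<in> L2"
    using L2_diff[OF trunc_fourier_L2[OF f, of 0] conjunct1[OF bound[of 0]]] by simp
  moreover have "((\<lambda>R. l2_norm (\<lambda>\<xi>. ?F R \<xi> - g \<xi>)) \<longlongrightarrow> 0) at_top"
    by (rule Lim_null_comparison[OF _ trunc_tendsto[OF f]]) (use bound in \<open>simp add: always_eventually\<close>)
  ultimately show ?thesis
    using f by (auto simp: fourier_L2_iff)
qed

section \<open>The Fourier--Plancherel transform as a unitary map\<close>

lemma fourier_L2_D:
  assumes "fourier_L2 f g"
  shows "f \<in> L2" "g \<in> L2"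
    "((\<lambda>R. l2_norm (\<lambda>\<xi>. fourier_integral (trunc R f) \<xi> - g \<xi>)) \<longlongrightarrow> 0) at_top"
  using assms by (auto simp: fourier_L2_iff)

lemma fourier_L2_lincomb:
  assumes f: "fourier_L2 f f'" and g: "fourier_L2 g g'"
  shows "fourier_L2 (\<lambda>x. a * f x + b * g x) (\<lambda>\<xi>. a * f' \<xi> + b * g' \<xi>)"
proof -
  note f = fourier_L2_D[OF f] and g = fourier_L2_D[OF g]
  let ?h = "\<lambda>x. a * f x + b * g x" and ?h' = "\<lambda>\<xi>. a * f' \<xi> + b * g' \<xi>"
  let ?A = "\<lambda>R \<xi>. fourier_integral (trunc R f) \<xi> - f' \<xi>"
  let ?B = "\<lambda>R \<xi>. fourier_integral (trunc R g) \<xi> - g' \<xi>"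
  have eq: "fourier_integral (trunc R ?h) \<xi> - ?h' \<xi> = a * ?A R \<xi> + b * ?B R \<xi>" for R \<xi>
  proof -
    have "trunc R ?h = (\<lambda>x. a * trunc R f x + b * trunc R g x)"
      by (auto simp: trunc_def indicator_def)
    then have "fourier_integral (trunc R ?h) \<xi> = a * fourier_integral (trunc R f) \<xi> + b * fourier_integral (trunc R g) \<xi>"
      using fourier_integral_lincomb[OF trunc_integrable[OF f(1)] trunc_integrable[OF g(1)]] by simp
    then show ?thesis
      by (simp add: algebra_simps)
  qed
  have "l2_norm (\<lambda>\<xi>. fourier_integral (trunc R ?h) \<xi> - ?h' \<xi>) \<le> cmod a * l2_norm (?A R) + cmod b * l2_norm (?B R)" for R
    unfolding eq
    using l2_norm_triangle[OF L2_cmult[OF L2_diff[OF trunc_fourier_L2[OF f(1)] f(2)]] L2_cmult[OF L2_diff[OF trunc_fourier_L2[OF g(1)] g(2)]], of a R b R]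
    by (simp only: l2_norm_cmult)
  then have le: "\<forall>\<^sub>F R in at_top. norm (l2_norm (\<lambda>\<xi>. fourier_integral (trunc R ?h) \<xi> - ?h' \<xi>)) \<le> cmod a * l2_norm (?A R) + cmod b * l2_norm (?B R)"
    by (simp add: always_eventually)
  have "((\<lambda>R. cmod a * l2_norm (?A R) + cmod b * l2_norm (?B R)) \<longlongrightarrow> cmod a * 0 + cmod b * 0) at_top"
    by (intro tendsto_intros f(3) g(3))
  then have "((\<lambda>R. l2_norm (\<lambda>\<xi>. fourier_integral (trunc R ?h) \<xi> - ?h' \<xi>)) \<longlongrightarrow> 0) at_top"
    by (intro Lim_null_comparison[OF le]) simp
  then show ?thesis
    using f g by (simp add: fourier_L2_iff L2_add L2_cmult)
qed

lemma fourier_L2_diff: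
  assumes "fourier_L2 f f'" "fourier_L2 g g'"
  shows "fourier_L2 (\<lambda>x. f x - g x) (\<lambda>\<xi>. f' \<xi> - g' \<xi>)"
  using fourier_L2_lincomb[OF assms, of 1 "-1"] by simp

lemma fourier_L2_dist:
  assumes "fourier_L2 f f'" "fourier_L2 g g'"
  shows "l2_norm (\<lambda>\<xi>. f' \<xi> - g' \<xi>) = l2_norm (\<lambda>x. f x - g x)"
  by (rule fourier_L2_norm[OF fourier_L2_diff[OF assms]])

text \<open>
  Isometry applied to differences: the relation is single-valued and injective modulo
  null sets.
\<close>

lemma fourier_L2_AE_iff:
  assumes f: "fourier_L2 f f'" and g: "fourier_L2 g g'"
  shows "(AE \<xi> in lborel. f' \<xi> = g' \<xi>) \<longleftrightarrow> (AE x in lborel. f x = g x)"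
  using fourier_L2_dist[OF f g] l2_dist_eq_0_iff[OF fourier_L2_D(1)[OF f] fourier_L2_D(1)[OF g]]
    l2_dist_eq_0_iff[OF fourier_L2_D(2)[OF f] fourier_L2_D(2)[OF g]] by simp

lemma fourier_L2_cong_right:
  assumes f: "fourier_L2 f g" and h: "h \<in> borel_measurable borel" "AE \<xi> in lborel. g \<xi> = h \<xi>"
  shows "fourier_L2 f h"
proof -
  note f' = fourier_L2_D[OF f]
  have hL: "h \<in> L2"
    by (rule L2_cong_AE[OF f'(2) h])
  have "l2_norm (\<lambda>\<xi>. fourier_integral (trunc R f) \<xi> - h \<xi>) = l2_norm (\<lambda>\<xi>. fourier_integral (trunc R f) \<xi> - g \<xi>)" for R
    using h by (intro l2_norm_cong_AE L2_measurable[OF L2_diff[OF trunc_fourier_L2[OF f'(1)]]] hL f'(2)) auto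
  then show ?thesis
    using f' hL by (simp add: fourier_L2_iff)
qed

lemma fourier_L2_duality:
  assumes f: "fourier_L2 f f'" and g: "fourier_L2 g g'"
  shows "(LINT \<xi>|lborel. f' \<xi> * g \<xi>) = (LINT x|lborel. f x * g' x)"
proof -
  note f = fourier_L2_D[OF f] and g = fourier_L2_D[OF g]
  have "((\<lambda>R. LINT \<xi>|lborel. fourier_integral (trunc R f) \<xi> * trunc R g \<xi>) \<longlongrightarrow> (LINT \<xi>|lborel. f' \<xi> * g \<xi>)) at_top"
    by (rule tendsto_integral_mult[OF trunc_fourier_L2[OF f(1)] f(2,3) trunc_L2[OF g(1)] g(1) trunc_tendsto[OF g(1)]])
  moreover have "((\<lambda>R. LINT x|lborel. trunc R f x * fourier_integral (trunc R g) x) \<longlongrightarrow> (LINT x|lborel. f x * g' x)) at_top"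
    by (rule tendsto_integral_mult[OF trunc_L2[OF f(1)] f(1) trunc_tendsto[OF f(1)] trunc_fourier_L2[OF g(1)] g(2,3)])
  ultimately show ?thesis
    unfolding fourier_integral_duality[OF trunc_integrable[OF f(1)] trunc_integrable[OF g(1)]]
    by (rule tendsto_unique[rotated]) simp
qed

text \<open>
  Conjugation followed by the transform is an involution. With \<open>h\<close> the transform of
  \<open>cnj g'\<close>, duality gives \<open>\<integral> h g = \<integral> cnj g' g' = \<parallel>g\<parallel>\<^sup>2\<close>, while \<open>\<parallel>h\<parallel> = \<parallel>g\<parallel>\<close>. Expanding
  \<open>\<parallel>h - cnj g\<parallel>\<^sup>2\<close> therefore gives \<open>0\<close>.
\<close>

lemma fourier_L2_conj_inverse:
  assumes g: "fourier_L2 g g'"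
  shows "fourier_L2 (\<lambda>\<xi>. cnj (g' \<xi>)) (\<lambda>x. cnj (g x))"
proof -
  note gL = fourier_L2_D[OF g]
  obtain h where h: "fourier_L2 (\<lambda>\<xi>. cnj (g' \<xi>)) h"
    using fourier_L2_exists[OF L2_cnj[OF gL(2)]] by blast
  note hL = fourier_L2_D(2)[OF h]
  let ?N = "complex_of_real ((l2_norm g)\<^sup>2)"
  have norm_h: "l2_norm h = l2_norm g"
    using fourier_L2_norm[OF h] fourier_L2_norm[OF g] by (simp add: l2_norm_cnj)
  have hg: "(LINT x|lborel. h x * g x) = ?N"
    using fourier_L2_duality[OF h g] integral_mult_cnj_self[OF gL(2)] fourier_L2_norm[OF g]
    by (simp add: mult.commute)
  have hg': "(LINT x|lborel. cnj (h x) * cnj (g x)) = ?N"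
  proof -
    have "(LINT x|lborel. cnj (h x) * cnj (g x)) = (LINT x|lborel. cnj (h x * g x))"
      by simp
    also have "\<dots> = cnj ?N"
      unfolding hg[symmetric] by (rule Bochner_Integration.integral_cnj)
    finally show ?thesis
      by simp
  qed
  let ?d = "\<lambda>x. h x - cnj (g x)"
  have dL: "?d \<in> L2"
    by (intro L2_diff hL L2_cnj gL)
  have "complex_of_real ((l2_norm ?d)\<^sup>2) = (LINT x|lborel. ?d x * cnj (?d x))"
    by (rule integral_mult_cnj_self[OF dL, symmetric])
  also have "\<dots> = (LINT x|lborel. (h x * cnj (h x) - h x * g x) - (cnj (h x) * cnj (g x) - g x * cnj (g x)))"
    by (simp add: algebra_simps)
  also have "\<dots> = ((LINT x|lborel. h x * cnj (h x)) - (LINT x|lborel. h x * g x))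
      - ((LINT x|lborel. cnj (h x) * cnj (g x)) - (LINT x|lborel. g x * cnj (g x)))"
    using hL gL by (simp add: L2_mult_integrable L2_cnj del: complex_cnj_mult)
  also have "\<dots> = 0"
    unfolding hg hg' integral_mult_cnj_self[OF hL] integral_mult_cnj_self[OF gL(1)] norm_h by simp
  finally have "l2_norm ?d = 0"
    by simp
  then have "AE x in lborel. h x = cnj (g x)"
    using l2_dist_eq_0_iff[OF hL L2_cnj[OF gL(1)]] by simp
  then show ?thesis
    using fourier_L2_cong_right[OF h L2_measurable[OF L2_cnj[OF gL(1)]]] by simp
qed

lemma fourier_L2_surjective:
  assumes g: "g \<in> L2"
  shows "\<exists>f. fourier_L2 f g"
proof -
  obtain G where "fourier_L2 (\<lambda>x. cnj (g x)) G"
    using fourier_L2_exists[OF L2_cnj[OF g]] by blast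
  from fourier_L2_conj_inverse[OF this] show ?thesis
    by auto
qed

text \<open>
  Duality with the transform of \<open>cnj g'\<close>, which is known to be \<open>cnj g\<close>.
\<close>

lemma fourier_L2_Parseval:
  assumes f: "fourier_L2 f f'" and g: "fourier_L2 g g'"
  shows "(LINT x|lborel. f x * cnj (g x)) = (LINT \<xi>|lborel. f' \<xi> * cnj (g' \<xi>))"
  using fourier_L2_duality[OF f fourier_L2_conj_inverse[OF g]] by simp

lemma l2_norm_translate:
  fixes u :: "'a::euclidean_space \<Rightarrow> complex"
  assumes [measurable]: "u \<in> borel_measurable borel"
  shows "l2_norm (\<lambda>\<xi>. u (\<xi> - \<eta>)) = l2_norm u"
proof -
  have "(LINT \<xi>|lborel. (cmod (u \<xi>))\<^sup>2) = (LINT \<xi>|lborel. (cmod (u (\<xi> - \<eta>)))\<^sup>2)"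
    using lborel_integral_affine[of "\<lambda>\<xi>. (cmod (u \<xi>))\<^sup>2" 1 "- \<eta>"] by simp
  then show ?thesis
    by (simp add: l2_norm_def)
qed

lemma L2_translate:
  fixes u :: "'a::euclidean_space \<Rightarrow> complex"
  assumes u: "u \<in> L2"
  shows "(\<lambda>\<xi>. u (\<xi> - \<eta>)) \<in> L2"
proof (rule L2I)
  note [measurable] = L2_measurable[OF u]
  show "(\<lambda>\<xi>. u (\<xi> - \<eta>)) \<in> borel_measurable borel"
    by measurable
  show "integrable lborel (\<lambda>\<xi>. (cmod (u (\<xi> - \<eta>)))\<^sup>2)"
    using lborel_integrable_affine[OF L2_integrable[OF u], of 1 "- \<eta>"] by simp
qed

lemma fourier_L2_modulation:
  fixes f :: "'a::euclidean_space \<Rightarrow> complex"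
  assumes f: "fourier_L2 f g"
  shows "fourier_L2 (\<lambda>x. cis (\<eta> \<bullet> x) * f x) (\<lambda>\<xi>. g (\<xi> - \<eta>))"
proof -
  note fL = fourier_L2_D[OF f]
  note [measurable] = L2_measurable[OF fL(1)] L2_measurable[OF fL(2)] L2_measurable[OF trunc_fourier_L2[OF fL(1)]]
  let ?h = "\<lambda>x. cis (\<eta> \<bullet> x) * f x"
  have hL: "?h \<in> L2"
    by (rule L2_bound(1)[OF fL(1), of _ 1]) (auto simp: norm_mult)
  have eq: "fourier_integral (trunc R ?h) \<xi> = fourier_integral (trunc R f) (\<xi> - \<eta>)" for R \<xi>
  proof -
    have "cis (- (x \<bullet> \<xi>)) * trunc R ?h x = cis (- (x \<bullet> (\<xi> - \<eta>))) * trunc R f x" for x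
    proof -
      have "cis (- (x \<bullet> \<xi>)) * cis (\<eta> \<bullet> x) = cis (- (x \<bullet> (\<xi> - \<eta>)))"
        by (simp add: cis_mult inner_diff_right inner_commute)
      then show ?thesis
        by (simp add: trunc_def scaleR_conv_of_real mult_ac)
    qed
    then show ?thesis
      by (simp add: fourier_integral_def)
  qed
  have "l2_norm (\<lambda>\<xi>. fourier_integral (trunc R ?h) \<xi> - g (\<xi> - \<eta>)) = l2_norm (\<lambda>\<xi>. fourier_integral (trunc R f) \<xi> - g \<xi>)" for R
    unfolding eq by (rule l2_norm_translate) measurable
  then show ?thesis
    using fL hL L2_translate[OF fL(2)] by (simp add: fourier_L2_iff)
qed

section \<open>Fourier multipliers of modulus one and their generators\<close>

definition fourier :: "('a::euclidean_space \<Rightarrow> complex) \<Rightarrow> 'a \<Rightarrow> complex" where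
  "fourier f = (SOME g. fourier_L2 f g)"

definition inverse_fourier :: "('a::euclidean_space \<Rightarrow> complex) \<Rightarrow> 'a \<Rightarrow> complex" where
  "inverse_fourier g = (SOME f. fourier_L2 f g)"

lemma fourier_L2_fourier: "f \<in> L2 \<Longrightarrow> fourier_L2 f (fourier f)"
  unfolding fourier_def by (rule someI_ex[OF fourier_L2_exists])

lemma fourier_L2_inverse_fourier: "g \<in> L2 \<Longrightarrow> fourier_L2 (inverse_fourier g) g"
  unfolding inverse_fourier_def by (rule someI_ex[OF fourier_L2_surjective])

text \<open>
  The Fourier multiplier \<open>e\<^bsup>itw\<^esup>\<close>.
\<close>

definition phase_group :: "('a::euclidean_space \<Rightarrow> real) \<Rightarrow> real \<Rightarrow> ('a \<Rightarrow> complex) \<Rightarrow> 'a \<Rightarrow> complex" where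
  "phase_group w t f = inverse_fourier (\<lambda>\<xi>. cis (t * w \<xi>) * fourier f \<xi>)"

lemma L2_cis_mult:
  assumes f: "f \<in> L2" and p: "p \<in> borel_measurable borel"
  shows "(\<lambda>\<xi>. cis (p \<xi>) * f \<xi>) \<in> L2"
  by (rule L2_bound(1)[OF f, of _ 1]) (use L2_measurable[OF f] p in \<open>auto simp: norm_mult\<close>)

lemma fourier_L2_phase_group:
  assumes w [measurable]: "w \<in> borel_measurable borel" and f: "fourier_L2 f f'"
  shows "fourier_L2 (phase_group w t f) (\<lambda>\<xi>. cis (t * w \<xi>) * f' \<xi>)"
proof -
  note fL = fourier_L2_D[OF f]
  note F = fourier_L2_fourier[OF fL(1)]
  have *: "fourier_L2 (phase_group w t f) (\<lambda>\<xi>. cis (t * w \<xi>) * fourier f \<xi>)"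
    unfolding phase_group_def
    by (intro fourier_L2_inverse_fourier L2_cis_mult fourier_L2_D(2)[OF F]) measurable
  have "AE \<xi> in lborel. fourier f \<xi> = f' \<xi>"
    using fourier_L2_AE_iff[OF F f] by simp
  then show ?thesis
    using L2_measurable[OF fL(2)] by (intro fourier_L2_cong_right[OF *]) (auto elim: eventually_mono)
qed

lemma tendsto_at_0_sequentiallyI:
  fixes f :: "real \<Rightarrow> 'b::topological_space"
  assumes "\<And>X. (\<And>i::nat. X i \<noteq> 0) \<Longrightarrow> X \<longlonglongrightarrow> 0 \<Longrightarrow> (\<lambda>i. f (X i)) \<longlonglongrightarrow> l"
  shows "(f \<longlongrightarrow> l) (at 0)"
  using assms by (simp add: tendsto_at_iff_sequentially comp_def)

text \<open>
  Each axiom, transported by the transform, is a pointwise identity for \<open>cis (t * w \<xi>)\<close>,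
  except for strong continuity, which is dominated convergence.
\<close>

lemma unitary_group_phase_group:
  fixes w :: "'a::euclidean_space \<Rightarrow> real"
  assumes w [measurable]: "w \<in> borel_measurable borel"
  shows "unitary_group (phase_group w)"
proof -
  let ?V = "phase_group w"
  note FV = fourier_L2_phase_group[OF w]
  have 1: "?V t f \<in> L2 \<and> l2_norm (?V t f) = l2_norm f" if f: "f \<in> L2" for t f
  proof -
    note F = fourier_L2_fourier[OF f]
    have "l2_norm (?V t f) = l2_norm (\<lambda>\<xi>. cis (t * w \<xi>) * fourier f \<xi>)"
      by (rule fourier_L2_norm[OF FV[OF F], symmetric])
    also have "\<dots> = l2_norm (fourier f)"
      by (simp add: l2_norm_def norm_mult)
    finally show ?thesis
      using fourier_L2_D(1)[OF FV[OF F]] fourier_L2_norm[OF F] by simp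
  qed
  have 2: "AE x in lborel. ?V t (\<lambda>y. a * f y + b * g y) x = a * ?V t f x + b * ?V t g x"
    if f: "f \<in> L2" and g: "g \<in> L2" for t f g a b
    using FV[OF fourier_L2_lincomb[OF fourier_L2_fourier[OF f] fourier_L2_fourier[OF g], of a b], of t]
      fourier_L2_lincomb[OF FV[OF fourier_L2_fourier[OF f], of t] FV[OF fourier_L2_fourier[OF g], of t], of a b]
    by (rule fourier_L2_AE_iff[THEN iffD1]) (simp add: algebra_simps)
  have 3: "AE x in lborel. ?V 0 f x = f x" if f: "f \<in> L2" for f
    by (rule fourier_L2_AE_iff[OF FV[OF fourier_L2_fourier[OF f]] fourier_L2_fourier[OF f], THEN iffD1]) simp
  have 4: "AE x in lborel. ?V (t + u) f x = ?V t (?V u f) x" if f: "f \<in> L2" for t u f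
    using FV[OF fourier_L2_fourier[OF f], of "t + u"] FV[OF FV[OF fourier_L2_fourier[OF f], of u], of t]
    by (rule fourier_L2_AE_iff[THEN iffD1]) (simp add: cis_mult distrib_right mult.assoc[symmetric])
  have 5: "((\<lambda>t. l2_norm (\<lambda>x. ?V t f x - f x)) \<longlongrightarrow> 0) (at 0)" if f: "f \<in> L2" for f
  proof -
    note F = fourier_L2_fourier[OF f]
    note [measurable] = L2_measurable[OF fourier_L2_D(2)[OF F]]
    have eq: "l2_norm (\<lambda>x. ?V t f x - f x) = l2_norm (\<lambda>\<xi>. cis (t * w \<xi>) * fourier f \<xi> - fourier f \<xi>)" for t
      by (rule fourier_L2_dist[OF FV[OF F] F, symmetric])
    show ?thesis
      unfolding eq
    proof (rule tendsto_at_0_sequentiallyI)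
      fix X :: "nat \<Rightarrow> real"
      assume X: "X \<longlonglongrightarrow> 0"
      show "(\<lambda>i. l2_norm (\<lambda>\<xi>. cis (X i * w \<xi>) * fourier f \<xi> - fourier f \<xi>)) \<longlonglongrightarrow> 0"
      proof (rule l2_norm_tendsto_0[OF fourier_L2_D(2)[OF F], where C = 2])
        have "(\<lambda>i. cis (X i * w \<xi>) * fourier f \<xi> - fourier f \<xi>) \<longlonglongrightarrow> cis (0 * w \<xi>) * fourier f \<xi> - fourier f \<xi>" for \<xi>
          unfolding cis_conv_exp by (intro tendsto_intros X)
        then show "AE \<xi> in lborel. (\<lambda>i. cis (X i * w \<xi>) * fourier f \<xi> - fourier f \<xi>) \<longlonglongrightarrow> 0"
          by simp
        show "AE \<xi> in lborel. cmod (cis (X i * w \<xi>) * fourier f \<xi> - fourier f \<xi>) \<le> 2 * cmod (fourier f \<xi>)" for i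
          by (rule AE_I2) (rule order_trans[OF norm_triangle_ineq4], simp add: norm_mult)
      qed measurable
    qed
  qed
  show ?thesis
    unfolding unitary_group_def using 1 2 3 4 5 by blast
qed

lemma norm_cis_minus_1_le: "cmod (cis a - 1) \<le> \<bar>a\<bar>"
  using iexp_approx1[of a 0] by (simp add: cis_conv_exp)

lemma cis_difference_quotient:
  "((\<lambda>h. (cis (h * a) - 1) / complex_of_real h) \<longlongrightarrow> \<i> * complex_of_real a) (at 0)"
proof -
  have "((\<lambda>z. exp (\<i> * complex_of_real a * z)) has_field_derivative \<i> * complex_of_real a) (at 0)"
    by (auto intro!: derivative_eq_intros)
  then have "((\<lambda>z. (exp (\<i> * complex_of_real a * z) - 1) / z) \<longlongrightarrow> \<i> * complex_of_real a) (at 0)"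
    by (simp add: DERIV_def)
  moreover have "filterlim complex_of_real (at 0) (at 0)"
    by (auto simp: filterlim_at eventually_at_filter intro!: tendsto_eq_intros)
  ultimately have "((\<lambda>h. (exp (\<i> * complex_of_real a * complex_of_real h) - 1) / complex_of_real h) \<longlongrightarrow> \<i> * complex_of_real a) (at 0)"
    by (rule filterlim_compose)
  then show ?thesis
    by (simp add: cis_conv_exp mult_ac)
qed

text \<open>
  In Fourier space the difference quotient is multiplication by \<open>(cis (h w) - 1) / h\<close>,
  which tends pointwise to \<open>i w\<close> and is bounded by \<open>|w|\<close>. If \<open>w f'\<close> is the square-integrable \<open>g'\<close>,
  dominated convergence gives the limit; conversely, Fatou's lemma identifies any limit in \<open>L\<^sup>2\<close> with
  the pointwise one. This equivalence is what makes the domains agree.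
\<close>

lemma phase_group_derivative_iff:
  fixes w :: "'a::euclidean_space \<Rightarrow> real"
  assumes w [measurable]: "w \<in> borel_measurable borel"
    and f: "fourier_L2 f f'" and g: "fourier_L2 g g'"
  shows "((\<lambda>h. l2_norm (\<lambda>x. (phase_group w h f x - f x) / of_real h - \<i> * g x)) \<longlongrightarrow> 0) (at 0)
    \<longleftrightarrow> (AE \<xi> in lborel. g' \<xi> = w \<xi> *\<^sub>R f' \<xi>)"
proof -
  note fL = fourier_L2_D(2)[OF f] and gL = fourier_L2_D(2)[OF g]
  note [measurable] = L2_measurable[OF fL] L2_measurable[OF gL]
  let ?q = "\<lambda>h \<xi>. (cis (h * w \<xi>) - 1) / complex_of_real h * f' \<xi> - \<i> * g' \<xi>"
  have Fq: "fourier_L2 (\<lambda>x. (phase_group w h f x - f x) / of_real h - \<i> * g x) (?q h)" for h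
    using fourier_L2_lincomb[OF fourier_L2_diff[OF fourier_L2_phase_group[OF w f, of h] f] g, of "1 / of_real h" "- \<i>"]
    by (simp add: field_simps)
  have eq: "l2_norm (\<lambda>x. (phase_group w h f x - f x) / of_real h - \<i> * g x) = l2_norm (?q h)" for h
    by (rule fourier_L2_norm[OF Fq, symmetric])
  have lim: "(\<lambda>i. ?q (X i) \<xi>) \<longlonglongrightarrow> \<i> * complex_of_real (w \<xi>) * f' \<xi> - \<i> * g' \<xi>"
    if X: "\<And>i::nat. X i \<noteq> 0" "X \<longlonglongrightarrow> 0" for X \<xi>
  proof -
    have "filterlim X (at 0) sequentially"
      using X by (simp add: filterlim_at)
    then show ?thesis
      by (intro tendsto_intros filterlim_compose[OF cis_difference_quotient])
  qed
  show ?thesis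
    unfolding eq
  proof
    assume q0: "((\<lambda>h. l2_norm (?q h)) \<longlongrightarrow> 0) (at 0)"
    define X where "X = (\<lambda>i. 1 / real (Suc i))"
    have X: "X i \<noteq> 0" "X \<longlonglongrightarrow> 0" for i
      unfolding X_def by (simp, rule LIMSEQ_Suc[OF lim_1_over_n])
    have "filterlim X (at 0) sequentially"
      using X by (simp add: filterlim_at)
    then have qX: "(\<lambda>i. l2_norm (?q (X i))) \<longlonglongrightarrow> 0"
      by (rule filterlim_compose[OF q0])
    let ?d = "\<lambda>\<xi>. \<i> * complex_of_real (w \<xi>) * f' \<xi> - \<i> * g' \<xi>"
    have "(\<integral>\<^sup>+ \<xi>. ennreal ((cmod (?d \<xi>))\<^sup>2) \<partial>lborel) \<le> 0 + ennreal e" (is "?I \<le> _") if e: "e > 0" for e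
    proof -
      have "(\<integral>\<^sup>+ \<xi>. ennreal ((cmod (?d \<xi>))\<^sup>2) \<partial>lborel) \<le> ennreal e"
      proof (rule nn_integral_Fatou_le)
        show "(\<lambda>\<xi>. ennreal ((cmod (?q (X i) \<xi>))\<^sup>2)) \<in> borel_measurable lborel" for i
          by measurable
        show "AE \<xi> in lborel. (\<lambda>i. ennreal ((cmod (?q (X i) \<xi>))\<^sup>2)) \<longlonglongrightarrow> ennreal ((cmod (?d \<xi>))\<^sup>2)"
          by (intro AE_I2 tendsto_ennrealI tendsto_power tendsto_norm lim X)
        have "(\<lambda>i. (l2_norm (?q (X i)))\<^sup>2) \<longlonglongrightarrow> 0\<^sup>2"
          by (intro tendsto_power qX)
        then have "\<forall>\<^sub>F i in sequentially. (l2_norm (?q (X i)))\<^sup>2 < e"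
          using e by (intro order_tendstoD(2)) auto
        then show "\<forall>\<^sub>F i in sequentially. (\<integral>\<^sup>+ \<xi>. ennreal ((cmod (?q (X i) \<xi>))\<^sup>2) \<partial>lborel) \<le> ennreal e"
          unfolding nn_integral_L2[OF fourier_L2_D(2)[OF Fq]]
          by eventually_elim (intro ennreal_leI less_imp_le)
      qed
      then show ?thesis
        by simp
    qed
    then have "?I \<le> 0"
      by (rule ennreal_le_epsilon)
    then have "?I = 0"
      by (simp only: le_zero_eq)
    then have "AE \<xi> in lborel. ennreal ((cmod (?d \<xi>))\<^sup>2) = 0"
      by (rule nn_integral_0_iff_AE[THEN iffD1, rotated]) measurable
    then show "AE \<xi> in lborel. g' \<xi> = w \<xi> *\<^sub>R f' \<xi>"
    proof eventually_elim
      case (elim \<xi>)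
      then have "\<i> * (complex_of_real (w \<xi>) * f' \<xi> - g' \<xi>) = 0"
        by (simp add: algebra_simps)
      then show ?case
        by (simp add: scaleR_conv_of_real)
    qed
  next
    assume ae: "AE \<xi> in lborel. g' \<xi> = w \<xi> *\<^sub>R f' \<xi>"
    show "((\<lambda>h. l2_norm (?q h)) \<longlongrightarrow> 0) (at 0)"
    proof (rule tendsto_at_0_sequentiallyI)
      fix X :: "nat \<Rightarrow> real"
      assume X: "\<And>i. X i \<noteq> 0" "X \<longlonglongrightarrow> 0"
      show "(\<lambda>i. l2_norm (?q (X i))) \<longlonglongrightarrow> 0"
      proof (rule l2_norm_tendsto_0[OF gL, where C = 2])
        show "AE \<xi> in lborel. (\<lambda>i. ?q (X i) \<xi>) \<longlonglongrightarrow> 0"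
          using ae
        proof eventually_elim
          case (elim \<xi>)
          then show ?case
            using lim[OF X, of \<xi>] by (simp add: scaleR_conv_of_real)
        qed
        show "AE \<xi> in lborel. cmod (?q (X i) \<xi>) \<le> 2 * cmod (g' \<xi>)" for i
          using ae
        proof eventually_elim
          case (elim \<xi>)
          have "cmod ((cis (X i * w \<xi>) - 1) / complex_of_real (X i)) \<le> \<bar>w \<xi>\<bar>"
            using norm_cis_minus_1_le[of "X i * w \<xi>"] X(1)[of i]
            by (simp add: norm_divide abs_mult field_simps)
          then have "cmod ((cis (X i * w \<xi>) - 1) / complex_of_real (X i) * f' \<xi>) \<le> cmod (g' \<xi>)"
            unfolding elim norm_mult norm_scaleR by (rule mult_right_mono) simp
          then show ?case
            using norm_triangle_ineq4[of "(cis (X i * w \<xi>) - 1) / complex_of_real (X i) * f' \<xi>" "\<i> * g' \<xi>"]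
            by (simp add: norm_mult)
        qed
      qed measurable
    qed
  qed
qed

text \<open>
  The Sobolev weight is bounded by a multiple of \<open>1 + |\<xi>|\<^sup>s\<close>, so membership in the Sobolev
  space is implied by square integrability of \<open>f\<close> and of \<open>|\<xi>|\<^sup>s f\<close>.
\<close>

lemma fourier_weight_L2:
  fixes f g :: "'a::euclidean_space \<Rightarrow> complex"
  assumes f: "f \<in> L2" and g: "g \<in> L2" and s: "s \<ge> 0"
    and ae: "AE \<xi> in lborel. g \<xi> = norm \<xi> powr s *\<^sub>R f \<xi>"
  shows "(\<lambda>\<xi>. (1 + (norm \<xi>)\<^sup>2) powr (s / 2) *\<^sub>R f \<xi>) \<in> L2"
proof -
  note [measurable] = L2_measurable[OF f] L2_measurable[OF g]
  have "(\<lambda>\<xi>. complex_of_real (cmod (h \<xi>))) \<in> L2" if h: "h \<in> L2" for h :: "'a \<Rightarrow> complex"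
    by (rule L2_bound(1)[OF h, of _ 1]) (use L2_measurable[OF h] in auto)
  from L2_add[OF this[OF f] this[OF g]]
  have fg: "(\<lambda>\<xi>. complex_of_real (cmod (f \<xi>)) + complex_of_real (cmod (g \<xi>))) \<in> L2" .
  have weight: "(1 + r\<^sup>2) powr (s / 2) \<le> 2 powr (s / 2) * (1 + r powr s)" if "r \<ge> 0" for r :: real
  proof (cases "r \<le> 1")
    case True
    then have "(1 + r\<^sup>2) powr (s / 2) \<le> 2 powr (s / 2)"
      using that s by (intro powr_mono2) (auto simp: power_le_one)
    also have "\<dots> \<le> 2 powr (s / 2) * (1 + r powr s)"
      by simp
    finally show ?thesis .
  next
    case False
    then have "1 + r\<^sup>2 \<le> 2 * r\<^sup>2"
      by (simp add: one_le_power)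
    then have "(1 + r\<^sup>2) powr (s / 2) \<le> (2 * r\<^sup>2) powr (s / 2)"
      using s by (intro powr_mono2) auto
    also have "\<dots> = 2 powr (s / 2) * r powr s"
      using False by (simp add: powr_mult powr_powr flip: powr_numeral)
    also have "\<dots> \<le> 2 powr (s / 2) * (1 + r powr s)"
      by simp
    finally show ?thesis .
  qed
  show ?thesis
  proof (rule L2_bound(1)[OF fg])
    show "AE \<xi> in lborel. cmod ((1 + (norm \<xi>)\<^sup>2) powr (s / 2) *\<^sub>R f \<xi>)
        \<le> 2 powr (s / 2) * cmod (complex_of_real (cmod (f \<xi>)) + complex_of_real (cmod (g \<xi>)))"
      using ae
    proof eventually_elim
      case (elim \<xi>)
      have "cmod (complex_of_real (cmod (f \<xi>)) + complex_of_real (cmod (g \<xi>))) = cmod (f \<xi>) + cmod (g \<xi>)"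
        unfolding of_real_add[symmetric] norm_of_real by simp
      also have "\<dots> = (1 + norm \<xi> powr s) * cmod (f \<xi>)"
        using elim by (simp add: algebra_simps)
      finally show ?case
        using mult_right_mono[OF weight[of "norm \<xi>"], of "cmod (f \<xi>)"] by (simp add: mult.assoc)
    qed
  qed simp_all
qed

lemma frac_laplacian_iff:
  fixes f g :: "'a::euclidean_space \<Rightarrow> complex"
  assumes s: "s \<ge> 0" and f: "fourier_L2 f f'" and g: "fourier_L2 g g'"
  shows "frac_laplacian s f g \<longleftrightarrow> (AE \<xi> in lborel. g' \<xi> = norm \<xi> powr s *\<^sub>R f' \<xi>)"
proof
  assume "frac_laplacian s f g"
  then obtain fh gh where fh: "fourier_L2 f fh" and gh: "fourier_L2 g gh"
    and ae: "AE \<xi> in lborel. gh \<xi> = norm \<xi> powr s *\<^sub>R fh \<xi>"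
    by (auto simp: frac_laplacian_def)
  have "AE \<xi> in lborel. fh \<xi> = f' \<xi>" "AE \<xi> in lborel. gh \<xi> = g' \<xi>"
    using fourier_L2_AE_iff[OF fh f] fourier_L2_AE_iff[OF gh g] by auto
  with ae show "AE \<xi> in lborel. g' \<xi> = norm \<xi> powr s *\<^sub>R f' \<xi>"
    by eventually_elim simp
next
  assume ae: "AE \<xi> in lborel. g' \<xi> = norm \<xi> powr s *\<^sub>R f' \<xi>"
  have "(\<lambda>\<xi>. (1 + (norm \<xi>)\<^sup>2) powr (s / 2) *\<^sub>R f' \<xi>) \<in> L2"
    by (rule fourier_weight_L2[OF fourier_L2_D(2)[OF f] fourier_L2_D(2)[OF g] s ae])
  then show "frac_laplacian s f g"
    using f g ae fourier_L2_D(1)[OF f] fourier_L2_D(1)[OF g]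
    unfolding frac_laplacian_def sobolev_def by blast
qed

lemma phase_group_generates:
  assumes s: "s \<ge> 0"
  shows "generates (frac_laplacian s) (phase_group (\<lambda>\<xi>::'a::euclidean_space. norm \<xi> powr s))"
  unfolding generates_def
proof (intro conjI ballI)
  have w: "(\<lambda>\<xi>::'a. norm \<xi> powr s) \<in> borel_measurable borel"
    by measurable
  show "unitary_group (phase_group (\<lambda>\<xi>::'a. norm \<xi> powr s))"
    by (rule unitary_group_phase_group[OF w])
  fix f g :: "'a \<Rightarrow> complex"
  assume "f \<in> L2" "g \<in> L2"
  then have F: "fourier_L2 f (fourier f)" "fourier_L2 g (fourier g)"
    by (auto intro: fourier_L2_fourier)
  show "frac_laplacian s f g \<longleftrightarrow>
      ((\<lambda>h. l2_norm (\<lambda>x. (phase_group (\<lambda>\<xi>. norm \<xi> powr s) h f x - f x) / of_real h - \<i> * g x)) \<longlongrightarrow> 0) (at 0)"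
    unfolding frac_laplacian_iff[OF s F] phase_group_derivative_iff[OF w F] ..
qed

section \<open>Uniqueness of the group with a given generator\<close>

lemma unitary_group_D:
  assumes "unitary_group U" "f \<in> L2"
  shows "U t f \<in> L2" "l2_norm (U t f) = l2_norm f"
    "AE x in lborel. U 0 f x = f x"
    "AE x in lborel. U (t + u) f x = U t (U u f) x"
    "g \<in> L2 \<Longrightarrow> AE x in lborel. U t (\<lambda>y. a * f y + b * g y) x = a * U t f x + b * U t g x"
  using assms unfolding unitary_group_def by blast+

lemma unitary_group_diff:
  assumes U: "unitary_group U" and f: "f \<in> L2" and g: "g \<in> L2"
  shows "l2_norm (\<lambda>x. U t f x - U t g x) = l2_norm (\<lambda>x. f x - g x)"
proof -
  have L2: "U t h \<in> L2" "l2_norm (U t h) = l2_norm h" if "h \<in> L2" for h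
    using U that by (auto simp: unitary_group_def)
  have lin: "AE x in lborel. U t (\<lambda>y. 1 * f y + (-1) * g y) x = 1 * U t f x + (-1) * U t g x"
    by (rule unitary_group_D(5)[OF U f g])
  have fg: "(\<lambda>x. f x - g x) \<in> L2"
    by (rule L2_diff[OF f g])
  have "l2_norm (U t (\<lambda>x. f x - g x)) = l2_norm (\<lambda>x. U t f x - U t g x)"
    using lin by (intro l2_norm_cong_AE L2_measurable L2_diff L2 f g fg) simp
  then show ?thesis
    using L2(2)[OF fg] by simp
qed

lemma unitary_group_lincomb_diff:
  assumes U: "unitary_group U" and f: "f \<in> L2" and g: "g \<in> L2" and h: "h \<in> L2"
  shows "AE x in lborel. U t (\<lambda>y. a * (f y - g y) + b * h y) x = a * (U t f x - U t g x) + b * U t h x"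
proof -
  have 1: "AE x in lborel. U t (\<lambda>y. a * (f y - g y) + b * h y) x = a * U t (\<lambda>y. f y - g y) x + b * U t h x"
    by (rule unitary_group_D(5)[OF U L2_diff[OF f g] h])
  have "AE x in lborel. U t (\<lambda>y. 1 * f y + (-1) * g y) x = 1 * U t f x + (-1) * U t g x"
    by (rule unitary_group_D(5)[OF U f g])
  with 1 show ?thesis
    by eventually_elim simp
qed

lemma generates_D:
  assumes "generates H U" "f \<in> L2" "g \<in> L2"
  shows "H f g \<longleftrightarrow> ((\<lambda>h. l2_norm (\<lambda>x. (U h f x - f x) / of_real h - \<i> * g x)) \<longlongrightarrow> 0) (at 0)"
  using assms unfolding generates_def by blast

text \<open>
  The difference quotient of the orbit at time \<open>t\<close> is \<open>U t\<close> applied to that at time \<open>0\<close>, and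
  \<open>U t\<close> preserves norms.
\<close>

lemma generates_invariant:
  assumes gen: "generates H U" and f: "f \<in> L2" and g: "g \<in> L2" and H: "H f g"
  shows "H (U t f) (U t g)"
proof -
  have U: "unitary_group U"
    using gen by (simp add: generates_def)
  have L2: "U t h \<in> L2" "l2_norm (U t h) = l2_norm h" if "h \<in> L2" for t h
    using U that by (auto simp: unitary_group_def)
  have add: "AE x in lborel. U (a + b) f x = U a (U b f) x" for a b
    by (rule unitary_group_D(4)[OF U f])
  let ?q = "\<lambda>h x. 1 / of_real h * (U h f x - f x) + (- \<i>) * g x"
  have qL2: "?q h \<in> L2" for h
    by (intro L2_add L2_cmult L2_diff L2 f g)
  have eq: "l2_norm (\<lambda>x. (U h (U t f) x - U t f x) / of_real h - \<i> * U t g x) = l2_norm (\<lambda>x. (U h f x - f x) / of_real h - \<i> * g x)" for h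
  proof -
    have "AE x in lborel. (U h (U t f) x - U t f x) / of_real h - \<i> * U t g x = U t (?q h) x"
      using add[of h t] add[of t h, unfolded add.commute[of t h]]
        unitary_group_lincomb_diff[OF U L2(1)[OF f] f g, of t "1 / of_real h" h "- \<i>"]
    proof eventually_elim
      case (elim x)
      then show ?case
        by (simp add: field_simps)
    qed
    moreover have "(\<lambda>x. (U h (U t f) x - U t f x) / of_real h - \<i> * U t g x) \<in> L2"
      using L2_diff[OF L2_cmult[OF L2_diff[OF L2(1)[OF L2(1)[OF f]] L2(1)[OF f]], of "1 / of_real h"] L2_cmult[OF L2(1)[OF g], of "\<i>"]]
      by simp
    ultimately have "l2_norm (\<lambda>x. (U h (U t f) x - U t f x) / of_real h - \<i> * U t g x) = l2_norm (U t (?q h))"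
      using L2(1)[OF qL2] by (intro l2_norm_cong_AE L2_measurable)
    also have "\<dots> = l2_norm (?q h)"
      by (rule L2(2)[OF qL2])
    finally show ?thesis
      by simp
  qed
  show ?thesis
    using generates_D[OF gen f g] generates_D[OF gen L2(1)[OF f] L2(1)[OF g], of t t] H by (simp only: eq)
qed

text \<open>
  Let \<open>N t\<close> be the distance between the two orbits. Since \<open>V h\<close> is an isometry, \<open>N\<close> changes
  between \<open>t\<close> and \<open>t + h\<close> by at most the distance of \<open>U h u\<close> and \<open>V h u\<close>, where \<open>u = U t f\<close>. As \<open>u\<close> is
  in the domain, both have the same derivative at \<open>h = 0\<close>, so this is \<open>o(h)\<close>. Thus \<open>N\<close> has derivative
  zero everywhere, and \<open>N 0 = 0\<close>.
\<close>

lemma generates_unique: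
  assumes genU: "generates H U" and genV: "generates H V"
    and f: "f \<in> L2" and g: "g \<in> L2" and H: "H f g"
  shows "AE x in lborel. U t f x = V t f x"
proof -
  have U: "unitary_group U" and V: "unitary_group V"
    using genU genV by (auto simp: generates_def)
  have UL2: "U t h \<in> L2" and VL2: "V t h \<in> L2" if "h \<in> L2" for t h
    using U V that by (auto simp: unitary_group_def)
  have U_add: "AE x in lborel. U (a + b) f x = U a (U b f) x" and V_add: "AE x in lborel. V (a + b) f x = V a (V b f) x" for a b
    by (rule unitary_group_D(4)[OF U f], rule unitary_group_D(4)[OF V f])
  define N where "N = (\<lambda>t. l2_norm (\<lambda>x. U t f x - V t f x))"
  have deriv: "(N has_field_derivative 0) (at t)" for t
  proof -
    define u where "u = U t f"
    have uL2: "u \<in> L2"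
      unfolding u_def by (rule UL2[OF f])
    let ?qU = "\<lambda>h x. (U h u x - u x) / of_real h - \<i> * U t g x"
    let ?qV = "\<lambda>h x. (V h u x - u x) / of_real h - \<i> * U t g x"
    have Hu: "H u (U t g)"
      unfolding u_def by (rule generates_invariant[where H = H, OF genU f g H])
    have lim: "((\<lambda>h. l2_norm (?qU h) + l2_norm (?qV h)) \<longlongrightarrow> 0 + 0) (at 0)"
      by (intro tendsto_add generates_D[OF genU uL2 UL2[OF g], THEN iffD1] generates_D[OF genV uL2 UL2[OF g], THEN iffD1] Hu)
    have qL2: "?qU h \<in> L2" "?qV h \<in> L2" for h
      using L2_diff[OF L2_cmult[OF L2_diff[OF UL2[OF uL2] uL2], of "1 / of_real h"] L2_cmult[OF UL2[OF g], of "\<i>"]]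
        L2_diff[OF L2_cmult[OF L2_diff[OF VL2[OF uL2] uL2], of "1 / of_real h"] L2_cmult[OF UL2[OF g], of "\<i>"]]
      by auto
    have bound: "norm ((N (t + h) - N t) / h) \<le> l2_norm (?qU h) + l2_norm (?qV h)" if h: "h \<noteq> 0" for h
    proof -
      have "N (t + h) = l2_norm (\<lambda>x. U h u x - V h (V t f) x)"
        unfolding N_def u_def
      proof (rule l2_norm_cong_AE)
        show "AE x in lborel. U (t + h) f x - V (t + h) f x = U h (U t f) x - V h (V t f) x"
          using U_add[of h t] V_add[of h t] unfolding add.commute[of h t] by eventually_elim simp
      qed (intro L2_measurable L2_diff UL2 VL2 f)+
      moreover have "N t = l2_norm (\<lambda>x. V h u x - V h (V t f) x)"
        unfolding N_def using unitary_group_diff[OF V uL2 VL2[OF f, of t], of h] by (simp only: u_def)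
      moreover have "\<bar>l2_norm (\<lambda>x. U h u x - V h (V t f) x) - l2_norm (\<lambda>x. V h u x - V h (V t f) x)\<bar>
          \<le> l2_norm (\<lambda>x. U h u x - V h u x)"
        using l2_norm_diff_abs[OF L2_diff[OF UL2[OF uL2] VL2[OF VL2[OF f]]] L2_diff[OF VL2[OF uL2] VL2[OF VL2[OF f]]], of h h t h h t]
        by simp
      moreover have "l2_norm (\<lambda>x. U h u x - V h u x) = \<bar>h\<bar> * l2_norm (\<lambda>x. ?qU h x - ?qV h x)"
      proof -
        have "U h u x - V h u x = of_real h * (?qU h x - ?qV h x)" for x
          using h by (simp add: field_simps)
        then show ?thesis
          by (simp only: l2_norm_cmult norm_of_real)
      qed
      moreover have "l2_norm (\<lambda>x. ?qU h x - ?qV h x) \<le> l2_norm (?qU h) + l2_norm (?qV h)"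
        using l2_norm_triangle[OF qL2(1)[of h] L2_cmult[OF qL2(2)[of h], of "-1"]] l2_norm_cmult[of "-1" "?qV h"]
        by simp
      ultimately have "\<bar>N (t + h) - N t\<bar> \<le> \<bar>h\<bar> * (l2_norm (?qU h) + l2_norm (?qV h))"
        by (metis (no_types, lifting) abs_ge_zero mult_left_mono order_trans)
      then show ?thesis
        using h by (simp add: abs_divide pos_divide_le_eq mult.commute)
    qed
    have "\<forall>\<^sub>F h in at 0. norm ((N (t + h) - N t) / h) \<le> l2_norm (?qU h) + l2_norm (?qV h)"
      unfolding eventually_at_filter by (rule always_eventually) (use bound in blast)
    from Lim_null_comparison[OF this lim[unfolded add_0]] show ?thesis
      unfolding DERIV_def by simp
  qed
  have "N t = N 0"
    by (rule DERIV_isconst_all) (use deriv in blast)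
  also have "N 0 = 0"
  proof -
    have "AE x in lborel. U 0 f x = f x" "AE x in lborel. V 0 f x = f x"
      by (rule unitary_group_D(3)[OF U f], rule unitary_group_D(3)[OF V f])
    then have "AE x in lborel. U 0 f x = V 0 f x"
      by eventually_elim simp
    then show ?thesis
      unfolding N_def by (simp add: l2_dist_eq_0_iff UL2[OF f] VL2[OF f])
  qed
  finally show ?thesis
    unfolding N_def by (simp add: l2_dist_eq_0_iff UL2[OF f] VL2[OF f])
qed

text \<open>
  Existence of one generated group makes the choice in the definition of \<open>exp_i\<close> a generated
  group, and uniqueness on the domain determines its value.
\<close>

lemma exp_i_eq:
  assumes gen: "generates H V" and f: "f \<in> L2" and g: "g \<in> L2" and H: "H f g"
  shows "exp_i t H f \<in> L2" and "AE x in lborel. exp_i t H f x = V t f x"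
proof -
  have "generates H (SOME U. generates H U)"
    by (rule someI[where P = "generates H", OF gen])
  then obtain U where U: "generates H U" and eq: "exp_i t H = U t"
    by (simp add: exp_i_def)
  show "exp_i t H f \<in> L2"
    unfolding eq using U by (intro unitary_group_D(1)[OF _ f]) (simp add: generates_def)
  show "AE x in lborel. exp_i t H f x = V t f x"
    unfolding eq by (rule generates_unique[where H = H, OF U gen f g H])
qed

section \<open>Position distributions of wave packets\<close>

text \<open>
  The distribution of the observable \<open>X\<close> in the state \<open>u\<close>, that is, when the position has
  probability density \<open>|u|\<^sup>2\<close>.
\<close>

definition position_distr :: "('a::euclidean_space \<Rightarrow> complex) \<Rightarrow> ('a \<Rightarrow> real) \<Rightarrow> real measure" where
  "position_distr u X = distr (density lborel (\<lambda>x. ennreal ((cmod (u x))\<^sup>2))) borel X"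

lemma position_distr_integral:
  fixes \<phi> :: "real \<Rightarrow> 'b::{banach, second_countable_topology}"
  assumes u: "u \<in> borel_measurable borel" and X: "X \<in> borel_measurable borel" and \<phi>: "\<phi> \<in> borel_measurable borel"
  shows "(LINT y|position_distr u X. \<phi> y) = (LINT x|lborel. (cmod (u x))\<^sup>2 *\<^sub>R \<phi> (X x))"
proof -
  have "(LINT y|position_distr u X. \<phi> y) = (LINT x|density lborel (\<lambda>x. ennreal ((cmod (u x))\<^sup>2)). \<phi> (X x))"
    unfolding position_distr_def using X \<phi> by (intro integral_distr) simp_all
  also have "\<dots> = (LINT x|lborel. (cmod (u x))\<^sup>2 *\<^sub>R \<phi> (X x))"
    using u X \<phi> by (intro integral_density) auto
  finally show ?thesis .
qed

lemma real_distribution_position_distr: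
  assumes u: "u \<in> L2" "l2_norm u = 1" and X: "X \<in> borel_measurable borel"
  shows "real_distribution (position_distr u X)"
proof -
  have "prob_space (density lborel (\<lambda>x. ennreal ((cmod (u x))\<^sup>2)))"
    using L2_measurable[OF u(1)] nn_integral_L2[OF u(1)] u(2)
    by (intro prob_spaceI) (simp add: emeasure_density)
  then show ?thesis
    unfolding position_distr_def using X by (intro prob_space.real_distribution_distr) simp_all
qed

lemma measure_position_distr:
  assumes u: "u \<in> borel_measurable borel" and X: "X \<in> borel_measurable borel" and A: "A \<in> sets borel"
  shows "measure (position_distr u X) A = (LINT x:{x. X x \<in> A}|lborel. (cmod (u x))\<^sup>2)"
proof -
  have "measure (position_distr u X) A = (LINT y|position_distr u X. indicat_real A y)"
    by (simp add: position_distr_def)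
  also have "\<dots> = (LINT x|lborel. (cmod (u x))\<^sup>2 *\<^sub>R indicat_real A (X x))"
    using A by (intro position_distr_integral u X) simp
  also have "\<dots> = (LINT x:{x. X x \<in> A}|lborel. (cmod (u x))\<^sup>2)"
    unfolding set_lebesgue_integral_def by (intro Bochner_Integration.integral_cong) (auto simp: indicator_def)
  finally show ?thesis .
qed

text \<open>
  The factor \<open>iexp\<close> modulates one of the two copies of \<open>u\<close>, hence translates one of the two
  copies of its transform in Parseval's identity.
\<close>

lemma char_position_distr:
  fixes e :: "'a::euclidean_space"
  assumes u: "fourier_L2 u v"
  shows "char (position_distr u (\<lambda>x. (x \<bullet> e) / \<tau>)) \<eta>
    = (LINT \<xi>|lborel. v (\<xi> - (\<eta> / \<tau>) *\<^sub>R e) * cnj (v \<xi>))"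
proof -
  let ?h = "(\<eta> / \<tau>) *\<^sub>R e"
  note [measurable] = L2_measurable[OF fourier_L2_D(1)[OF u]]
  have "char (position_distr u (\<lambda>x. (x \<bullet> e) / \<tau>)) \<eta>
      = (LINT x|lborel. (cmod (u x))\<^sup>2 *\<^sub>R iexp (\<eta> * ((x \<bullet> e) / \<tau>)))"
    unfolding char_def by (rule position_distr_integral) measurable
  also have "\<dots> = (LINT x|lborel. (cis (?h \<bullet> x) * u x) * cnj (u x))"
  proof (intro Bochner_Integration.integral_cong refl)
    fix x
    have 1: "(cmod (u x))\<^sup>2 *\<^sub>R iexp (\<eta> * ((x \<bullet> e) / \<tau>)) = (u x * cnj (u x)) * cis (\<eta> * ((x \<bullet> e) / \<tau>))"
      unfolding complex_norm_square[symmetric] by (simp add: scaleR_conv_of_real cis_conv_exp)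
    have 2: "\<eta> * ((x \<bullet> e) / \<tau>) = ?h \<bullet> x"
      by (simp add: inner_commute)
    show "(cmod (u x))\<^sup>2 *\<^sub>R iexp (\<eta> * ((x \<bullet> e) / \<tau>)) = (cis (?h \<bullet> x) * u x) * cnj (u x)"
      by (subst 1, subst 2) (simp only: mult_ac)
  qed
  also have "\<dots> = (LINT \<xi>|lborel. v (\<xi> - ?h) * cnj (v \<xi>))"
    by (rule fourier_L2_Parseval[OF fourier_L2_modulation[OF u] u])
  finally show ?thesis .
qed

text \<open>
  The \<open>L\<^sup>2\<close>-normalised indicator of \<open>\<kappa> B\<close> with phase \<open>p\<close>.
\<close>

definition packet :: "'a::euclidean_space set \<Rightarrow> real \<Rightarrow> ('a \<Rightarrow> real) \<Rightarrow> 'a \<Rightarrow> complex" where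
  "packet B \<kappa> p \<xi> = complex_of_real (indicat_real B (\<xi> /\<^sub>R \<kappa>) / sqrt (measure lborel B * \<kappa> ^ DIM('a))) * cis (p \<xi>)"

lemma packet_measurable:
  fixes B :: "'a::euclidean_space set"
  assumes B: "open B" and p [measurable]: "p \<in> borel_measurable borel"
  shows "packet B \<kappa> p \<in> borel_measurable borel"
proof -
  have [measurable]: "B \<in> sets borel"
    using B by simp
  show ?thesis
    unfolding packet_def by measurable
qed

lemma open_bounded_measure_pos:
  fixes B :: "'a::euclidean_space set"
  assumes "open B" "bounded B" "B \<noteq> {}"
  shows "measure lborel B > 0"
proof -
  have "B \<in> lmeasurable"
    using assms by (intro bounded_set_imp_lmeasurable) (auto intro: sets_completionI_sets)
  then have "measure lebesgue B > 0"
    using assms open_not_negligible[of B] negligible_iff_measure0[of B] measure_nonneg[of lebesgue B]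
    by (simp add: less_le)
  then show ?thesis
    using assms(1) by (simp add: measure_completion)
qed

lemma integrable_indicator_bounded:
  fixes B :: "'a::euclidean_space set"
  assumes "open B" "bounded B"
  shows "integrable lborel (indicat_real B)"
  using assms by (intro integrable_real_indicator emeasure_bounded_finite) auto

text \<open>
  The substitution \<open>\<xi> = \<kappa> \<zeta>\<close> moves all dependence on \<open>\<kappa>\<close> into the size of the translation
  and into the phase difference.
\<close>

lemma packet_correlation:
  fixes B :: "'a::euclidean_space set"
  assumes B: "open B" and \<kappa>: "\<kappa> > 0" and p [measurable]: "p \<in> borel_measurable borel"
  shows "(LINT \<xi>|lborel. packet B \<kappa> p (\<xi> - h) * cnj (packet B \<kappa> p \<xi>))
    = (LINT \<zeta>|lborel. complex_of_real (indicat_real B (\<zeta> - h /\<^sub>R \<kappa>) * indicat_real B \<zeta> / measure lborel B)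
        * cis (p (\<kappa> *\<^sub>R \<zeta> - h) - p (\<kappa> *\<^sub>R \<zeta>)))"
proof -
  have [measurable]: "B \<in> sets borel"
    using B by simp
  let ?m = "measure lborel B" and ?n = "DIM('a)"
  let ?F = "\<lambda>\<xi>. packet B \<kappa> p (\<xi> - h) * cnj (packet B \<kappa> p \<xi>)"
  note [measurable] = packet_measurable[OF B p]
  have "?F \<in> borel_measurable borel"
    by measurable
  then have "(LINT \<xi>|lborel. ?F \<xi>) = \<kappa> ^ ?n *\<^sub>R (LINT \<zeta>|lborel. ?F (\<kappa> *\<^sub>R \<zeta>))"
    using lborel_integral_affine[of ?F \<kappa> 0] \<kappa> by simp
  also have "\<dots> = (LINT \<zeta>|lborel. \<kappa> ^ ?n *\<^sub>R ?F (\<kappa> *\<^sub>R \<zeta>))"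
    by simp
  also have "\<dots> = (LINT \<zeta>|lborel. complex_of_real (indicat_real B (\<zeta> - h /\<^sub>R \<kappa>) * indicat_real B \<zeta> / measure lborel B)
        * cis (p (\<kappa> *\<^sub>R \<zeta> - h) - p (\<kappa> *\<^sub>R \<zeta>)))"
  proof (intro Bochner_Integration.integral_cong refl)
    fix \<zeta>
    let ?a = "indicat_real B (\<zeta> - h /\<^sub>R \<kappa>)" and ?b = "indicat_real B \<zeta>" and ?r = "sqrt (?m * \<kappa> ^ ?n)"
    have 1: "(\<kappa> *\<^sub>R \<zeta> - h) /\<^sub>R \<kappa> = \<zeta> - h /\<^sub>R \<kappa>" "(\<kappa> *\<^sub>R \<zeta>) /\<^sub>R \<kappa> = \<zeta>"
      using \<kappa> by (simp_all add: algebra_simps)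
    have 2: "\<kappa> ^ ?n * ((?a / ?r) * (?b / ?r)) = ?a * ?b / ?m"
    proof -
      have "?r * ?r = ?m * \<kappa> ^ ?n"
        using \<kappa> by simp
      then have "(?a / ?r) * (?b / ?r) = ?a * ?b / (?m * \<kappa> ^ ?n)"
        by (simp only: times_divide_times_eq)
      then show ?thesis
        using \<kappa> by simp
    qed
    have 3: "cis (p (\<kappa> *\<^sub>R \<zeta> - h)) * cnj (cis (p (\<kappa> *\<^sub>R \<zeta>))) = cis (p (\<kappa> *\<^sub>R \<zeta> - h) - p (\<kappa> *\<^sub>R \<zeta>))"
      by (simp add: cis_cnj cis_mult)
    have "\<kappa> ^ ?n *\<^sub>R ?F (\<kappa> *\<^sub>R \<zeta>)
        = complex_of_real (\<kappa> ^ ?n * ((?a / ?r) * (?b / ?r))) * (cis (p (\<kappa> *\<^sub>R \<zeta> - h)) * cnj (cis (p (\<kappa> *\<^sub>R \<zeta>))))"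
      unfolding packet_def 1
      by (simp only: scaleR_conv_of_real of_real_mult complex_cnj_mult complex_cnj_complex_of_real mult_ac)
    then show "\<kappa> ^ ?n *\<^sub>R ?F (\<kappa> *\<^sub>R \<zeta>) = complex_of_real (?a * ?b / ?m) * cis (p (\<kappa> *\<^sub>R \<zeta> - h) - p (\<kappa> *\<^sub>R \<zeta>))"
      unfolding 2 3 .
  qed
  finally show ?thesis .
qed

lemma packet_L2:
  fixes B :: "'a::euclidean_space set"
  assumes B: "open B" "bounded B" "B \<noteq> {}" and \<kappa>: "\<kappa> > 0" and p [measurable]: "p \<in> borel_measurable borel"
  shows "packet B \<kappa> p \<in> L2" and "l2_norm (packet B \<kappa> p) = 1"
proof -
  note m = open_bounded_measure_pos[OF B]
  have [measurable]: "B \<in> sets borel"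
    using B by simp
  have sq: "(\<lambda>\<xi>. (cmod (packet B \<kappa> p \<xi>))\<^sup>2) = (\<lambda>\<xi>. indicat_real B (\<xi> /\<^sub>R \<kappa>) / (measure lborel B * \<kappa> ^ DIM('a)))"
    using m \<kappa> by (auto simp: packet_def norm_mult norm_divide power_divide indicator_def)
  have "integrable lborel (\<lambda>\<xi>. (cmod (packet B \<kappa> p \<xi>))\<^sup>2)"
    unfolding sq using lborel_integrable_affine[OF integrable_indicator_bounded[OF B(1,2)], of "inverse \<kappa>" 0] \<kappa> by simp
  then show L2: "packet B \<kappa> p \<in> L2"
    using packet_measurable[OF B(1) p] by (intro L2I)
  have "complex_of_real ((l2_norm (packet B \<kappa> p))\<^sup>2) = (LINT \<xi>|lborel. packet B \<kappa> p (\<xi> - 0) * cnj (packet B \<kappa> p \<xi>))"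
    by (simp only: integral_mult_cnj_self[OF L2] diff_zero)
  also have "\<dots> = (LINT \<zeta>|lborel. complex_of_real (indicat_real B \<zeta> / measure lborel B))"
    unfolding packet_correlation[OF B(1) \<kappa> p]
    by (intro Bochner_Integration.integral_cong) (auto simp: indicator_def)
  also have "\<dots> = complex_of_real (LINT \<zeta>|lborel. indicat_real B \<zeta> / measure lborel B)"
    by (rule integral_of_real) (use integrable_indicator_bounded[OF B(1,2)] in simp)
  also have "(LINT \<zeta>|lborel. indicat_real B \<zeta> / measure lborel B) = 1"
    using m by simp
  finally have "(l2_norm (packet B \<kappa> p))\<^sup>2 = 1"
    by (simp only: of_real_eq_iff)
  then show "l2_norm (packet B \<kappa> p) = 1"
    using power2_eq_iff_nonneg[OF l2_norm_nonneg[of "packet B \<kappa> p"] zero_le_one] by (simp only: power_one simp_thms)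
qed

text \<open>
  The translation \<open>\<eta> e / (\<tau> \<kappa>)\<close> of \<open>B\<close> tends to \<open>0\<close>, so on the open set \<open>B\<close> the two
  indicators in the correlation are eventually both \<open>1\<close>. The characteristic functions thus converge
  to that of \<open>Y\<close> under the uniform distribution on \<open>B\<close>. By Levy's continuity theorem the
  distributions converge weakly, and the mass of \<open>A\<close> tends to its mass in the limit, where
  \<open>A\<close>, and with it its frontier, is null.
\<close>

lemma packet_position_limit:
  fixes B :: "'a::euclidean_space set" and e :: 'a
  assumes B: "open B" "bounded B" "B \<noteq> {}"
    and \<kappa>: "\<And>n::nat. \<kappa> n > 0" and \<tau>: "filterlim (\<lambda>n. \<tau> n * \<kappa> n) at_top sequentially"
    and p: "\<And>n. p n \<in> borel_measurable borel" and Y [measurable]: "Y \<in> borel_measurable borel"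
    and u: "\<And>n. fourier_L2 (u n) (packet B (\<kappa> n) (p n))"
    and phase: "\<And>\<eta> \<zeta>. \<zeta> \<in> B \<Longrightarrow>
      (\<lambda>n. p n (\<kappa> n *\<^sub>R \<zeta> - (\<eta> / \<tau> n) *\<^sub>R e) - p n (\<kappa> n *\<^sub>R \<zeta>)) \<longlonglongrightarrow> \<eta> * Y \<zeta>"
    and A: "closed A" "\<And>\<zeta>. \<zeta> \<in> B \<Longrightarrow> Y \<zeta> \<notin> A"
  shows "(\<lambda>n. LINT x:{x. (x \<bullet> e) / \<tau> n \<in> A}|lborel. (cmod (u n x))\<^sup>2) \<longlonglongrightarrow> 0"
proof -
  define m where "m = measure lborel B"
  have m: "m > 0"
    unfolding m_def by (rule open_bounded_measure_pos[OF B])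
  have [measurable]: "B \<in> sets borel"
    using B by simp
  note intB = integrable_indicator_bounded[OF B(1,2)]
  \<comment> \<open>The limit distribution is itself the distribution of an observable, in the state \<open>v\<close>.\<close>
  define v where "v = packet B 1 (\<lambda>_::'a. 0)"
  have v: "v \<in> L2" "l2_norm v = 1" and v_sq: "(cmod (v \<zeta>))\<^sup>2 = indicat_real B \<zeta> / m" for \<zeta>
    unfolding v_def using packet_L2[OF B, of 1 "\<lambda>_. 0"] m
    by (auto simp: packet_def norm_mult norm_divide power_divide indicator_def m_def)
  define M where "M = (\<lambda>n. position_distr (u n) (\<lambda>x. (x \<bullet> e) / \<tau> n))"
  define M' where "M' = position_distr v Y"
  have u_L2: "u n \<in> L2" "l2_norm (u n) = 1" for n
    using fourier_L2_D(1)[OF u] fourier_L2_norm[OF u] packet_L2(2)[OF B \<kappa> p] by auto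
  have M: "real_distribution (M n)" for n
    unfolding M_def by (rule real_distribution_position_distr[OF u_L2]) measurable
  have M': "real_distribution M'"
    unfolding M'_def by (rule real_distribution_position_distr[OF v Y])
  have "(\<lambda>n. char (M n) \<eta>) \<longlonglongrightarrow> char M' \<eta>" for \<eta>
  proof -
    let ?h = "\<lambda>n. (\<eta> / \<tau> n) *\<^sub>R e"
    let ?f = "\<lambda>n \<zeta>. complex_of_real (indicat_real B (\<zeta> - ?h n /\<^sub>R \<kappa> n) * indicat_real B \<zeta> / m)
        * cis (p n (\<kappa> n *\<^sub>R \<zeta> - ?h n) - p n (\<kappa> n *\<^sub>R \<zeta>))"
    let ?g = "\<lambda>\<zeta>. complex_of_real (indicat_real B \<zeta> / m) * cis (\<eta> * Y \<zeta>)"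
    have "(\<lambda>n. \<eta> / (\<tau> n * \<kappa> n)) \<longlonglongrightarrow> 0"
      by (rule tendsto_divide_0[OF tendsto_const filterlim_at_top_imp_at_infinity[OF \<tau>]])
    then have h0: "(\<lambda>n. ?h n /\<^sub>R \<kappa> n) \<longlonglongrightarrow> 0"
      using tendsto_scaleR[OF _ tendsto_const[of e], of "\<lambda>n. \<eta> / (\<tau> n * \<kappa> n)" 0] by (simp add: field_simps)
    have "(\<lambda>n. LINT \<zeta>|lborel. ?f n \<zeta>) \<longlonglongrightarrow> (LINT \<zeta>|lborel. ?g \<zeta>)"
    proof (rule integral_dominated_convergence)
      show "integrable lborel (\<lambda>\<zeta>. indicat_real B \<zeta> / m)"
        using intB by simp
      show "AE \<zeta> in lborel. (\<lambda>n. ?f n \<zeta>) \<longlonglongrightarrow> ?g \<zeta>"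
      proof (rule AE_I2)
        fix \<zeta>
        show "(\<lambda>n. ?f n \<zeta>) \<longlonglongrightarrow> ?g \<zeta>"
        proof (cases "\<zeta> \<in> B")
          case True
          have "(\<lambda>n. \<zeta> - ?h n /\<^sub>R \<kappa> n) \<longlonglongrightarrow> \<zeta> - 0"
            by (intro tendsto_intros h0)
          then have "\<forall>\<^sub>F n in sequentially. \<zeta> - ?h n /\<^sub>R \<kappa> n \<in> B"
            using B(1) True by (intro topological_tendstoD) auto
          then have "(\<lambda>n. indicat_real B (\<zeta> - ?h n /\<^sub>R \<kappa> n)) \<longlonglongrightarrow> 1"
            by (intro tendsto_eventually) (auto elim!: eventually_mono)
          then have "(\<lambda>n. ?f n \<zeta>) \<longlonglongrightarrow> complex_of_real (1 * indicat_real B \<zeta> / m) * cis (\<eta> * Y \<zeta>)"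
            unfolding cis_conv_exp using m by (intro tendsto_intros phase[OF True]) auto
          then show ?thesis
            by simp
        qed simp
      qed
      show "AE \<zeta> in lborel. norm (?f n \<zeta>) \<le> indicat_real B \<zeta> / m" for n
        using m by (intro AE_I2) (auto simp: norm_mult norm_divide indicator_def)
    qed (use p in measurable)
    moreover have "char (M n) \<eta> = (LINT \<zeta>|lborel. ?f n \<zeta>)" for n
      unfolding M_def char_position_distr[OF u] packet_correlation[OF B(1) \<kappa> p] m_def ..
    moreover have "char M' \<eta> = (LINT \<zeta>|lborel. ?g \<zeta>)"
    proof -
      have "char M' \<eta> = (LINT \<zeta>|lborel. (cmod (v \<zeta>))\<^sup>2 *\<^sub>R iexp (\<eta> * Y \<zeta>))"
        unfolding char_def M'_def by (rule position_distr_integral[OF L2_measurable[OF v(1)] Y]) measurable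
      then show ?thesis
        unfolding v_sq by (simp add: scaleR_conv_of_real cis_conv_exp)
    qed
    ultimately show ?thesis
      by simp
  qed
  then have "weak_conv_m M M'"
    by (rule levy_continuity[OF M M'])
  have A_borel: "A \<in> sets borel"
    using A(1) by simp
  have null: "measure M' A = 0"
  proof -
    have "measure M' A = (LINT \<zeta>:{\<zeta>. Y \<zeta> \<in> A}|lborel. indicat_real B \<zeta> / m)"
      unfolding M'_def measure_position_distr[OF L2_measurable[OF v(1)] Y A_borel] v_sq ..
    also have "\<dots> = (LINT \<zeta>|(lborel::'a measure). 0)"
      unfolding set_lebesgue_integral_def using A(2)
      by (intro Bochner_Integration.integral_cong) (auto simp: indicator_def)
    finally show ?thesis
      by simp
  qed
  interpret M': real_distribution M'
    by (rule M')
  have "measure M' (frontier A) \<le> measure M' A"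
    using A(1) A_borel by (intro M'.finite_measure_mono frontier_subset_closed) simp_all
  then have "measure M' (frontier A) = 0"
    using null measure_nonneg[of M' "frontier A"] by simp
  then have "emeasure M' (frontier A) = 0"
    by (simp add: M'.emeasure_eq_measure)
  then have "(\<lambda>n. measure (M n) A) \<longlonglongrightarrow> measure M' A"
    using weak_conv_imp_continuity_set_conv[OF M M' \<open>weak_conv_m M M'\<close> A_borel] by simp
  then show ?thesis
    unfolding null M_def using measure_position_distr[OF L2_measurable[OF u_L2(1)] _ A_borel] by simp
qed

section \<open>Concentration and escape\<close>

lemma powr_norm_eq: "norm (x::'a::real_normed_vector) powr s = ((norm x)\<^sup>2) powr (s / 2)"
  by (cases "x = 0") (simp_all add: powr_powr flip: powr_numeral)

text \<open>
  Written through the squared norm, which is a quadratic polynomial in \<open>h\<close> and positive at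
  \<open>h = 0\<close>.
\<close>

lemma norm_powr_directional_derivative:
  fixes \<zeta> d :: "'a::real_inner"
  assumes \<zeta>: "\<zeta> \<noteq> 0"
  shows "((\<lambda>h. norm (\<zeta> - h *\<^sub>R d) powr s) has_real_derivative
    - (s * ((norm \<zeta>)\<^sup>2) powr (s / 2 - 1) * (\<zeta> \<bullet> d))) (at 0)"
proof -
  let ?q = "\<lambda>h. (norm \<zeta>)\<^sup>2 - 2 * h * (\<zeta> \<bullet> d) + h\<^sup>2 * (norm d)\<^sup>2"
  have eq: "norm (\<zeta> - h *\<^sub>R d) powr s = ?q h powr (s / 2)" for h
    unfolding powr_norm_eq[of "\<zeta> - h *\<^sub>R d"] power2_norm_eq_inner
    by (simp add: inner_diff_left inner_diff_right inner_commute algebra_simps power2_eq_square)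
  have "(?q has_real_derivative - 2 * (\<zeta> \<bullet> d)) (at 0)"
    by (auto intro!: derivative_eq_intros)
  moreover have "((\<lambda>z. z powr (s / 2)) has_real_derivative s / 2 * ?q 0 powr (s / 2 - 1)) (at (?q 0))"
    using \<zeta> by (intro has_real_derivative_powr) simp
  ultimately have "((\<lambda>h. ?q h powr (s / 2)) has_real_derivative s / 2 * ?q 0 powr (s / 2 - 1) * (- 2 * (\<zeta> \<bullet> d))) (at 0)"
    by (rule DERIV_chain2[rotated])
  then show ?thesis
    unfolding eq by (simp add: mult.assoc)
qed

text \<open>
  By homogeneity the phase difference is a difference quotient of \<open>|\<zeta>|\<^sup>s\<close> with increment
  \<open>1 / (t \<kappa>\<^sup>s)\<close> in the direction \<open>- \<eta> e\<close>.
\<close>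

lemma scaled_phase_limit:
  fixes \<zeta> e :: "'a::real_inner"
  assumes \<zeta>: "\<zeta> \<noteq> 0" and t: "t > 0" and \<kappa>: "\<And>n. \<kappa> n > 0"
    and lim: "filterlim (\<lambda>n. t * \<kappa> n powr s) at_top sequentially"
  shows "(\<lambda>n. t * norm (\<kappa> n *\<^sub>R \<zeta> - (\<eta> / (t * \<kappa> n powr (s - 1))) *\<^sub>R e) powr s - t * norm (\<kappa> n *\<^sub>R \<zeta>) powr s)
    \<longlonglongrightarrow> \<eta> * - (s * ((norm \<zeta>)\<^sup>2) powr (s / 2 - 1) * (\<zeta> \<bullet> e))"
proof -
  let ?d = "\<eta> *\<^sub>R e"
  let ?\<epsilon> = "\<lambda>n. inverse (t * \<kappa> n powr s)"
  have "filterlim ?\<epsilon> (at 0) sequentially"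
    using filterlim_compose[OF filterlim_inverse_at_right_top lim] by (rule filterlim_mono) (simp_all add: at_within_le_at)
  moreover have "((\<lambda>h. (norm (\<zeta> - h *\<^sub>R ?d) powr s - norm \<zeta> powr s) / h)
      \<longlongrightarrow> - (s * ((norm \<zeta>)\<^sup>2) powr (s / 2 - 1) * (\<zeta> \<bullet> ?d))) (at 0)"
    using norm_powr_directional_derivative[OF \<zeta>, of ?d s] by (simp add: DERIV_def)
  ultimately have "(\<lambda>n. (norm (\<zeta> - ?\<epsilon> n *\<^sub>R ?d) powr s - norm \<zeta> powr s) / ?\<epsilon> n)
      \<longlonglongrightarrow> - (s * ((norm \<zeta>)\<^sup>2) powr (s / 2 - 1) * (\<zeta> \<bullet> ?d))"
    by (rule filterlim_compose[rotated])
  moreover have "(norm (\<zeta> - ?\<epsilon> n *\<^sub>R ?d) powr s - norm \<zeta> powr s) / ?\<epsilon> n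
      = t * norm (\<kappa> n *\<^sub>R \<zeta> - (\<eta> / (t * \<kappa> n powr (s - 1))) *\<^sub>R e) powr s - t * norm (\<kappa> n *\<^sub>R \<zeta>) powr s" for n
  proof -
    have k: "\<kappa> n powr s = \<kappa> n * \<kappa> n powr (s - 1)"
      using \<kappa>[of n] powr_add[of "\<kappa> n" 1 "s - 1"] by simp
    have "\<kappa> n *\<^sub>R (\<zeta> - ?\<epsilon> n *\<^sub>R ?d) = \<kappa> n *\<^sub>R \<zeta> - (\<eta> / (t * \<kappa> n powr (s - 1))) *\<^sub>R e"
      using \<kappa>[of n] unfolding k by (simp add: scaleR_diff_right field_simps)
    then have "norm (\<kappa> n *\<^sub>R \<zeta> - (\<eta> / (t * \<kappa> n powr (s - 1))) *\<^sub>R e) = \<kappa> n * norm (\<zeta> - ?\<epsilon> n *\<^sub>R ?d)"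
      using \<kappa>[of n] by (metis abs_of_pos norm_scaleR)
    then show ?thesis
      using \<kappa>[of n] t by (simp add: powr_mult field_simps)
  qed
  moreover have "- (s * ((norm \<zeta>)\<^sup>2) powr (s / 2 - 1) * (\<zeta> \<bullet> ?d))
      = \<eta> * - (s * ((norm \<zeta>)\<^sup>2) powr (s / 2 - 1) * (\<zeta> \<bullet> e))"
    by (simp add: mult_ac)
  ultimately show ?thesis
    by (simp only:)
qed

text \<open>
  On this ball \<open>\<zeta> \<bullet> e > 1\<close> and \<open>1 < |\<zeta>| \<le> 3\<close>. The hypothesis \<open>s \<ge> 1\<close> enters through
  \<open>|\<zeta>|\<^bsup>s-2\<^esup> \<ge> 1 / |\<zeta>|\<close>.
\<close>

lemma group_velocity_bound:
  fixes e :: "'a::real_inner"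
  assumes e: "norm e = 1" and s: "s \<ge> 1" and \<zeta>: "\<zeta> \<in> ball (2 *\<^sub>R e) 1"
  shows "\<zeta> \<noteq> 0" and "1 / 3 \<le> s * ((norm \<zeta>)\<^sup>2) powr (s / 2 - 1) * (\<zeta> \<bullet> e)"
proof -
  have d: "norm (\<zeta> - 2 *\<^sub>R e) < 1"
    using \<zeta> by (simp add: dist_norm norm_minus_commute)
  have "\<bar>(\<zeta> - 2 *\<^sub>R e) \<bullet> e\<bar> < 1"
    using Cauchy_Schwarz_ineq2[of "\<zeta> - 2 *\<^sub>R e" e] d e by simp
  moreover have "e \<bullet> e = 1"
    using e by (simp add: norm_eq_1)
  ultimately have dot: "\<zeta> \<bullet> e > 1"
    by (simp add: inner_diff_left)
  have lower: "norm \<zeta> > 1"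
    using Cauchy_Schwarz_ineq2[of \<zeta> e] dot e by simp
  have upper: "norm \<zeta> \<le> 3"
    using norm_triangle_ineq[of "\<zeta> - 2 *\<^sub>R e" "2 *\<^sub>R e"] d e by simp
  show "\<zeta> \<noteq> 0"
    using lower by auto
  have "1 / 3 \<le> 1 / norm \<zeta>"
    using lower upper by (intro divide_left_mono) auto
  also have "\<dots> = ((norm \<zeta>)\<^sup>2) powr (- 1 / 2)"
    using powr_norm_eq[of \<zeta> "- 1"] lower by (simp add: powr_minus_divide)
  also have "\<dots> \<le> ((norm \<zeta>)\<^sup>2) powr (s / 2 - 1)"
    using s lower by (intro powr_mono) (auto simp: one_le_power)
  finally have "1 / 3 \<le> ((norm \<zeta>)\<^sup>2) powr (s / 2 - 1)" .
  moreover have "1 \<le> s * (\<zeta> \<bullet> e)"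
    using mult_mono[of 1 s 1 "\<zeta> \<bullet> e"] s dot by simp
  ultimately show "1 / 3 \<le> s * ((norm \<zeta>)\<^sup>2) powr (s / 2 - 1) * (\<zeta> \<bullet> e)"
    using mult_mono[of "1 / 3" "((norm \<zeta>)\<^sup>2) powr (s / 2 - 1)" 1 "s * (\<zeta> \<bullet> e)"] by (simp add: mult_ac)
qed

lemma L2_set_integral_mono:
  fixes u :: "'a::euclidean_space \<Rightarrow> complex"
  assumes u: "u \<in> L2" and S: "S \<in> sets borel" and T: "T \<in> sets borel" and sub: "S \<subseteq> T"
  shows "(LINT x:S|lborel. (cmod (u x))\<^sup>2) \<le> (LINT x:T|lborel. (cmod (u x))\<^sup>2)"
proof -
  have "set_integrable lborel X (\<lambda>x. (cmod (u x))\<^sup>2)" if "X \<in> sets borel" for X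
    unfolding set_integrable_def using that L2_integrable[OF u] by (intro integrable_mult_indicator) auto
  then show ?thesis
    using S T sub unfolding set_lebesgue_integral_def set_integrable_def
    by (intro integral_mono) (auto simp: indicator_def)
qed

lemma L2_set_integral_sum_bound:
  fixes u :: "'a::euclidean_space \<Rightarrow> complex"
  assumes u: "u \<in> L2" and S: "S \<in> sets borel" and T: "\<And>b. b \<in> I \<Longrightarrow> T b \<in> sets borel"
    and I: "finite I" and sub: "S \<subseteq> (\<Union>b\<in>I. T b)"
  shows "(LINT x:S|lborel. (cmod (u x))\<^sup>2) \<le> (\<Sum>b\<in>I. LINT x:T b|lborel. (cmod (u x))\<^sup>2)"
proof -
  have int: "integrable lborel (\<lambda>x. indicat_real X x *\<^sub>R (cmod (u x))\<^sup>2)" if "X \<in> sets borel" for X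
    using that L2_integrable[OF u] by (intro integrable_mult_indicator) auto
  have "(LINT x:S|lborel. (cmod (u x))\<^sup>2) \<le> (LINT x|lborel. (\<Sum>b\<in>I. indicat_real (T b) x *\<^sub>R (cmod (u x))\<^sup>2))"
    unfolding set_lebesgue_integral_def
  proof (rule integral_mono[OF int[OF S] Bochner_Integration.integrable_sum[OF int[OF T]]])
    fix x
    show "indicat_real S x *\<^sub>R (cmod (u x))\<^sup>2 \<le> (\<Sum>b\<in>I. indicat_real (T b) x *\<^sub>R (cmod (u x))\<^sup>2)"
    proof (cases "x \<in> S")
      case True
      then obtain b where b: "b \<in> I" "x \<in> T b"
        using sub by auto
      have "indicat_real (T b) x *\<^sub>R (cmod (u x))\<^sup>2 \<le> (\<Sum>b\<in>I. indicat_real (T b) x *\<^sub>R (cmod (u x))\<^sup>2)"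
        using b(1) I by (intro member_le_sum) auto
      then show ?thesis
        using True b by simp
    qed (simp add: sum_nonneg)
  qed
  also have "\<dots> = (\<Sum>b\<in>I. LINT x:T b|lborel. (cmod (u x))\<^sup>2)"
    unfolding set_lebesgue_integral_def by (rule Bochner_Integration.integral_sum[OF int[OF T]])
  finally show ?thesis .
qed

lemma tendsto_int_at_topI:
  fixes g :: "int \<Rightarrow> 'b::topological_space"
  assumes "(\<lambda>n. g (int n)) \<longlonglongrightarrow> l"
  shows "(g \<longlongrightarrow> l) at_top"
proof -
  have "((\<lambda>k. g (int (nat k))) \<longlongrightarrow> l) at_top"
    by (rule filterlim_compose[OF assms filterlim_nat_sequentially])
  moreover have "\<forall>\<^sub>F k in at_top. g (int (nat k)) = g k"
    using eventually_ge_at_top[of "0::int"] by eventually_elim simp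
  ultimately show ?thesis
    by (rule Lim_transform_eventually)
qed

text \<open>
  The transform of \<open>f\<close> has bounded support, so \<open>f\<close> lies in the domain of the fractional
  Laplacian, where the group is known to be the Fourier multiplier.
\<close>

lemma packet_evolution:
  fixes B :: "'a::euclidean_space set"
  assumes s: "s \<ge> 0" and B: "open B" "bounded B" "B \<noteq> {}" and \<kappa>: "\<kappa> > 0"
    and f: "fourier_L2 f (packet B \<kappa> (\<lambda>_. 0))"
  obtains u where "fourier_L2 u (packet B \<kappa> (\<lambda>\<xi>. t * norm \<xi> powr s))" "exp_i t (frac_laplacian s) f \<in> L2"
    "AE x in lborel. exp_i t (frac_laplacian s) f x = u x"
proof -
  let ?P = "packet B \<kappa> (\<lambda>_. 0)" and ?w = "\<lambda>\<xi>::'a. norm \<xi> powr s"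
  have w: "?w \<in> borel_measurable borel"
    by measurable
  note fL = fourier_L2_D[OF f]
  note [measurable] = L2_measurable[OF fL(2)]
  obtain R where R: "\<And>x. x \<in> B \<Longrightarrow> norm x \<le> R"
    using B(2) by (auto simp: bounded_iff)
  have "(\<lambda>\<xi>. ?w \<xi> *\<^sub>R ?P \<xi>) \<in> L2"
  proof (rule L2_bound(1)[OF fL(2), of _ "(\<kappa> * R) powr s"])
    show "AE \<xi> in lborel. cmod (?w \<xi> *\<^sub>R ?P \<xi>) \<le> (\<kappa> * R) powr s * cmod (?P \<xi>)"
    proof (rule AE_I2)
      fix \<xi>
      show "cmod (?w \<xi> *\<^sub>R ?P \<xi>) \<le> (\<kappa> * R) powr s * cmod (?P \<xi>)"
      proof (cases "\<xi> /\<^sub>R \<kappa> \<in> B")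
        case True
        then have "norm \<xi> \<le> \<kappa> * R"
          using R[OF True] \<kappa> by (simp add: field_simps)
        then have "?w \<xi> \<le> (\<kappa> * R) powr s"
          using s by (intro powr_mono2) auto
        then show ?thesis
          by (simp add: mult_right_mono)
      qed (simp add: packet_def)
    qed
  qed simp_all
  from fourier_L2_inverse_fourier[OF this] obtain g where g: "fourier_L2 g (\<lambda>\<xi>. ?w \<xi> *\<^sub>R ?P \<xi>)"
    by blast
  have H: "frac_laplacian s f g"
    unfolding frac_laplacian_iff[OF s f g] by simp
  note E = exp_i_eq[where H = "frac_laplacian s", OF phase_group_generates[OF s] fL(1) fourier_L2_D(1)[OF g] H]
  have "(\<lambda>\<xi>. cis (t * ?w \<xi>) * ?P \<xi>) = packet B \<kappa> (\<lambda>\<xi>. t * ?w \<xi>)"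
    by (auto simp: packet_def)
  then have "fourier_L2 (phase_group ?w t f) (packet B \<kappa> (\<lambda>\<xi>. t * ?w \<xi>))"
    using fourier_L2_phase_group[OF w f, of t] by simp
  then show ?thesis
    using that E by blast
qed

text \<open>
  With zero phase and \<open>\<tau> = 1\<close> the limit distribution of every coordinate is concentrated at
  \<open>0\<close>, and a point of norm at least \<open>r\<close> has a coordinate of size at least \<open>r / DIM('a)\<close>.
\<close>

lemma packet_concentrates:
  fixes B :: "'a::euclidean_space set"
  assumes B: "open B" "bounded B" "B \<noteq> {}" and \<kappa>: "\<And>n. \<kappa> n > 0" "filterlim \<kappa> at_top sequentially"
    and f: "\<And>n. fourier_L2 (f n) (packet B (\<kappa> n) (\<lambda>_. 0))" and r: "r > 0"
  shows "(\<lambda>n. LINT x:{x. norm x \<ge> r}|lborel. (cmod (f n x))\<^sup>2) \<longlonglongrightarrow> 0"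
proof -
  let ?a = "r / real DIM('a)"
  define A where "A = {y::real. \<bar>y\<bar> \<ge> ?a}"
  have a: "?a > 0"
    using r by simp
  have A: "closed A"
    unfolding A_def by (intro closed_Collect_le continuous_intros)
  let ?T = "\<lambda>b. {x::'a. (x \<bullet> b) / 1 \<in> A}"
  have "(\<lambda>n. LINT x:?T b|lborel. (cmod (f n x))\<^sup>2) \<longlonglongrightarrow> 0" for b
    by (rule packet_position_limit[OF B \<kappa>(1), where p = "\<lambda>_ _. 0" and Y = "\<lambda>_. 0" and A = A])
      (use \<kappa>(2) f A a in \<open>auto simp: A_def\<close>)
  then have sum: "(\<lambda>n. \<Sum>b\<in>Basis. LINT x:?T b|lborel. (cmod (f n x))\<^sup>2) \<longlonglongrightarrow> (\<Sum>b\<in>(Basis::'a set). 0)"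
    by (intro tendsto_sum)
  have T: "?T b \<in> sets borel" for b
  proof -
    have "closed (?T b)"
      unfolding A_def by (simp, intro closed_Collect_le continuous_intros)
    then show ?thesis
      by simp
  qed
  have sub: "{x::'a. norm x \<ge> r} \<subseteq> (\<Union>b\<in>Basis. ?T b)"
  proof
    fix x :: 'a
    assume "x \<in> {x. norm x \<ge> r}"
    then have "r \<le> (\<Sum>b\<in>Basis. \<bar>x \<bullet> b\<bar>)"
      using norm_le_l1[of x] by simp
    then have "\<not> (\<forall>b\<in>Basis. \<bar>x \<bullet> b\<bar> < ?a)"
      using sum_strict_mono[of "Basis :: 'a set" "\<lambda>b. \<bar>x \<bullet> b\<bar>" "\<lambda>_. ?a"] by auto
    then show "x \<in> (\<Union>b\<in>Basis. ?T b)"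
      by (auto simp: A_def not_less)
  qed
  have S: "{x::'a. norm x \<ge> r} \<in> sets borel"
    by (intro borel_closed closed_Collect_le continuous_intros)
  show ?thesis
  proof (rule tendsto_sandwich[OF _ _ tendsto_const])
    show "\<forall>\<^sub>F n in sequentially. 0 \<le> (LINT x:{x. norm x \<ge> r}|lborel. (cmod (f n x))\<^sup>2)"
      by (intro always_eventually allI) (simp add: set_lebesgue_integral_def)
    show "\<forall>\<^sub>F n in sequentially. (LINT x:{x. norm x \<ge> r}|lborel. (cmod (f n x))\<^sup>2) \<le> (\<Sum>b\<in>Basis. LINT x:?T b|lborel. (cmod (f n x))\<^sup>2)"
      by (intro always_eventually allI L2_set_integral_sum_bound fourier_L2_D(1)[OF f] S T sub) simp
    show "(\<lambda>n. \<Sum>b\<in>Basis. LINT x:?T b|lborel. (cmod (f n x))\<^sup>2) \<longlonglongrightarrow> 0"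
      using sum by simp
  qed
qed

text \<open>
  Positions are measured in units of \<open>\<tau> = t \<kappa>\<^bsup>s-1\<^esup>\<close>, the distance travelled up to a bounded
  factor. In these units the limiting coordinate along \<open>e\<close> is at most \<open>- 1/3\<close>. As \<open>\<tau> \<ge> t\<close>, the ball
  of radius \<open>t/4\<close> lies in the slab where the rescaled coordinate is at most \<open>1/4\<close> in modulus.
\<close>

lemma packet_escapes:
  fixes e :: "'a::euclidean_space"
  assumes s: "s \<ge> 1" and e: "norm e = 1" and t: "t > 0" and \<kappa>: "\<And>n. \<kappa> n \<ge> 1" "filterlim \<kappa> at_top sequentially"
    and u: "\<And>n. fourier_L2 (u n) (packet (ball (2 *\<^sub>R e) 1) (\<kappa> n) (\<lambda>\<xi>. t * norm \<xi> powr s))"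
  shows "(\<lambda>n. LINT x:{x. norm x \<le> 1 / 4 * t}|lborel. (cmod (u n x))\<^sup>2) \<longlonglongrightarrow> 0"
proof -
  let ?B = "ball (2 *\<^sub>R e) 1"
  let ?\<tau> = "\<lambda>n. t * \<kappa> n powr (s - 1)"
  let ?A = "{- (1 / 4)..1 / 4 :: real}"
  let ?T = "\<lambda>n. {x::'a. (x \<bullet> e) / ?\<tau> n \<in> ?A}"
  have \<kappa>0: "\<kappa> n > 0" for n
    using \<kappa>(1)[of n] by linarith
  have \<tau>0: "?\<tau> n > 0" for n
    using t \<kappa>0[of n] by simp
  have \<kappa>s: "filterlim (\<lambda>n. t * \<kappa> n powr s) at_top sequentially"
  proof (rule filterlim_at_top_mono)
    show "filterlim (\<lambda>n. t * \<kappa> n) at_top sequentially"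
      using t \<kappa>(2) by (intro filterlim_tendsto_pos_mult_at_top[OF tendsto_const]) auto
    show "\<forall>\<^sub>F n in sequentially. t * \<kappa> n \<le> t * \<kappa> n powr s"
    proof (intro always_eventually allI mult_left_mono)
      fix n
      show "\<kappa> n \<le> \<kappa> n powr s"
        using powr_mono[OF s \<kappa>(1)[of n]] \<kappa>0[of n] by simp
    qed (use t in simp)
  qed
  have "?\<tau> n * \<kappa> n = t * \<kappa> n powr s" for n
    using \<kappa>0[of n] powr_add[of "\<kappa> n" 1 "s - 1"] by simp
  then have \<tau>\<kappa>: "filterlim (\<lambda>n. ?\<tau> n * \<kappa> n) at_top sequentially"
    using \<kappa>s by (simp only:)
  have lim: "(\<lambda>n. LINT x:?T n|lborel. (cmod (u n x))\<^sup>2) \<longlonglongrightarrow> 0"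
  proof (rule packet_position_limit[OF _ _ _ \<kappa>0 \<tau>\<kappa> _ _ u, where A = ?A
        and Y = "\<lambda>\<zeta>. - (s * ((norm \<zeta>)\<^sup>2) powr (s / 2 - 1) * (\<zeta> \<bullet> e))"])
    fix \<zeta> \<eta>
    assume \<zeta>: "\<zeta> \<in> ?B"
    show "(\<lambda>n. t * norm (\<kappa> n *\<^sub>R \<zeta> - (\<eta> / ?\<tau> n) *\<^sub>R e) powr s - t * norm (\<kappa> n *\<^sub>R \<zeta>) powr s)
        \<longlonglongrightarrow> \<eta> * - (s * ((norm \<zeta>)\<^sup>2) powr (s / 2 - 1) * (\<zeta> \<bullet> e))"
      by (rule scaled_phase_limit[OF group_velocity_bound(1)[OF e s \<zeta>] t \<kappa>0 \<kappa>s])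
    show "- (s * ((norm \<zeta>)\<^sup>2) powr (s / 2 - 1) * (\<zeta> \<bullet> e)) \<notin> ?A"
      using group_velocity_bound(2)[OF e s \<zeta>] by simp
  qed simp_all
  have S: "{x::'a. norm x \<le> 1 / 4 * t} \<in> sets borel"
    by (intro borel_closed closed_Collect_le continuous_intros)
  have T: "?T n \<in> sets borel" for n
    unfolding atLeastAtMost_iff using \<tau>0[of n]
    by (intro borel_closed closed_Collect_conj closed_Collect_le continuous_intros) auto
  have sub: "{x::'a. norm x \<le> 1 / 4 * t} \<subseteq> ?T n" for n
  proof
    fix x :: 'a
    assume "x \<in> {x. norm x \<le> 1 / 4 * t}"
    then have "\<bar>x \<bullet> e\<bar> \<le> 1 / 4 * t"
      using Cauchy_Schwarz_ineq2[of x e] e by simp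
    also have "\<dots> \<le> 1 / 4 * ?\<tau> n"
    proof -
      have "1 \<le> \<kappa> n powr (s - 1)"
        using \<kappa>(1)[of n] s by (intro ge_one_powr_ge_zero) auto
      then show ?thesis
        using t mult_left_mono[of 1 "\<kappa> n powr (s - 1)" t] by simp
    qed
    finally have "\<bar>(x \<bullet> e) / ?\<tau> n\<bar> \<le> 1 / 4"
      using \<tau>0[of n] by (simp only: abs_divide abs_of_pos pos_divide_le_eq)
    then show "x \<in> ?T n"
      unfolding mem_Collect_eq atLeastAtMost_iff by (intro conjI; linarith)
  qed
  show ?thesis
  proof (rule tendsto_sandwich[OF _ _ tendsto_const lim])
    show "\<forall>\<^sub>F n in sequentially. 0 \<le> (LINT x:{x. norm x \<le> 1 / 4 * t}|lborel. (cmod (u n x))\<^sup>2)"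
      by (intro always_eventually allI) (simp add: set_lebesgue_integral_def)
    show "\<forall>\<^sub>F n in sequentially. (LINT x:{x. norm x \<le> 1 / 4 * t}|lborel. (cmod (u n x))\<^sup>2) \<le> (LINT x:?T n|lborel. (cmod (u n x))\<^sup>2)"
      by (intro always_eventually allI L2_set_integral_mono fourier_L2_D(1)[OF u] S T sub)
  qed
qed

theorem theorem3p5:
  fixes s :: real
  assumes "s \<ge> 1"
  shows "\<exists>f :: int \<Rightarrow> (real ^ 'n) \<Rightarrow> complex.
    (\<forall>k. f k \<in> L2 \<and> (LINT x|lborel. (cmod (f k x))\<^sup>2) = 1) \<and>
    (\<exists>\<sigma>>0. \<forall>t>0. \<forall>r1>0.
       ((\<lambda>k. LINT x:{x. norm x \<ge> r1}|lborel. (cmod (f k x))\<^sup>2) \<longlongrightarrow> 0) at_top \<and>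
       ((\<lambda>k. LINT x:{x. norm x \<le> \<sigma> * t}|lborel.
            (cmod (exp_i t (frac_laplacian s) (f k) x))\<^sup>2) \<longlongrightarrow> 0) at_top)"
proof -
  obtain e :: "real ^ 'n" where e: "e \<in> Basis"
    using nonempty_Basis by blast
  then have e1: "norm e = 1"
    by simp
  define B where "B = ball (2 *\<^sub>R e) 1"
  have B: "open B" "bounded B" "B \<noteq> {}"
    by (auto simp: B_def)
  \<comment> \<open>Truncated below at \<open>1\<close>, so that the functions with index \<open>k \<le> 0\<close> are normalised as well.\<close>
  define \<kappa> :: "int \<Rightarrow> real" where "\<kappa> = (\<lambda>k. max 1 (real_of_int k))"
  have \<kappa>1: "\<kappa> k \<ge> 1" for k
    by (simp add: \<kappa>_def)
  have \<kappa>0: "\<kappa> k > 0" for k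
    using \<kappa>1[of k] by linarith
  have \<kappa>_lim: "filterlim (\<lambda>n. \<kappa> (int n)) at_top sequentially"
    by (rule filterlim_at_top_mono[OF filterlim_real_sequentially]) (simp add: \<kappa>_def)
  define f where "f = (\<lambda>k. inverse_fourier (packet B (\<kappa> k) (\<lambda>_. 0)))"
  have f: "fourier_L2 (f k) (packet B (\<kappa> k) (\<lambda>_. 0))" for k
    unfolding f_def by (rule fourier_L2_inverse_fourier[OF packet_L2(1)[OF B \<kappa>0]]) simp
  have unit: "f k \<in> L2 \<and> (LINT x|lborel. (cmod (f k x))\<^sup>2) = 1" for k
    unfolding l2_norm_square[symmetric]
    using fourier_L2_D(1)[OF f] fourier_L2_norm[OF f, of k] packet_L2(2)[OF B \<kappa>0, of "\<lambda>_. 0" k] by simp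
  have start: "((\<lambda>k. LINT x:{x. norm x \<ge> r}|lborel. (cmod (f k x))\<^sup>2) \<longlongrightarrow> 0) at_top" if "r > 0" for r
    by (rule tendsto_int_at_topI, rule packet_concentrates[OF B \<kappa>0 \<kappa>_lim f that])
  have escape: "((\<lambda>k. LINT x:{x. norm x \<le> 1 / 4 * t}|lborel.
      (cmod (exp_i t (frac_laplacian s) (f k) x))\<^sup>2) \<longlongrightarrow> 0) at_top" if t: "t > 0" for t
  proof -
    let ?E = "\<lambda>k. exp_i t (frac_laplacian s) (f k)"
    have "\<exists>u. fourier_L2 u (packet B (\<kappa> k) (\<lambda>\<xi>. t * norm \<xi> powr s)) \<and> ?E k \<in> L2 \<and> (AE x in lborel. ?E k x = u x)" for k
      by (rule packet_evolution[OF _ B \<kappa>0 f[of k], of s t]) (use assms in auto)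
    then obtain u where u: "\<And>k. fourier_L2 (u k) (packet B (\<kappa> k) (\<lambda>\<xi>. t * norm \<xi> powr s))"
      and E: "\<And>k. ?E k \<in> L2" "\<And>k. AE x in lborel. ?E k x = u k x"
      by metis
    have S: "{x::real^'n. norm x \<le> 1 / 4 * t} \<in> sets borel"
      by (intro borel_closed closed_Collect_le continuous_intros)
    have "(LINT x:{x. norm x \<le> 1 / 4 * t}|lborel. (cmod (?E k x))\<^sup>2)
        = (LINT x:{x. norm x \<le> 1 / 4 * t}|lborel. (cmod (u k x))\<^sup>2)" for k
      unfolding set_lebesgue_integral_def
      using L2_measurable[OF E(1)[of k]] L2_measurable[OF fourier_L2_D(1)[OF u[of k]]] S E(2)[of k]
      by (intro integral_cong_AE) auto
    moreover have "((\<lambda>k. LINT x:{x. norm x \<le> 1 / 4 * t}|lborel. (cmod (u k x))\<^sup>2) \<longlongrightarrow> 0) at_top"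
      by (rule tendsto_int_at_topI, rule packet_escapes[OF assms e1 t \<kappa>1 \<kappa>_lim u[unfolded B_def]])
    ultimately show ?thesis
      by simp
  qed
  show ?thesis
    using unit start escape by (intro exI[of _ f] conjI allI impI exI[of _ "1 / 4"]) auto
qed

end
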